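(* Let $V$ be a real locally integrable function on $\mathbb{R}^n$ such that: (i) for every $\lambda>0$ the Lebesgue measure $\omega_\lambda(a)$ of the set $\{x\in B_a \mid V(x)<\lambda\}$ satisfies $\lim_{a\to\infty}\omega_\lambda(a)=0$; (ii) the negative part $V_-$ of $V$ satisfies $V_-\leq \mu\Delta+\nu$ for some positive real numbers $\mu,\nu$ with $0<\mu<1$. Then the spectrum of the self-adjoint operator $H$ on $L^2(\mathbb{R}^n)$ associated to the form sum $\Delta+V$ is purely discrete.
   Context: $\Delta$ denotes the positive Laplacian on $\mathbb{R}^n$, i.e. $\Delta=-\sum_{j}\partial_j^2\geq 0$. For $a\in\mathbb{R}^n$, $B_a=\{x\in\mathbb{R}^n \mid |x-a|\leq 1\}$ is the closed unit ball centred at $a$; $a\to\infty$ means $|a|\to\infty$. $V_\pm=\max\{\pm V,0\}$, so $V=V_+-V_-$. The inequality in (ii) is understood in the sense of quadratic forms: $\int V_-|f|^2\,\mathrm{d}x\leq \mu\|\nabla f\|^2+\nu\|f\|^2$ for all $f$ in the first order Sobolev space $\mathcal{H}^1(\mathbb{R}^n)$. The form sum $\Delta+V$ is the closed, bounded from below quadratic form $f\mapsto \|\nabla f\|^2+\int V|f|^2\,\mathrm{d}x$ with domain $\{f\in\mathcal{H}^1(\mathbb{R}^n)\mid V_+^{1/2}f\in L^2(\mathbb{R}^n)\}$, and $H$ is the self-adjoint operator associated to it. Purely discrete spectrum means that the essential spectrum is empty. *)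

theory Defs
  imports "HOL-Analysis.Analysis"
begin

section \<open>The Hilbert space of square integrable functions\<close>

text \<open>Elements of the Hilbert space are handled through representatives: two functions
  denote the same element iff they agree almost everywhere.  All notions below are insensitive
  to the choice of representatives, and uniqueness or finite dimension is always meant modulo
  almost everywhere equality.\<close>

definition L2 :: "('a::euclidean_space \<Rightarrow> complex) set" where
  "L2 = {f \<in> borel_measurable lebesgue. integrable lebesgue (\<lambda>x. (cmod (f x))\<^sup>2)}"

definition L2_inner :: "('a::euclidean_space \<Rightarrow> complex) \<Rightarrow> ('a \<Rightarrow> complex) \<Rightarrow> complex" where
  "L2_inner f g = (LINT x|lebesgue. f x * cnj (g x))"

definition L2_norm :: "('a::euclidean_space \<Rightarrow> complex) \<Rightarrow> real" where
  "L2_norm f = sqrt (LINT x|lebesgue. (cmod (f x))\<^sup>2)"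


section \<open>The first order Sobolev space\<close>

text \<open>Membership in the class $C^k$, through iterated partial derivatives.\<close>

primrec Ck :: "nat \<Rightarrow> ('a::euclidean_space \<Rightarrow> real) \<Rightarrow> bool" where
  "Ck 0 \<phi> \<longleftrightarrow> continuous_on UNIV \<phi>"
| "Ck (Suc k) \<phi> \<longleftrightarrow> (\<forall>x. \<phi> differentiable (at x)) \<and>
     (\<forall>b\<in>Basis. Ck k (\<lambda>x. frechet_derivative \<phi> (at x) b))"

definition test_function :: "('a::euclidean_space \<Rightarrow> real) \<Rightarrow> bool" where
  "test_function \<phi> \<longleftrightarrow> (\<forall>k. Ck k \<phi>) \<and> compact (closure {x. \<phi> x \<noteq> 0})"

text \<open>Weak partial derivative in direction \<open>b\<close>.  Testing against real test functions is the same
  as testing against complex ones, by linearity.\<close>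

definition has_weak_pderiv ::
  "('a::euclidean_space \<Rightarrow> complex) \<Rightarrow> 'a \<Rightarrow> ('a \<Rightarrow> complex) \<Rightarrow> bool" where
  "has_weak_pderiv f b g \<longleftrightarrow> (\<forall>\<phi>. test_function \<phi> \<longrightarrow>
     (LINT x|lebesgue. frechet_derivative \<phi> (at x) b *\<^sub>R f x) = - (LINT x|lebesgue. \<phi> x *\<^sub>R g x))"

definition H1 :: "('a::euclidean_space \<Rightarrow> complex) set" where
  "H1 = {f \<in> L2. \<forall>b\<in>Basis. \<exists>g\<in>L2. has_weak_pderiv f b g}"

text \<open>For \<open>f \<in> H1\<close> the choice is unique up to almost everywhere equality.\<close>

definition weak_pderiv :: "'a::euclidean_space \<Rightarrow> ('a \<Rightarrow> complex) \<Rightarrow> 'a \<Rightarrow> complex" where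
  "weak_pderiv b f = (SOME g. g \<in> L2 \<and> has_weak_pderiv f b g)"

definition grad_inner :: "('a::euclidean_space \<Rightarrow> complex) \<Rightarrow> ('a \<Rightarrow> complex) \<Rightarrow> complex" where
  "grad_inner f g = (\<Sum>b\<in>Basis. L2_inner (weak_pderiv b f) (weak_pderiv b g))"

definition grad_norm :: "('a::euclidean_space \<Rightarrow> complex) \<Rightarrow> real" where
  "grad_norm f = sqrt (\<Sum>b\<in>Basis. (L2_norm (weak_pderiv b f))\<^sup>2)"


section \<open>Unbounded operators\<close>

text \<open>An operator is represented by its graph, a set of pairs of representatives
  which is closed under changing either component on a null set.\<close>

type_synonym 'a operator = "(('a \<Rightarrow> complex) \<times> ('a \<Rightarrow> complex)) set"

definition densely_defined :: "'a::euclidean_space operator \<Rightarrow> bool" where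
  "densely_defined H \<longleftrightarrow> (\<forall>f\<in>L2. \<forall>\<epsilon>>0. \<exists>u \<in> Domain H \<inter> L2. L2_norm (\<lambda>x. f x - u x) < \<epsilon>)"

definition adjoint_operator :: "'a::euclidean_space operator \<Rightarrow> 'a operator" where
  "adjoint_operator H =
     {(f, g). f \<in> L2 \<and> g \<in> L2 \<and> (\<forall>(u, v)\<in>H. L2_inner v f = L2_inner u g)}"

definition self_adjoint :: "'a::euclidean_space operator \<Rightarrow> bool" where
  "self_adjoint H \<longleftrightarrow> densely_defined H \<and> adjoint_operator H = H"

text \<open>\<open>z\<close> is in the resolvent set iff \<open>H - z\<close> is a bijection from the domain of \<open>H\<close> onto the
  Hilbert space with bounded inverse; \<open>(H - z) f = g\<close> is written as \<open>H f = g + z f\<close>.\<close>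

definition resolvent_set :: "'a::euclidean_space operator \<Rightarrow> complex set" where
  "resolvent_set H = {z. \<exists>C. \<forall>g\<in>L2. \<exists>f.
     (f, \<lambda>x. g x + z * f x) \<in> H \<and> L2_norm f \<le> C * L2_norm g \<and>
     (\<forall>f'. (f', \<lambda>x. g x + z * f' x) \<in> H \<longrightarrow> (AE x in lebesgue. f' x = f x))}"

definition spectrum :: "'a::euclidean_space operator \<Rightarrow> complex set" where
  "spectrum H = - resolvent_set H"

definition eigenspace :: "'a::euclidean_space operator \<Rightarrow> complex \<Rightarrow> ('a \<Rightarrow> complex) set" where
  "eigenspace H z = {f. (f, \<lambda>x. z * f x) \<in> H}"

definition eigenvalue :: "'a::euclidean_space operator \<Rightarrow> complex \<Rightarrow> bool" where
  "eigenvalue H z \<longleftrightarrow> (\<exists>f\<in>eigenspace H z. \<not> (AE x in lebesgue. f x = 0))"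

definition finite_dimensional :: "('a::euclidean_space \<Rightarrow> complex) set \<Rightarrow> bool" where
  "finite_dimensional E \<longleftrightarrow> (\<exists>B\<subseteq>E. finite B \<and>
     (\<forall>f\<in>E. \<exists>c. AE x in lebesgue. f x = (\<Sum>e\<in>B. c e * e x)))"

text \<open>Isolated eigenvalues of finite multiplicity.  The geometric multiplicity is used, which is
  the appropriate one for self-adjoint operators.\<close>

definition discrete_spectrum :: "'a::euclidean_space operator \<Rightarrow> complex set" where
  "discrete_spectrum H =
     {z. z isolated_in spectrum H \<and> eigenvalue H z \<and> finite_dimensional (eigenspace H z)}"

definition essential_spectrum :: "'a::euclidean_space operator \<Rightarrow> complex set" where
  "essential_spectrum H = spectrum H - discrete_spectrum H"

definition purely_discrete_spectrum :: "'a::euclidean_space operator \<Rightarrow> bool" where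
  "purely_discrete_spectrum H \<longleftrightarrow> essential_spectrum H = {}"


section \<open>The form sum of the Laplacian and a potential\<close>

text \<open>The operator associated to a sesquilinear form \<open>q\<close> with domain \<open>D\<close>, as in the first
  representation theorem.\<close>

definition form_operator ::
  "('a::euclidean_space \<Rightarrow> complex) set \<Rightarrow> (('a \<Rightarrow> complex) \<Rightarrow> ('a \<Rightarrow> complex) \<Rightarrow> complex) \<Rightarrow>
    'a operator" where
  "form_operator D q = {(f, g). f \<in> D \<and> g \<in> L2 \<and> (\<forall>h\<in>D. q f h = L2_inner g h)}"

definition pos_part :: "('a \<Rightarrow> real) \<Rightarrow> 'a \<Rightarrow> real" where
  "pos_part V x = max (V x) 0"

definition neg_part :: "('a \<Rightarrow> real) \<Rightarrow> 'a \<Rightarrow> real" where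
  "neg_part V x = max (- V x) 0"

definition locally_integrable :: "('a::euclidean_space \<Rightarrow> real) \<Rightarrow> bool" where
  "locally_integrable V \<longleftrightarrow> (\<forall>K. compact K \<longrightarrow> V absolutely_integrable_on K)"

text \<open>The inequality \<open>W \<le> \<mu> \<Delta> + \<nu>\<close> in the sense of forms, for \<open>W \<ge> 0\<close>.  The extended integral is
  used so that the inequality includes finiteness of the left hand side.\<close>

definition form_bounded :: "('a::euclidean_space \<Rightarrow> real) \<Rightarrow> real \<Rightarrow> real \<Rightarrow> bool" where
  "form_bounded W \<mu> \<nu> \<longleftrightarrow> (\<forall>f\<in>H1.
     (\<integral>\<^sup>+x. ennreal (W x * (cmod (f x))\<^sup>2) \<partial>lebesgue)
       \<le> ennreal (\<mu> * (grad_norm f)\<^sup>2 + \<nu> * (L2_norm f)\<^sup>2))"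

definition form_sum_domain :: "('a::euclidean_space \<Rightarrow> real) \<Rightarrow> ('a \<Rightarrow> complex) set" where
  "form_sum_domain V = {f \<in> H1. (\<lambda>x. complex_of_real (sqrt (pos_part V x)) * f x) \<in> L2}"

text \<open>The sesquilinear form obtained by polarization from
  $f \mapsto \|\nabla f\|^2 + \int V |f|^2$.\<close>

definition form_sum ::
  "('a::euclidean_space \<Rightarrow> real) \<Rightarrow> ('a \<Rightarrow> complex) \<Rightarrow> ('a \<Rightarrow> complex) \<Rightarrow> complex" where
  "form_sum V f g =
     grad_inner f g + (LINT x|lebesgue. complex_of_real (V x) * f x * cnj (g x))"

definition schroedinger_operator :: "('a::euclidean_space \<Rightarrow> real) \<Rightarrow> 'a operator" where
  "schroedinger_operator V = form_operator (form_sum_domain V) (form_sum V)"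

end

theory Submission
  imports Defs "HOL-Library.Function_Algebras" "HOL-Complex_Analysis.Great_Picard"
begin

text \<open>By (ii), $Q = q + (\nu + 1) \langle\cdot,\cdot\rangle$ is a Hilbert space scalar product on the form
  domain, and Riesz' theorem makes $H + \nu + 1$ surjective; a symmetric operator with this property is
  self-adjoint.  Suppose that the form domain embeds compactly into $L^2$.  Then $H - z$ is bounded below
  as soon as it is injective, so every point of the spectrum is a real eigenvalue.  If eigenvalues
  $z_k \neq z$ converged to $z$, normalised eigenvectors, being orthogonal to $\ker (H - z)$, would
  subconverge to a unit vector of that kernel, which is absurd.

  For the compactness, let $K(x)$ be the integral of $|f(x) - f(x + h)|^2$ over $|h| < 2 \epsilon$.  Since
  translation by $h$ moves $f$ by at most $C |h| \|\nabla f\|$ in $L^2$, the integral of $K$ is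
  $O(\epsilon^{n+2}) \|\nabla f\|^2$.  On a ball $|x| \leq R$, $f(x)$ differs from one of finitely many
  averages of $f$ by an amount controlled by $K(x)$.  Where $V \geq \lambda$, $|f|^2 \leq V_+ |f|^2 / \lambda$.
  On the remaining set $E = \{|x| > R, V < \lambda\}$ compare $f(x)$ with $f(x + h)$ for $|h| < \epsilon$: by
  Fubini, the integral of $|f(x + h)|^2$ over $x \in E$, $|h| < \epsilon$ is at most
  $\sup_y |E \cap B(y, \epsilon)| \, \|f\|^2$, which (i) makes small for large $R$.  Hence $\|f\|^2$ is at most
  a small multiple of $Q(f, f)$ plus finitely many squared functionals of $f$.\<close>

section \<open>Spaces with a complete semi-inner product\<close>

text \<open>Compactness enters only as an inequality: for every \<delta> > 0 the squared norm is at
  most \<delta> times the form plus finitely many squared functionals. This yields both convergent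
  subsequences and finite multiplicity, and it is reached without Fourier transform or
  mollification. Density of smooth functions in \<open>H1\<close> is avoided as well: the
  translation estimate comes from duality, with the translation acting on the test function. The
  obstacle is the order of the constants, since (i) gives no rate and speaks of unit balls only. So
  the averaging radius \<epsilon> <= 1 is fixed first, from \<delta> and the dimension alone; the
  threshold for V and the tolerated measure follow, and then the radius R. Far out V may be small on
  a thin set, where the potential controls nothing; only neighbouring values of f help there. The
  spectral half is carried out over a semi-inner product: instead of forming quotients by null
  functions, vectors of norm zero are carried along, and the graph of the operator is shown to be
  saturated under them.\<close>

text \<open>Only semidefinite: vectors will be representatives of functions modulo null functions.\<close>

locale semi_hilbert = vector_space scale
  for scale :: "complex \<Rightarrow> 'v::ab_group_add \<Rightarrow> 'v" (infixr "\<cdot>" 75) +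
  fixes S :: "'v set" and ip :: "'v \<Rightarrow> 'v \<Rightarrow> complex"
  assumes subspace_carrier: "subspace S"
    and ip_add_left: "\<lbrakk>x \<in> S; y \<in> S; z \<in> S\<rbrakk> \<Longrightarrow> ip (x + y) z = ip x z + ip y z"
    and ip_scale_left: "\<lbrakk>x \<in> S; z \<in> S\<rbrakk> \<Longrightarrow> ip (c \<cdot> x) z = c * ip x z"
    and ip_commute: "\<lbrakk>x \<in> S; y \<in> S\<rbrakk> \<Longrightarrow> ip y x = cnj (ip x y)"
    and ip_self_nonneg: "x \<in> S \<Longrightarrow> 0 \<le> Re (ip x x)"
    and complete: "\<lbrakk>\<And>n::nat. X n \<in> S;
        \<And>e. e > 0 \<Longrightarrow> \<exists>N. \<forall>m\<ge>N. \<forall>n\<ge>N. Re (ip (X m - X n) (X m - X n)) < e\<rbrakk>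
      \<Longrightarrow> \<exists>x\<in>S. (\<lambda>n. Re (ip (X n - x) (X n - x))) \<longlonglongrightarrow> 0"
begin

definition nrm :: "'v \<Rightarrow> real" where
  "nrm x = sqrt (Re (ip x x))"

lemma carrier_closed [simp]:
  "0 \<in> S" "x \<in> S \<Longrightarrow> y \<in> S \<Longrightarrow> x + y \<in> S" "x \<in> S \<Longrightarrow> y \<in> S \<Longrightarrow> x - y \<in> S"
  "x \<in> S \<Longrightarrow> c \<cdot> x \<in> S"
  using subspace_carrier by (auto intro: subspace_0 subspace_add subspace_diff subspace_scale)

lemma ip_add_right: "\<lbrakk>x \<in> S; y \<in> S; z \<in> S\<rbrakk> \<Longrightarrow> ip z (x + y) = ip z x + ip z y"
  by (metis complex_cnj_add ip_add_left ip_commute carrier_closed(2))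

lemma ip_scale_right: "\<lbrakk>x \<in> S; z \<in> S\<rbrakk> \<Longrightarrow> ip z (c \<cdot> x) = cnj c * ip z x"
  by (metis complex_cnj_mult ip_scale_left ip_commute carrier_closed(4))

lemma ip_diff_left: "\<lbrakk>x \<in> S; y \<in> S; z \<in> S\<rbrakk> \<Longrightarrow> ip (x - y) z = ip x z - ip y z"
  by (metis add_diff_cancel diff_add_cancel ip_add_left carrier_closed(3))

lemma ip_diff_right: "\<lbrakk>x \<in> S; y \<in> S; z \<in> S\<rbrakk> \<Longrightarrow> ip z (x - y) = ip z x - ip z y"
  by (metis add_diff_cancel diff_add_cancel ip_add_right carrier_closed(3))

lemmas ip_simps = ip_add_left ip_add_right ip_scale_left ip_scale_right ip_diff_left ip_diff_right

lemma ip_zero [simp]: "x \<in> S \<Longrightarrow> ip 0 x = 0" "x \<in> S \<Longrightarrow> ip x 0 = 0"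
  using ip_diff_left[of x x x] ip_diff_right[of x x x] by auto

lemma nrm_zero [simp]: "nrm 0 = 0"
  by (simp add: nrm_def)

lemma nrm_nonneg: "x \<in> S \<Longrightarrow> 0 \<le> nrm x"
  by (simp add: nrm_def ip_self_nonneg)

lemma nrm_square: "x \<in> S \<Longrightarrow> (nrm x)\<^sup>2 = Re (ip x x)"
  by (simp add: nrm_def ip_self_nonneg)

lemma ip_self: "x \<in> S \<Longrightarrow> ip x x = of_real ((nrm x)\<^sup>2)"
  using ip_commute[of x x] by (simp add: nrm_square complex_eq_iff)

text \<open>The one expansion behind the geometry below: suitable values of \<open>c\<close> turn it
  into orthogonality of minimisers, Cauchy-Schwarz, homogeneity, the triangle inequality and the
  parallelogram law.\<close>

lemma nrm_diff_scale:
  assumes "x \<in> S" "u \<in> S"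
  shows "(nrm (x - c \<cdot> u))\<^sup>2 = (nrm x)\<^sup>2 - 2 * Re (cnj c * ip x u) + (cmod c)\<^sup>2 * (nrm u)\<^sup>2"
proof -
  have "ip (x - c \<cdot> u) (x - c \<cdot> u) = ip x x - (cnj c * ip x u + c * ip u x) + c * cnj c * ip u u"
    using assms by (simp add: ip_simps algebra_simps)
  moreover have "c * ip u x = cnj (cnj c * ip x u)"
    using assms ip_commute[of x u] by simp
  moreover have "Re (c * cnj c * ip u u) = (cmod c)\<^sup>2 * (nrm u)\<^sup>2"
    using assms by (simp only: complex_norm_square[symmetric] ip_self of_real_mult[symmetric] Re_complex_of_real)
  ultimately show ?thesis
    using assms by (simp add: nrm_square)
qed

text \<open>Moving from \<open>x\<close> against \<open>u\<close> by \<open>t\<close> times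
  \<open>ip x u\<close> lowers the squared seminorm by 2 t a at first order and raises it only at
  order t^2, where a is the squared modulus of \<open>ip x u\<close>.\<close>

lemma orthogonal_if_minimal:
  assumes "x \<in> S" "u \<in> S" and min: "\<And>c. nrm x \<le> nrm (x - c \<cdot> u)"
  shows "ip x u = 0"
proof (rule ccontr)
  assume ne: "ip x u \<noteq> 0"
  define a where "a = (cmod (ip x u))\<^sup>2"
  have a: "a > 0" using ne by (simp add: a_def)
  have key: "2 * t * a \<le> t\<^sup>2 * a * (nrm u)\<^sup>2" for t :: real
  proof -
    have "(nrm x)\<^sup>2 \<le> (nrm (x - (of_real t * ip x u) \<cdot> u))\<^sup>2"
      using min assms by (intro power_mono nrm_nonneg) auto
    moreover have "Re (cnj (of_real t * ip x u) * ip x u) = t * a"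
      by (simp add: a_def cmod_power2) (simp add: power2_eq_square algebra_simps)
    moreover have "(cmod (of_real t * ip x u))\<^sup>2 = t\<^sup>2 * a"
      by (simp add: a_def norm_mult power_mult_distrib)
    ultimately show ?thesis
      using assms by (simp add: nrm_diff_scale)
  qed
  \<comment> \<open>Any t > 0 with t |u|^2 < 1 contradicts \<open>key\<close>; the summand 1 covers
    \<open>nrm u = 0\<close>.\<close>
  define t where "t = 1 / ((nrm u)\<^sup>2 + 1)"
  have "(nrm u)\<^sup>2 + 1 > 0" by (rule add_nonneg_pos) auto
  then have t: "t > 0" "t * (nrm u)\<^sup>2 < 1"
    by (auto simp: t_def divide_less_eq)
  have "t\<^sup>2 * a * (nrm u)\<^sup>2 = (t * a) * (t * (nrm u)\<^sup>2)" by (simp add: power2_eq_square)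
  also have "\<dots> < (t * a) * 1" using t a by (intro mult_strict_left_mono) auto
  finally show False using key[of t] t a by simp
qed

lemma Cauchy_Schwarz:
  assumes "x \<in> S" "y \<in> S"
  shows "cmod (ip x y) \<le> nrm x * nrm y"
\<comment> \<open>A nonzero \<open>y\<close> may have seminorm zero, and then no projection
  coefficient exists. Such a \<open>y\<close> is minimal along every line, hence orthogonal to
  everything.\<close>
proof (cases "nrm y = 0")
  case True
  have "ip y x = 0"
  proof (rule orthogonal_if_minimal)
    fix c show "nrm y \<le> nrm (y - c \<cdot> x)" using True nrm_nonneg[of "y - c \<cdot> x"] assms by simp
  qed (use assms in auto)
  then show ?thesis using ip_commute[of y x] assms True by simp
next
  case False
  then have y: "(nrm y)\<^sup>2 > 0" by simp
  define a where "a = (cmod (ip x y))\<^sup>2"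
  \<comment> \<open>The coefficient that minimises \<open>nrm (x - c \<cdot> y)\<close>;
    nonnegativity of the minimum is the inequality.\<close>
  define c where "c = ip x y / of_real ((nrm y)\<^sup>2)"
  have "Re (cnj c * ip x y) = a / (nrm y)\<^sup>2"
    unfolding c_def a_def complex_cnj_divide complex_cnj_complex_of_real times_divide_eq_left
      mult.commute[of "cnj (ip x y)"] complex_norm_square[symmetric] 
    by (metis Re_complex_of_real of_real_divide of_real_power)
  moreover have "(cmod c)\<^sup>2 * (nrm y)\<^sup>2 = a / (nrm y)\<^sup>2"
    using y by (simp add: c_def a_def norm_divide power_divide norm_power) (simp add: power2_eq_square power4_eq_xxxx)
  moreover have "0 \<le> (nrm (x - c \<cdot> y))\<^sup>2" by simp
  ultimately have "a / (nrm y)\<^sup>2 \<le> (nrm x)\<^sup>2"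
    using nrm_diff_scale[OF assms, of c] by linarith
  then have "(cmod (ip x y))\<^sup>2 \<le> (nrm x * nrm y)\<^sup>2"
    using y by (simp add: a_def field_simps power_mult_distrib)
  then show ?thesis
    by (rule power2_le_imp_le) (simp add: assms nrm_nonneg)
qed

lemma nrm_scale: "x \<in> S \<Longrightarrow> nrm (c \<cdot> x) = cmod c * nrm x"
proof -
  assume x: "x \<in> S"
  have "(nrm (c \<cdot> x))\<^sup>2 = (cmod c * nrm x)\<^sup>2"
    using nrm_diff_scale[of 0 x "-c"] x by (simp add: power_mult_distrib)
  then show ?thesis
    using x by (metis abs_of_nonneg carrier_closed(4) mult_nonneg_nonneg norm_ge_zero nrm_nonneg real_sqrt_abs)
qed

lemma nrm_triangle:
  assumes "x \<in> S" "y \<in> S" shows "nrm (x + y) \<le> nrm x + nrm y"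
proof (rule power2_le_imp_le)
  have "(nrm (x + y))\<^sup>2 = (nrm x)\<^sup>2 + 2 * Re (ip x y) + (nrm y)\<^sup>2"
    using nrm_diff_scale[OF assms, of "-1"] by simp
  also have "Re (ip x y) \<le> nrm x * nrm y"
    using Cauchy_Schwarz[OF assms] complex_Re_le_cmod[of "ip x y"] by linarith
  finally show "(nrm (x + y))\<^sup>2 \<le> (nrm x + nrm y)\<^sup>2"
    by (simp add: power2_sum)
qed (use assms in \<open>auto simp: nrm_nonneg\<close>)

lemma nrm_minus_commute: "x \<in> S \<Longrightarrow> y \<in> S \<Longrightarrow> nrm (x - y) = nrm (y - x)"
  using nrm_scale[of "x - y" "-1"] by simp

lemma nrm_triangle_diff:
  assumes "x \<in> S" "y \<in> S" "z \<in> S" shows "nrm (x - z) \<le> nrm (x - y) + nrm (y - z)"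
  using nrm_triangle[of "x - y" "y - z"] assms by simp

lemma parallelogram:
  assumes "x \<in> S" "y \<in> S"
  shows "(nrm (x - y))\<^sup>2 = 2 * (nrm x)\<^sup>2 + 2 * (nrm y)\<^sup>2 - (nrm (x + y))\<^sup>2"
  using nrm_diff_scale[OF assms, of 1] nrm_diff_scale[OF assms, of "-1"] by simp

text \<open>Limits are unique only up to vectors of seminorm zero, so convergence is a relation.
  Membership in \<open>S\<close> is built in because the laws of \<open>ip\<close> hold only
  there.\<close>

definition lim_to :: "(nat \<Rightarrow> 'v) \<Rightarrow> 'v \<Rightarrow> bool" where
  "lim_to X x \<longleftrightarrow> (\<forall>n. X n \<in> S) \<and> x \<in> S \<and> (\<lambda>n. nrm (X n - x)) \<longlonglongrightarrow> 0"

lemma complete_nrm: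
  assumes "\<And>n. X n \<in> S" "\<And>e. e > 0 \<Longrightarrow> \<exists>N. \<forall>m\<ge>N. \<forall>n\<ge>N. nrm (X m - X n) < e"
  shows "\<exists>x. lim_to X x"
proof -
  have "\<exists>N. \<forall>m\<ge>N. \<forall>n\<ge>N. Re (ip (X m - X n) (X m - X n)) < e" if "e > 0" for e
  proof -
    have "sqrt e > 0" using that by simp
    from assms(2)[OF this] show ?thesis by (simp add: nrm_def)
  qed
  from complete[OF assms(1) this] obtain x where
    "x \<in> S" "(\<lambda>n. Re (ip (X n - x) (X n - x))) \<longlonglongrightarrow> 0" by auto
  then have "lim_to X x"
    using assms(1) tendsto_real_sqrt[of "\<lambda>n. Re (ip (X n - x) (X n - x))" 0] by (simp add: lim_to_def nrm_def)
  then show ?thesis by blast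
qed

lemma lim_to_ip_const:
  assumes "lim_to X x" "y \<in> S"
  shows "(\<lambda>n. ip (X n) y) \<longlonglongrightarrow> ip x y"
proof (rule LIM_zero_cancel, rule Lim_null_comparison)
  show "\<forall>\<^sub>F n in sequentially. norm (ip (X n) y - ip x y) \<le> nrm (X n - x) * nrm y"
    using assms Cauchy_Schwarz by (auto simp: lim_to_def ip_diff_left[symmetric])
  show "(\<lambda>n. nrm (X n - x) * nrm y) \<longlonglongrightarrow> 0"
    using assms tendsto_mult_right[of "\<lambda>n. nrm (X n - x)" 0] by (simp add: lim_to_def tendsto_mult_left_zero)
qed

lemma lim_to_ip_const':
  assumes "lim_to X x" "y \<in> S"
  shows "(\<lambda>n. ip y (X n)) \<longlonglongrightarrow> ip y x"
proof -
  have "(\<lambda>n. cnj (ip (X n) y)) \<longlonglongrightarrow> cnj (ip x y)"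
    using lim_to_ip_const[OF assms] by (simp add: lim_cnj)
  moreover have "cnj (ip z y) = ip y z" if "z \<in> S" for z
    using ip_commute[OF that assms(2)] by simp
  ultimately show ?thesis
    using assms(1) by (simp add: lim_to_def)
qed

lemma lim_to_nrm:
  assumes "lim_to X x" shows "(\<lambda>n. nrm (X n)) \<longlonglongrightarrow> nrm x"
proof (rule LIM_zero_cancel, rule Lim_null_comparison)
  have "\<bar>nrm (X n) - nrm x\<bar> \<le> nrm (X n - x)" for n
    using assms nrm_triangle[of "X n - x" x] nrm_triangle[of "x - X n" "X n"] nrm_minus_commute[of x "X n"]
    by (auto simp: lim_to_def)
  then show "\<forall>\<^sub>F n in sequentially. norm (nrm (X n) - nrm x) \<le> nrm (X n - x)" by simp
  show "(\<lambda>n. nrm (X n - x)) \<longlonglongrightarrow> 0" using assms by (simp add: lim_to_def)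
qed

lemma lim_to_add:
  assumes "lim_to X x" "lim_to Y y" shows "lim_to (\<lambda>n. X n + Y n) (x + y)"
  unfolding lim_to_def
proof (intro conjI allI)
  show "(\<lambda>n. nrm (X n + Y n - (x + y))) \<longlonglongrightarrow> 0"
  proof (rule Lim_null_comparison)
    have "nrm (X n + Y n - (x + y)) \<le> nrm (X n - x) + nrm (Y n - y)" for n
      using assms nrm_triangle[of "X n - x" "Y n - y"] by (simp add: lim_to_def algebra_simps)
    then show "\<forall>\<^sub>F n in sequentially. norm (nrm (X n + Y n - (x + y))) \<le> nrm (X n - x) + nrm (Y n - y)"
      using assms by (auto simp: lim_to_def nrm_nonneg)
    show "(\<lambda>n. nrm (X n - x) + nrm (Y n - y)) \<longlonglongrightarrow> 0"
      using assms tendsto_add[of "\<lambda>n. nrm (X n - x)" 0 _ "\<lambda>n. nrm (Y n - y)" 0] by (simp add: lim_to_def)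
  qed
qed (use assms in \<open>auto simp: lim_to_def\<close>)

lemma lim_to_scale:
  assumes "lim_to X x" shows "lim_to (\<lambda>n. c \<cdot> X n) (c \<cdot> x)"
  using assms tendsto_mult_right_zero[of "\<lambda>n. nrm (X n - x)" sequentially "cmod c"]
  by (simp add: lim_to_def nrm_scale scale_right_diff_distrib[symmetric])

text \<open>\<open>R\<close> may fail to be closed, so the foot \<open>p\<close> of the
  perpendicular lies only in its closure. The approximating sequence \<open>r\<close> is returned
  because later arguments carry equations and bounds from \<open>R\<close> over to \<open>p\<close>.
  A minimising sequence is Cauchy by the parallelogram law, and minimality of the limit gives
  orthogonality.\<close>

lemma projection:
  assumes R: "subspace R" "R \<subseteq> S" and g: "g \<in> S"
  shows "\<exists>p r. (\<forall>n. r n \<in> R) \<and> lim_to r p \<and> (\<forall>u\<in>R. ip (g - p) u = 0)"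
proof -
  define d where "d = Inf ((\<lambda>u. nrm (g - u)) ` R)"
  have RS: "u \<in> R \<Longrightarrow> u \<in> S" for u using R by auto
  have bdd: "bdd_below ((\<lambda>u. nrm (g - u)) ` R)"
    using g RS by (intro bdd_belowI[of _ 0]) (auto intro: nrm_nonneg)
  have ne: "(\<lambda>u. nrm (g - u)) ` R \<noteq> {}" using subspace_0[OF R(1)] by auto
  have d_le: "d \<le> nrm (g - u)" if "u \<in> R" for u
    unfolding d_def using bdd that by (intro cInf_lower) auto
  have d0: "0 \<le> d" unfolding d_def using ne g RS by (intro cInf_greatest) (auto intro: nrm_nonneg)
  have "\<exists>u\<in>R. nrm (g - u) < d + 1 / Suc n" for n
  proof -
    have "d < d + 1 / Suc n" by simp
    then show ?thesis using cInf_lessD[OF ne, of "d + 1 / Suc n"] by (auto simp: d_def)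
  qed
  then obtain r where r: "\<And>n. r n \<in> R" "\<And>n. nrm (g - r n) < d + 1 / Suc n" by metis
  have rS [simp]: "r n \<in> S" for n using r RS by auto
  have cauchy: "(nrm (r m - r n))\<^sup>2 \<le> (4 * d + 2) * (1 / Suc m + 1 / Suc n)" for m n
  proof -
    \<comment> \<open>The midpoint lies in \<open>R\<close>, so its distance to \<open>g\<close> is
      at least \<open>d\<close>; this bounds the subtracted term of the parallelogram law from
      below.\<close>
    define v where "v = (1/2) \<cdot> (r m + r n)"
    have vR: "v \<in> R" using r R unfolding v_def by (intro subspace_scale subspace_add) auto
    have half: "(g - r m) + (g - r n) = 2 \<cdot> (g - v)"
    proof -
      have "2 \<cdot> v = r m + r n" by (simp add: v_def)
      moreover have "2 \<cdot> g = g + g" using scale_left_distrib[of 1 1 g] by simp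
      ultimately show ?thesis by (simp add: scale_right_diff_distrib)
    qed
    have "nrm ((g - r m) + (g - r n)) = 2 * nrm (g - v)"
      unfolding half using g RS[OF vR] by (simp add: nrm_scale)
    then have "nrm ((g - r m) + (g - r n)) \<ge> 2 * d" using d_le[OF vR] by simp
    then have "(nrm ((g - r m) + (g - r n)))\<^sup>2 \<ge> (2 * d)\<^sup>2" using d0 by (intro power_mono) auto
    moreover have sq: "(nrm (g - r n))\<^sup>2 \<le> d\<^sup>2 + (2 * d + 1) * (1 / Suc n)" for n
    proof -
      have "(nrm (g - r n))\<^sup>2 \<le> (d + 1 / Suc n)\<^sup>2"
        using g less_imp_le[OF r(2)] by (intro power_mono nrm_nonneg) auto
      also have "\<dots> = d\<^sup>2 + 2 * d * (1 / Suc n) + (1 / Suc n) * (1 / Suc n)"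
        by (simp add: power2_eq_square algebra_simps add_divide_distrib)
      also have "(1 / Suc n) * (1 / Suc n) \<le> 1 * (1 / real (Suc n))"
        by (intro mult_right_mono) auto
      finally show ?thesis by (simp add: algebra_simps)
    qed
    moreover have "(nrm (r n - r m))\<^sup>2 = 2 * (nrm (g - r m))\<^sup>2 + 2 * (nrm (g - r n))\<^sup>2 - (nrm ((g - r m) + (g - r n)))\<^sup>2"
      using parallelogram[of "g - r m" "g - r n"] g by simp
    moreover have four: "(2 * d)\<^sup>2 = 4 * d\<^sup>2" by (simp add: power_mult_distrib)
    moreover have "(nrm (r m - r n))\<^sup>2 = (nrm (r n - r m))\<^sup>2" by (simp add: nrm_minus_commute)
    ultimately have "(nrm (r m - r n))\<^sup>2 \<le> 2 * ((2 * d + 1) * (1 / Suc m)) + 2 * ((2 * d + 1) * (1 / Suc n))"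
      using sq[of m] sq[of n] four by linarith
    also have "\<dots> = (4 * d + 2) * (1 / Suc m + 1 / Suc n)" by algebra
    finally show ?thesis .
  qed
  have "\<exists>p. lim_to r p"
  proof (rule complete_nrm)
    fix e :: real assume e: "e > 0"
    have "(\<lambda>n. (4 * d + 2) * (2 * (1 / Suc n))) \<longlonglongrightarrow> (4 * d + 2) * (2 * 0)"
      by (intro tendsto_intros LIMSEQ_Suc lim_1_over_n)
    then have "\<forall>\<^sub>F n in sequentially. (4 * d + 2) * (2 * (1 / Suc n)) < e\<^sup>2"
      using e by (intro order_tendstoD(2)) auto
    then obtain N where N: "(4 * d + 2) * (2 * (1 / Suc N)) < e\<^sup>2"
      by (auto simp: eventually_sequentially)
    have "nrm (r m - r n) < e" if "m \<ge> N" "n \<ge> N" for m n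
    proof -
      have "1 / Suc m + 1 / Suc n \<le> 2 * (1 / real (Suc N))"
        using that frac_le[of 1 1 "real (Suc N)" "real (Suc m)"] frac_le[of 1 1 "real (Suc N)" "real (Suc n)"]
        by linarith
      then have "(4 * d + 2) * (1 / Suc m + 1 / Suc n) \<le> (4 * d + 2) * (2 * (1 / Suc N))"
        by (rule mult_left_mono) (use d0 in simp)
      then have "(nrm (r m - r n))\<^sup>2 < e\<^sup>2"
        by (rule order.strict_trans1[OF order.trans[OF cauchy] N])
      then show ?thesis by (rule power2_less_imp_less) (use e in simp)
    qed
    then show "\<exists>N. \<forall>m\<ge>N. \<forall>n\<ge>N. nrm (r m - r n) < e" by blast
  qed simp
  then obtain p where p: "lim_to r p" by blast
  have pS: "p \<in> S" using p by (simp add: lim_to_def)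
  have lim_diff: "(\<lambda>n. nrm (x - r n)) \<longlonglongrightarrow> nrm (x - p)" if "x \<in> S" for x
  proof -
    have "lim_to (\<lambda>n. x + (-1) \<cdot> r n) (x + (-1) \<cdot> p)"
      using p that by (intro lim_to_add lim_to_scale) (auto simp: lim_to_def)
    from lim_to_nrm[OF this] show ?thesis by simp
  qed
  have "nrm (g - p) \<le> d"
  proof (rule LIMSEQ_le[OF lim_diff[OF g]])
    show "(\<lambda>n. d + 1 / real (Suc n)) \<longlonglongrightarrow> d"
      using tendsto_add[OF tendsto_const LIMSEQ_Suc[OF lim_1_over_n], of d] by simp
    show "\<exists>N. \<forall>n\<ge>N. nrm (g - r n) \<le> d + 1 / real (Suc n)"
      using r by (auto intro!: exI[of _ 0] less_imp_le simp del: of_nat_Suc)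
  qed
  moreover have "d \<le> nrm (g - p - c \<cdot> u)" if "u \<in> R" for u c
  proof (rule LIMSEQ_le_const)
    show "(\<lambda>n. nrm (g - c \<cdot> u - r n)) \<longlonglongrightarrow> nrm (g - p - c \<cdot> u)"
      using lim_diff[of "g - c \<cdot> u"] g RS[OF that] by (simp add: algebra_simps)
    have "r n + c \<cdot> u \<in> R" for n using r R that by (auto intro: subspace_add subspace_scale)
    from d_le[OF this] show "\<exists>N. \<forall>n\<ge>N. d \<le> nrm (g - c \<cdot> u - r n)"
      by (simp add: algebra_simps)
  qed
  ultimately have "nrm (g - p) \<le> nrm (g - p - c \<cdot> u)" if "u \<in> R" for u c
    using that order_trans by blast
  then have "ip (g - p) u = 0" if "u \<in> R" for u
    using that g pS RS by (intro orthogonal_if_minimal) simp_all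
  then show ?thesis by (intro exI[of _ p] exI[of _ r] conjI ballI allI r p)
qed

text \<open>The representing vector is a multiple of \<open>w\<close>, the component orthogonal to
  the kernel of some \<open>g\<close> with \<open>l g\<close> nonzero. Projection places
  \<open>p\<close> only in the closure of the kernel; boundedness of \<open>l\<close> brings it back
  into the kernel. The second slot is antilinear, whence the conjugate in the multiple.\<close>

lemma Riesz:
  assumes add: "\<And>x y. x \<in> S \<Longrightarrow> y \<in> S \<Longrightarrow> l (x + y) = l x + l y"
    and scale: "\<And>c x. x \<in> S \<Longrightarrow> l (c \<cdot> x) = c * l x"
    and bdd: "\<And>x. x \<in> S \<Longrightarrow> cmod (l x) \<le> C * nrm x"
  shows "\<exists>w\<in>S. \<forall>x\<in>S. l x = ip x w"
proof (cases "\<exists>g\<in>S. l g \<noteq> 0")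
  case False
  then show ?thesis by (intro bexI[of _ 0]) auto
next
  case True
  then obtain g where g: "g \<in> S" "l g \<noteq> 0" by auto
  define K where "K = {x\<in>S. l x = 0}"
  have l0: "l 0 = 0" using scale[of 0 0] by simp
  have diff: "l (x - y) = l x - l y" if "x \<in> S" "y \<in> S" for x y
    using add[of "x - y" y] that by simp
  have K: "subspace K" "K \<subseteq> S"
    by (auto simp: K_def intro!: subspaceI simp: l0 add scale)
  obtain p r where p: "\<And>n. r n \<in> K" "lim_to r p" "\<And>u. u \<in> K \<Longrightarrow> ip (g - p) u = 0"
    using projection[OF K g(1)] by auto
  have pS: "p \<in> S" and rS: "r n \<in> S" for n using p by (auto simp: lim_to_def)
  have "(\<lambda>n. l (r n) - l p) \<longlonglongrightarrow> 0"
  proof (rule Lim_null_comparison)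
    show "\<forall>\<^sub>F n in sequentially. norm (l (r n) - l p) \<le> C * nrm (r n - p)"
      using bdd rS pS by (simp add: diff[symmetric])
    show "(\<lambda>n. C * nrm (r n - p)) \<longlonglongrightarrow> 0"
      using p(2) by (simp add: lim_to_def tendsto_mult_right_zero)
  qed
  moreover have "l (r n) - l p = - l p" for n using p(1) by (simp add: K_def)
  ultimately have lp: "l p = 0" by (simp add: LIMSEQ_const_iff)
  define w where "w = g - p"
  have w: "w \<in> S" "l w \<noteq> 0" using g pS lp by (auto simp: w_def diff)
  \<comment> \<open>In a semidefinite space a nonzero vector can have seminorm zero; here the bound
    on \<open>l\<close> excludes it.\<close>
  have nw: "nrm w \<noteq> 0" using bdd[OF w(1)] w(2) by auto
  have "l x = ip x (cnj (l w / ip w w) \<cdot> w)" if x: "x \<in> S" for x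
  proof -
    have "x - (l x / l w) \<cdot> w \<in> K" using x w by (simp add: K_def diff scale)
    then have "ip w (x - (l x / l w) \<cdot> w) = 0" using p(3) by (simp add: w_def)
    then have "ip (x - (l x / l w) \<cdot> w) w = 0" 
      using x w ip_commute[of w "x - (l x / l w) \<cdot> w"] by simp
    then have "ip x w = (l x / l w) * ip w w" using x w by (simp add: ip_simps)
    moreover have "ip w w \<noteq> 0" using nw w(1) by (simp add: ip_self)
    ultimately show ?thesis using x w by (simp add: ip_simps)
  qed
  then show ?thesis using w(1) carrier_closed(4) by blast
qed

end

section \<open>Operators of closed forms with compact embedding\<close>

lemma (in semi_hilbert) lim_to_Cauchy:
  assumes "lim_to X x" "e > 0"
  shows "\<exists>N. \<forall>m\<ge>N. \<forall>n\<ge>N. nrm (X m - X n) < e"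
proof -
  have "\<forall>\<^sub>F n in sequentially. nrm (X n - x) < e / 2"
    using assms by (intro order_tendstoD(2)) (auto simp: lim_to_def)
  then obtain N where N: "\<And>n. n \<ge> N \<Longrightarrow> nrm (X n - x) < e / 2" by (auto simp: eventually_sequentially)
  have "nrm (X m - X n) < e" if "m \<ge> N" "n \<ge> N" for m n
    using nrm_triangle_diff[of "X m" x "X n"] nrm_minus_commute[of x "X n"] N[OF that(1)] N[OF that(2)] assms
    by (simp add: lim_to_def)
  then show ?thesis by blast
qed

lemma (in semi_hilbert) lim_to_zeroI:
  assumes "\<And>n. X n \<in> S" "\<And>n. nrm (X n) \<le> 1 / real (Suc n)"
  shows "lim_to X 0"
proof -
  have "(\<lambda>n. nrm (X n)) \<longlonglongrightarrow> 0"
  proof (rule Lim_null_comparison)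
    show "\<forall>\<^sub>F n in sequentially. norm (nrm (X n)) \<le> 1 / real (Suc n)"
      using assms nrm_nonneg by (intro always_eventually) simp
    show "(\<lambda>n. 1 / real (Suc n)) \<longlonglongrightarrow> 0" by (rule LIMSEQ_Suc[OF lim_1_over_n])
  qed
  then show ?thesis using assms(1) by (simp add: lim_to_def)
qed

text \<open>Each functional given by some \<open>e\<close> lowers the dimension by at most one: its
  kernel in \<open>N\<close> is spanned by induction, and a single vector of \<open>N\<close>
  outside the kernel completes the span.\<close>

lemma (in semi_hilbert) finite_dimensional_if_separated:
  assumes "finite F" "F \<subseteq> S" "subspace N" "N \<subseteq> S"
    and "\<And>f. f \<in> N \<Longrightarrow> (\<And>e. e \<in> F \<Longrightarrow> ip f e = 0) \<Longrightarrow> nrm f = 0"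
  shows "\<exists>B\<subseteq>N. finite B \<and> (\<forall>f\<in>N. \<exists>c. nrm (f - (\<Sum>b\<in>B. c b \<cdot> b)) = 0)"
  using assms
proof (induction F arbitrary: N rule: finite_induct)
  case empty
  then show ?case by (intro exI[of _ "{}"]) simp
next
  case (insert e F)
  have eS: "e \<in> S" using insert.prems by simp
  have NS: "f \<in> N \<Longrightarrow> f \<in> S" for f using insert.prems by auto
  define N' where "N' = {f\<in>N. ip f e = 0}"
  have N': "subspace N'" "N' \<subseteq> S"
  proof (rule subspaceI)
    show "0 \<in> N'" using eS subspace_0[OF insert.prems(2)] by (simp add: N'_def)
  next
    fix f g assume "f \<in> N'" "g \<in> N'"
    then show "f + g \<in> N'" using eS NS subspace_add[OF insert.prems(2)] by (simp add: N'_def ip_simps)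
  next
    fix a f assume "f \<in> N'"
    then show "a \<cdot> f \<in> N'" using eS NS subspace_scale[OF insert.prems(2)] by (simp add: N'_def ip_simps)
  qed (use NS in \<open>auto simp: N'_def\<close>)
  have "\<exists>B\<subseteq>N'. finite B \<and> (\<forall>f\<in>N'. \<exists>c. nrm (f - (\<Sum>b\<in>B. c b \<cdot> b)) = 0)"
  proof (rule insert.IH[OF _ N'])
    show "F \<subseteq> S" using insert.prems(1) by simp
    fix f assume "f \<in> N'" "\<And>e. e \<in> F \<Longrightarrow> ip f e = 0"
    then show "nrm f = 0" by (intro insert.prems(4)) (auto simp: N'_def)
  qed
  then obtain B where B: "B \<subseteq> N'" "finite B" "\<And>f. f \<in> N' \<Longrightarrow> \<exists>c. nrm (f - (\<Sum>b\<in>B. c b \<cdot> b)) = 0"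
    by metis
  show ?case
  proof (cases "N' = N")
    case True
    then show ?thesis using B by (intro exI[of _ B]) auto
  next
    case False
    then obtain n0 where n0: "n0 \<in> N" "ip n0 e \<noteq> 0" by (auto simp: N'_def)
    have "n0 \<notin> B" using n0 B(1) by (auto simp: N'_def)
    have "\<exists>c. nrm (f - (\<Sum>b\<in>insert n0 B. c b \<cdot> b)) = 0" if f: "f \<in> N" for f
    proof -
      define a where "a = ip f e / ip n0 e"
      have "f - a \<cdot> n0 \<in> N'"
        using subspace_diff[OF insert.prems(2) f subspace_scale[OF insert.prems(2) n0(1), of a]] f n0 eS NS
        by (simp add: N'_def a_def ip_simps)
      from B(3)[OF this] obtain c where c: "nrm (f - a \<cdot> n0 - (\<Sum>b\<in>B. c b \<cdot> b)) = 0" by blast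
      have "(\<Sum>b\<in>B. (c(n0 := a)) b \<cdot> b) = (\<Sum>b\<in>B. c b \<cdot> b)"
        using \<open>n0 \<notin> B\<close> by (intro sum.cong) auto
      then have "nrm (f - (\<Sum>b\<in>insert n0 B. (c(n0 := a)) b \<cdot> b)) = 0"
        using c B(2) \<open>n0 \<notin> B\<close> by (simp add: diff_diff_eq)
      then show ?thesis by blast
    qed
    then show ?thesis using B n0 by (intro exI[of _ "insert n0 B"]) (auto simp: N'_def)
  qed
qed

text \<open>Closedness of the form is completeness of \<open>D\<close> under the shifted form.
  \<open>null\<close> makes \<open>D\<close> insensitive to the choice of representatives,
  \<open>dense\<close> expresses density through orthogonality, and \<open>compact_embedding\<close>
  says that finitely many functionals control the norm of \<open>L\<close> up to a small multiple of
  the form.\<close>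

locale form_space =
  L: semi_hilbert scale L ip + D: semi_hilbert scale D "\<lambda>f g. q f g + complex_of_real c * ip f g"
  for scale :: "complex \<Rightarrow> 'v::ab_group_add \<Rightarrow> 'v" (infixr "\<cdot>" 75)
    and L :: "'v set" and ip :: "'v \<Rightarrow> 'v \<Rightarrow> complex"
    and D :: "'v set" and q :: "'v \<Rightarrow> 'v \<Rightarrow> complex" and c :: real +
  assumes D_subset: "D \<subseteq> L"
    and nrm_le: "f \<in> D \<Longrightarrow> Re (ip f f) \<le> Re (q f f + c * ip f f)"
    and null: "f \<in> L \<Longrightarrow> ip f f = 0 \<Longrightarrow> f \<in> D \<and> q f f + c * ip f f = 0"
    and dense: "g \<in> L \<Longrightarrow> (\<And>f. f \<in> D \<Longrightarrow> ip g f = 0) \<Longrightarrow> ip g g = 0"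
    and compact_embedding: "\<delta> > 0 \<Longrightarrow> \<exists>F C. finite F \<and> F \<subseteq> L \<and> 0 \<le> C \<and> (\<forall>f\<in>D. Re (ip f f) \<le>
      \<delta> * Re (q f f + c * ip f f) + C * (\<Sum>e\<in>F. (cmod (ip f e))\<^sup>2))"
begin

lemma D_L [simp]: "f \<in> D \<Longrightarrow> f \<in> L"
  using D_subset by auto

lemma nrm_eq_0_iff: "f \<in> L \<Longrightarrow> L.nrm f = 0 \<longleftrightarrow> ip f f = 0"
  by (simp add: L.ip_self)

lemma nrm_le': "f \<in> D \<Longrightarrow> L.nrm f \<le> D.nrm f"
  using nrm_le by (simp add: L.nrm_def D.nrm_def)

lemma q_commute: "f \<in> D \<Longrightarrow> g \<in> D \<Longrightarrow> q g f = cnj (q f g)"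
  using D.ip_commute[of f g] L.ip_commute[of f g] by simp

lemma q_add_left: "f \<in> D \<Longrightarrow> g \<in> D \<Longrightarrow> h \<in> D \<Longrightarrow> q (f + g) h = q f h + q g h"
  using D.ip_add_left[of f g h] L.ip_add_left[of f g h] by (simp add: algebra_simps)

lemma q_scale_left: "f \<in> D \<Longrightarrow> h \<in> D \<Longrightarrow> q (a \<cdot> f) h = a * q f h"
  using D.ip_scale_left[of f h a] L.ip_scale_left[of f h a] by (simp add: algebra_simps)

definition H :: "('v \<times> 'v) set" where
  "H = {(f, g). f \<in> D \<and> g \<in> L \<and> (\<forall>h\<in>D. q f h = ip g h)}"

lemma H_D: "(f, g) \<in> H \<Longrightarrow> f \<in> D" "(f, g) \<in> H \<Longrightarrow> f \<in> L" "(f, g) \<in> H \<Longrightarrow> g \<in> L"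
  "(f, g) \<in> H \<Longrightarrow> h \<in> D \<Longrightarrow> q f h = ip g h"
  by (auto simp: H_def)

lemma H_add: "(f, g) \<in> H \<Longrightarrow> (f', g') \<in> H \<Longrightarrow> (f + f', g + g') \<in> H"
  by (auto simp: H_def q_add_left L.ip_add_left)

lemma H_scale: "(f, g) \<in> H \<Longrightarrow> (a \<cdot> f, a \<cdot> g) \<in> H"
  by (auto simp: H_def q_scale_left L.ip_scale_left)

lemma H_diff: "(f, g) \<in> H \<Longrightarrow> (f', g') \<in> H \<Longrightarrow> (f - f', g - g') \<in> H"
  using H_add[OF _ H_scale[of f' g' "-1"]] by force

lemma H_zero: "(0, 0) \<in> H"
  using q_scale_left[of 0 _ 0] by (auto simp: H_def)

section \<open>Self-adjointness of the operator of the form\<close>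

lemma H_symmetric:
  assumes "(f, g) \<in> H" "(u, v) \<in> H" shows "ip g u = ip f v"
proof -
  have "ip g u = cnj (q u f)" using assms q_commute[of u f] by (simp add: H_def)
  also have "\<dots> = ip f v" using assms L.ip_commute[of v f] by (simp add: H_def)
  finally show ?thesis .
qed

lemma H_solve:
  assumes g: "g \<in> L" shows "\<exists>f. (f, g - of_real c \<cdot> f) \<in> H"
proof -
  have "\<exists>w\<in>D. \<forall>x\<in>D. ip x g = q x w + c * ip x w"
  proof (rule D.Riesz)
    fix x assume x: "x \<in> D"
    have "cmod (ip x g) \<le> L.nrm x * L.nrm g" using x g by (intro L.Cauchy_Schwarz) auto
    also have "\<dots> \<le> L.nrm g * D.nrm x"
      using nrm_le'[OF x] g by (subst mult.commute) (intro mult_left_mono L.nrm_nonneg)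
    finally show "cmod (ip x g) \<le> L.nrm g * D.nrm x" .
  qed (use g in \<open>simp_all add: L.ip_simps\<close>)
  then obtain w where w: "w \<in> D" "\<And>x. x \<in> D \<Longrightarrow> ip x g = q x w + c * ip x w" by blast
  have "q w x = ip (g - of_real c \<cdot> w) x" if x: "x \<in> D" for x
  proof -
    \<comment> \<open>Riesz puts \<open>w\<close> into the antilinear slot; conjugation moves it to
      the left, where \<open>H\<close> expects its argument.\<close>
    have "cnj (ip x g) = cnj (q x w) + c * cnj (ip x w)" using w(2)[OF x] by simp
    then have "ip g x = q w x + c * ip w x"
      using q_commute[of x w] L.ip_commute[of x w] L.ip_commute[of x g] x w(1) g by simp
    then show ?thesis using x w(1) g by (simp add: L.ip_simps)
  qed
  then have "(w, g - of_real c \<cdot> w) \<in> H" using w(1) g by (auto simp: H_def)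
  then show ?thesis by blast
qed

lemma ip_null: "f \<in> L \<Longrightarrow> g \<in> L \<Longrightarrow> L.nrm f = 0 \<Longrightarrow> ip f g = 0"
  using L.Cauchy_Schwarz[of f g] by simp

text \<open>By \<open>null\<close> the form norm of \<open>f\<close> vanishes too, and
  Cauchy-Schwarz in \<open>D\<close> does the rest.\<close>

lemma q_null: 
  assumes "f \<in> L" "L.nrm f = 0" "h \<in> D" shows "f \<in> D" "q f h = 0"
proof -
  show f: "f \<in> D" using null[of f] assms by (simp add: nrm_eq_0_iff)
  have "D.nrm f = 0" using null[of f] assms by (simp add: nrm_eq_0_iff D.nrm_def)
  then have "q f h + c * ip f h = 0" using D.Cauchy_Schwarz[OF f assms(3)] by simp
  then show "q f h = 0" using ip_null[of f h] assms by simp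
qed

text \<open>The pair of differences is itself in \<open>H\<close>, as both forms vanish on null
  vectors. Equality with the adjoint, which is saturated in this way, would be false
  otherwise.\<close>

lemma H_null:
  assumes "(f, g) \<in> H" "f' \<in> L" "g' \<in> L" "L.nrm (f' - f) = 0" "L.nrm (g' - g) = 0"
  shows "(f', g') \<in> H"
proof -
  note H_D[OF assms(1), simp]
  have "(f' - f, g' - g) \<in> H"
    using assms q_null[of "f' - f" "0"] q_null(2)[of "f' - f"] ip_null[of "g' - g"] by (auto simp: H_def)
  from H_add[OF this assms(1)] show ?thesis by simp
qed

text \<open>For (f, g) in the adjoint let \<open>w\<close> solve (H + c) w = g + c f. Every
  \<open>x\<close> in \<open>L\<close> is (H + c) u for some \<open>u\<close>, and testing with this
  \<open>u\<close> gives \<open>ip x f = ip x w\<close>; so \<open>f\<close> and \<open>w\<close>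
  differ by a null vector.\<close>

lemma H_adjoint: "{(f, g). f \<in> L \<and> g \<in> L \<and> (\<forall>(u, v)\<in>H. ip v f = ip u g)} = H"
proof (intro equalityI subrelI)
  fix f g assume "(f, g) \<in> H"
  then show "(f, g) \<in> {(f, g). f \<in> L \<and> g \<in> L \<and> (\<forall>(u, v)\<in>H. ip v f = ip u g)}"
    using H_symmetric H_D by auto
next
  fix f g assume "(f, g) \<in> {(f, g). f \<in> L \<and> g \<in> L \<and> (\<forall>(u, v)\<in>H. ip v f = ip u g)}"
  then have fg: "f \<in> L" "g \<in> L" "\<And>u v. (u, v) \<in> H \<Longrightarrow> ip v f = ip u g" by auto
  obtain w where w: "(w, g + of_real c \<cdot> f - of_real c \<cdot> w) \<in> H"
    using H_solve[of "g + of_real c \<cdot> f"] fg by auto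
  note wD = H_D(1,2)[OF w]
  have "ip x (f - w) = 0" if x: "x \<in> L" for x
  proof -
    obtain u where u: "(u, x - of_real c \<cdot> u) \<in> H" using H_solve[OF x] by blast
    note uD = H_D(1,2)[OF u]
    have "ip x f = ip u g + c * ip u f" using fg(3)[OF u] fg(1,2) x uD by (simp add: L.ip_simps algebra_simps)
    moreover have "ip x w = ip u g + c * ip u f"
      using H_symmetric[OF u w] fg(1,2) x uD wD by (simp add: L.ip_simps algebra_simps)
    ultimately show ?thesis using x fg(1,2) wD by (simp add: L.ip_simps)
  qed
  then have "L.nrm (f - w) = 0" using fg(1,2) wD by (simp add: nrm_eq_0_iff)
  moreover have "L.nrm (g - (g + of_real c \<cdot> f - of_real c \<cdot> w)) = 0"
  proof -
    have "g - (g + of_real c \<cdot> f - of_real c \<cdot> w) = of_real c \<cdot> (w - f)"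
      by (simp add: algebra_simps L.scale_right_diff_distrib)
    then show ?thesis
      using \<open>L.nrm (f - w) = 0\<close> L.nrm_minus_commute[of f w] fg(1,2) wD by (simp add: L.nrm_scale)
  qed
  ultimately show "(f, g) \<in> H" using H_null[OF w] fg by blast
qed

lemma H_adjointI:
  assumes "f \<in> L" "g \<in> L" "\<And>u v. (u, v) \<in> H \<Longrightarrow> ip v f = ip u g"
  shows "(f, g) \<in> H"
  using assms by (subst H_adjoint[symmetric]) auto

text \<open>The residual \<open>f - p\<close> of the projection onto the closure of the domain
  equals (H + c) w for some \<open>w\<close> in the domain. Its orthogonality to \<open>w\<close>
  makes the shifted form vanish at \<open>w\<close>, so \<open>w\<close> is null,
  \<open>f - p\<close> is orthogonal to all of \<open>D\<close>, and \<open>dense\<close>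
  applies.\<close>

lemma H_densely_defined:
  assumes f: "f \<in> L" and "\<epsilon> > 0"
  shows "\<exists>u\<in>Domain H. u \<in> L \<and> L.nrm (f - u) < \<epsilon>"
proof -
  have R: "L.subspace (Domain H)" "Domain H \<subseteq> L"
    using H_zero H_add H_scale H_D by (auto intro!: L.subspaceI) blast+
  from L.projection[OF this f] obtain p r where p: "\<And>n. r n \<in> Domain H" "L.lim_to r p"
     "\<And>u. u \<in> Domain H \<Longrightarrow> ip (f - p) u = 0" by blast
  have pL: "p \<in> L" and rL: "r n \<in> L" for n using p(2) by (auto simp: L.lim_to_def)
  obtain w where w: "(w, f - p - of_real c \<cdot> w) \<in> H" using H_solve[of "f - p"] f pL by auto
  note wD = H_D(1,2)[OF w]
  have w0: "ip (f - p) w = 0" using p(3) w by auto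
  have "q w w = ip (f - p - of_real c \<cdot> w) w" using H_D(4)[OF w wD(1)] .
  then have "q w w + c * ip w w = 0" using w0 f pL wD by (simp add: L.ip_simps)
  then have "L.nrm w = 0" using nrm_le[OF wD(1)] L.ip_self_nonneg[OF wD(2)] by (simp add: L.nrm_def)
  have "ip (f - p) h = 0" if h: "h \<in> D" for h
  proof -
    have "q w h = ip (f - p - of_real c \<cdot> w) h" by (rule H_D(4)[OF w h])
    moreover have "q w h = 0" "ip w h = 0" using q_null[of w h] ip_null[of w h] wD h \<open>L.nrm w = 0\<close> by auto
    ultimately show ?thesis using f pL wD h by (simp add: L.ip_simps)
  qed
  then have "L.nrm (f - p) = 0" using dense[of "f - p"] f pL by (simp add: nrm_eq_0_iff)
  moreover have "\<forall>\<^sub>F n in sequentially. L.nrm (r n - p) < \<epsilon>"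
    using p(2) \<open>\<epsilon> > 0\<close> by (intro order_tendstoD(2)) (auto simp: L.lim_to_def)
  then obtain n where "L.nrm (r n - p) < \<epsilon>" by (auto simp: eventually_sequentially)
  ultimately have "L.nrm (f - r n) < \<epsilon>"
    using L.nrm_triangle_diff[of f p "r n"] L.nrm_minus_commute[of p "r n"] f pL rL[of n] by simp
  then show ?thesis using p(1) rL by blast
qed

section \<open>Consequences of the compact embedding for kernel, range and spectrum\<close>

lemma H_closed:
  assumes "\<And>n. (X n, Y n) \<in> H" "L.lim_to X x" "L.lim_to Y y"
  shows "(x, y) \<in> H"
\<comment> \<open>Adjoints are closed: the adjointness relation survives limits in both
  components.\<close>
proof (rule H_adjointI)
  show "x \<in> L" "y \<in> L" using assms by (auto simp: L.lim_to_def)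
  fix u v assume uv: "(u, v) \<in> H"
  have "(\<lambda>n. ip v (X n)) \<longlonglongrightarrow> ip v x" "(\<lambda>n. ip u (Y n)) \<longlonglongrightarrow> ip u y"
    using assms H_D[OF uv] by (auto intro: L.lim_to_ip_const')
  moreover have "ip v (X n) = ip u (Y n)" for n using H_symmetric[OF uv assms(1)] .
  ultimately show "ip v x = ip u y" using LIMSEQ_unique by auto
qed

text \<open>The functionals belonging to all \<delta> = 1/(m+1) form a countable family. Along a
  diagonal subsequence each of them converges, and the inequality then makes the subsequence Cauchy
  in \<open>L\<close>.\<close>

lemma compact_subsequence:
  fixes X :: "nat \<Rightarrow> 'v"
  assumes XD: "\<And>n. X n \<in> D" and bound: "\<And>n. D.nrm (X n) \<le> A"
  shows "\<exists>k x. strict_mono k \<and> L.lim_to (\<lambda>n. X (k n)) x"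
proof -
  note [simp] = XD
  have "\<forall>m. \<exists>F C. finite F \<and> F \<subseteq> L \<and> 0 \<le> C \<and> (\<forall>f\<in>D. Re (ip f f) \<le>
      (1 / real (Suc m)) * Re (q f f + c * ip f f) + C * (\<Sum>e\<in>F. (cmod (ip f e))\<^sup>2))"
    by (intro allI compact_embedding) simp
  then obtain F C where F: "\<And>m. finite (F m)" "\<And>m. F m \<subseteq> L" "\<And>m. 0 \<le> C m"
    and le: "\<And>m f. f \<in> D \<Longrightarrow> Re (ip f f) \<le>
      (1 / real (Suc m)) * Re (q f f + c * ip f f) + C m * (\<Sum>e\<in>F m. (cmod (ip f e))\<^sup>2)"
    by metis
  have XA: "L.nrm (X n) \<le> A" for n using nrm_le'[of "X n"] bound[of n] by simp
  define E where "E = (\<Union>m. F m)"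
  have E: "countable E" "E \<subseteq> L" using F by (auto simp: E_def intro: countable_finite)
  have "cmod (ip (X n) e / complex_of_real (1 + L.nrm e)) \<le> A" if "e \<in> E" for n e
  proof -
    have e: "e \<in> L" using E that by auto
    have ne: "0 \<le> L.nrm e" using e by (rule L.nrm_nonneg)
    have "cmod (ip (X n) e) \<le> L.nrm (X n) * L.nrm e" using e by (intro L.Cauchy_Schwarz) auto
    also have "\<dots> \<le> A * (1 + L.nrm e)"
      using XA[of n] L.nrm_nonneg[of "X n"] ne by (intro mult_mono) auto
    finally show ?thesis using ne
      by (simp only: norm_divide norm_of_real) (simp add: divide_le_eq)
  qed
  \<comment> \<open>The diagonal argument wants one bound for all \<open>e\<close>, hence the
    division by \<open>1 + L.nrm e\<close>, which is never zero.\<close>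
  from function_convergent_subsequence[where f = "\<lambda>n e. ip (X n) e / complex_of_real (1 + L.nrm e)", OF E(1) this]
  obtain k where k: "strict_mono k" and
    conv: "\<And>e. e \<in> E \<Longrightarrow> \<exists>l. (\<lambda>n. ip (X (k n)) e / complex_of_real (1 + L.nrm e)) \<longlonglongrightarrow> l" by blast
  have Cau: "Cauchy (\<lambda>n. ip (X (k n)) e)" if e: "e \<in> E" for e
  proof -
    have "1 + L.nrm e > 0" using e E L.nrm_nonneg[of e] by (auto intro: add_pos_nonneg)
    then have ne: "complex_of_real (1 + L.nrm e) \<noteq> 0" by (metis less_irrefl of_real_eq_0_iff)
    obtain l where "(\<lambda>n. ip (X (k n)) e / complex_of_real (1 + L.nrm e)) \<longlonglongrightarrow> l" using conv[OF e] by blast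
    from tendsto_mult_right[OF this, of "complex_of_real (1 + L.nrm e)"]
    have "(\<lambda>n. ip (X (k n)) e) \<longlonglongrightarrow> l * complex_of_real (1 + L.nrm e)" using ne by simp
    then show ?thesis by (rule LIMSEQ_imp_Cauchy)
  qed
  have A0: "0 \<le> A" using bound[of 0] D.nrm_nonneg[of "X 0"] by simp
  have "\<exists>x. L.lim_to (\<lambda>n. X (k n)) x"
  proof (rule L.complete_nrm)
    fix e :: real assume e: "e > 0"
    \<comment> \<open>Differences of two members have form norm at most 2 A, so this
      \<open>m\<close> makes the form term smaller than e^2 / 2. The other half is left to the
      finite sum through \<open>\<eta>\<close>, where the summand 1 keeps the denominator
      positive.\<close>
    obtain m where m: "4 * A\<^sup>2 / e\<^sup>2 * 2 < real m" using reals_Archimedean2 by blast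
    have m': "(1 / real (Suc m)) * (4 * A\<^sup>2) < e\<^sup>2 / 2"
    proof -
      have "4 * A\<^sup>2 * 2 < real m * e\<^sup>2" using m e by (simp add: field_simps)
      also have "\<dots> \<le> real (Suc m) * e\<^sup>2" by (intro mult_right_mono) auto
      finally show ?thesis by (simp add: field_simps)
    qed
    define \<eta> where "\<eta> = sqrt (e\<^sup>2 / 2 / (C m * card (F m) + 1))"
    have den: "0 < C m * card (F m) + 1" using F(3)[of m] by (intro add_nonneg_pos) auto
    have \<eta>: "\<eta> > 0" using e den by (simp add: \<eta>_def)
    have sq: "\<eta>\<^sup>2 = e\<^sup>2 / 2 / (C m * card (F m) + 1)"
      unfolding \<eta>_def using den by (intro real_sqrt_pow2 divide_nonneg_pos) auto
    have \<eta>2: "C m * (card (F m) * \<eta>\<^sup>2) \<le> e\<^sup>2 / 2"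
    proof -
      have "C m * (card (F m) * \<eta>\<^sup>2) \<le> (C m * card (F m) + 1) * \<eta>\<^sup>2"
        by (simp add: algebra_simps)
      also have "\<dots> = e\<^sup>2 / 2" unfolding sq using den by (intro nonzero_mult_div_cancel_left[of "C m * card (F m) + 1" "e\<^sup>2 / 2", unfolded times_divide_eq_right[symmetric]]) simp
      finally show ?thesis .
    qed
    have "\<forall>b\<in>F m. \<exists>N. \<forall>i\<ge>N. \<forall>j\<ge>N. cmod (ip (X (k i)) b - ip (X (k j)) b) < \<eta>"
      using Cau \<eta> by (auto simp: E_def Cauchy_def dist_norm)
    then obtain N where N: "\<And>b i j. b \<in> F m \<Longrightarrow> i \<ge> N b \<Longrightarrow> j \<ge> N b \<Longrightarrow> cmod (ip (X (k i)) b - ip (X (k j)) b) < \<eta>"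
      by metis
    define M where "M = Max (insert 0 (N ` F m))"
    have M: "N b \<le> M" if "b \<in> F m" for b using F(1) that by (auto simp: M_def)
    have "L.nrm (X (k i) - X (k j)) < e" if ij: "i \<ge> M" "j \<ge> M" for i j
    proof -
      let ?x = "X (k i) - X (k j)"
      have "D.nrm ?x \<le> D.nrm (X (k i)) + D.nrm (X (k j))"
        using D.nrm_triangle_diff[of "X (k i)" 0 "X (k j)"] D.nrm_minus_commute[of 0 "X (k j)"] by simp
      then have "D.nrm ?x \<le> 2 * A" using bound[of "k i"] bound[of "k j"] by simp
      then have "(D.nrm ?x)\<^sup>2 \<le> (2 * A)\<^sup>2" by (intro power_mono D.nrm_nonneg) auto
      then have "(D.nrm ?x)\<^sup>2 \<le> 4 * A\<^sup>2" by (simp add: power_mult_distrib)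
      then have "(1 / real (Suc m)) * Re (q ?x ?x + c * ip ?x ?x) \<le> (1 / real (Suc m)) * (4 * A\<^sup>2)"
        by (intro mult_left_mono) (simp_all add: D.nrm_square)
      moreover have "(\<Sum>b\<in>F m. (cmod (ip ?x b))\<^sup>2) \<le> (\<Sum>b\<in>F m. \<eta>\<^sup>2)"
      proof (rule sum_mono, rule power_mono)
        fix b assume b: "b \<in> F m"
        then have "b \<in> L" using F by auto
        then show "cmod (ip ?x b) \<le> \<eta>" 
          using N[OF b order.trans[OF M[OF b] ij(1)] order.trans[OF M[OF b] ij(2)]] by (simp add: L.ip_simps)
      qed auto
      then have "C m * (\<Sum>b\<in>F m. (cmod (ip ?x b))\<^sup>2) \<le> C m * (card (F m) * \<eta>\<^sup>2)"
        using F(3) by (intro mult_left_mono) auto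
      ultimately have "(L.nrm ?x)\<^sup>2 < e\<^sup>2"
        using le[of ?x m] m' \<eta>2 by (simp add: L.nrm_square)
      then show ?thesis by (rule power2_less_imp_less) (use e in simp)
    qed
    then show "\<exists>N. \<forall>m\<ge>N. \<forall>n\<ge>N. L.nrm (X (k m) - X (k n)) < e" by blast
  qed simp
  then show ?thesis using k by blast
qed

text \<open>The form at \<open>X n\<close> equals \<open>ip (Y n) (X n)\<close>, so a bound in the
  graph norm is a bound in the form norm.\<close>

lemma H_compact:
  fixes X Y :: "nat \<Rightarrow> 'v"
  assumes XY: "\<And>n. (X n, Y n) \<in> H" and X: "\<And>n. L.nrm (X n) \<le> A" and Y: "\<And>n. L.nrm (Y n) \<le> A"
  shows "\<exists>k x. strict_mono k \<and> L.lim_to (\<lambda>n. X (k n)) x"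
proof (rule compact_subsequence)
  fix n
  note D = H_D[OF XY[of n]]
  show "X n \<in> D" by (rule D)
  have A0: "0 \<le> A" using X[of n] L.nrm_nonneg[of "X n"] D by simp
  have "(D.nrm (X n))\<^sup>2 = Re (ip (Y n) (X n)) + c * (L.nrm (X n))\<^sup>2"
    using D D(4)[OF D(1)] by (simp add: D.nrm_square L.nrm_square)
  also have "Re (ip (Y n) (X n)) \<le> A * A"
    using L.Cauchy_Schwarz[of "Y n" "X n"] complex_Re_le_cmod[of "ip (Y n) (X n)"] D X[of n] Y[of n]
      mult_mono[OF Y[of n] X[of n] A0 L.nrm_nonneg[of "X n"]] by simp
  also have "c * (L.nrm (X n))\<^sup>2 \<le> \<bar>c\<bar> * A\<^sup>2"
    using X[of n] D L.nrm_nonneg[of "X n"] by (intro mult_mono power_mono) auto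
  finally have "(D.nrm (X n))\<^sup>2 \<le> A * A + \<bar>c\<bar> * A\<^sup>2" by simp
  then show "D.nrm (X n) \<le> sqrt (A * A + \<bar>c\<bar> * A\<^sup>2)"
    by (rule real_le_rsqrt)
qed

lemma nonreal_kernel:
  assumes "(f, z \<cdot> f) \<in> H" "Im z \<noteq> 0" shows "L.nrm f = 0"
proof -
  note D = H_D[OF assms(1)]
  have "ip (z \<cdot> f) f = ip f (z \<cdot> f)" using H_symmetric[OF assms(1) assms(1)] .
  then have "(z - cnj z) * ip f f = 0" using D by (simp add: L.ip_simps algebra_simps)
  moreover have "z - cnj z \<noteq> 0" using assms(2) by (simp add: complex_eq_iff)
  ultimately show ?thesis using D by (simp add: nrm_eq_0_iff)
qed

lemma normalize:
  assumes "(f, g) \<in> H" "L.nrm f \<noteq> 0"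
  obtains a where "cmod a = 1 / L.nrm f" "(a \<cdot> f, a \<cdot> g) \<in> H" "L.nrm (a \<cdot> f) = 1"
proof -
  have "L.nrm f > 0" using assms H_D L.nrm_nonneg[of f] by fastforce
  then have "cmod (of_real (1 / L.nrm f)) = 1 / L.nrm f" by (simp only: norm_of_real) simp
  then show ?thesis using assms H_D L.nrm_scale[of f] by (intro that[OF _ H_scale]) auto
qed

text \<open>Membership of (f, g + z f) in \<open>H\<close> reads (H - z) f = g. Without such a
  \<gamma>, unit vectors with (H - z) f tending to 0 would subconverge, and closedness would put
  their limit, again of norm 1, into the kernel.\<close>

lemma bounded_below:
  assumes "\<And>f. (f, z \<cdot> f) \<in> H \<Longrightarrow> L.nrm f = 0"
  shows "\<exists>\<gamma>>0. \<forall>f g. g \<in> L \<longrightarrow> (f, g + z \<cdot> f) \<in> H \<longrightarrow> \<gamma> * L.nrm f \<le> L.nrm g"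
proof (rule ccontr)
  assume neg: "\<not> ?thesis"
  have "\<exists>f g. g \<in> L \<and> (f, g + z \<cdot> f) \<in> H \<and> L.nrm f = 1 \<and> L.nrm g < 1 / real (Suc n)" for n
  proof -
    obtain f g where fg: "g \<in> L" "(f, g + z \<cdot> f) \<in> H" "L.nrm g < (1 / real (Suc n)) * L.nrm f"
      using neg by (metis linorder_not_le of_nat_0_less_iff zero_less_Suc zero_less_divide_1_iff)
    then have ne: "L.nrm f \<noteq> 0" using L.nrm_nonneg[of g] by auto
    have pos: "L.nrm f > 0" using ne fg H_D L.nrm_nonneg[of f] by fastforce
    obtain a where a: "cmod a = 1 / L.nrm f" "(a \<cdot> f, a \<cdot> (g + z \<cdot> f)) \<in> H" "L.nrm (a \<cdot> f) = 1"
      by (rule normalize[OF fg(2) ne])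
    have "a \<cdot> (g + z \<cdot> f) = a \<cdot> g + z \<cdot> (a \<cdot> f)"
      by (simp add: L.scale_right_distrib mult.commute)
    moreover have "L.nrm (a \<cdot> g) < 1 / real (Suc n)"
      using fg pos by (simp add: L.nrm_scale a divide_less_eq)
    ultimately show ?thesis using a fg by (intro exI[of _ "a \<cdot> f"] exI[of _ "a \<cdot> g"]) auto
  qed
  then obtain f g where fg: "\<And>n. g n \<in> L" "\<And>n. (f n, g n + z \<cdot> f n) \<in> H" "\<And>n. L.nrm (f n) = 1"
      "\<And>n::nat. L.nrm (g n) < 1 / real (Suc n)" by metis
  note D = H_D(1-3)[OF fg(2)]
  have "L.nrm (g n + z \<cdot> f n) \<le> 1 + cmod z" for n
  proof -
    have "L.nrm (g n + z \<cdot> f n) \<le> L.nrm (g n) + L.nrm (z \<cdot> f n)" using fg D by (intro L.nrm_triangle) auto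
    moreover have "1 / real (Suc n) \<le> 1" by simp
    moreover have "L.nrm (z \<cdot> f n) = cmod z" using fg(3)[of n] D[of n] by (simp add: L.nrm_scale)
    ultimately show ?thesis using fg(4)[of n] by linarith
  qed
  moreover have "L.nrm (f n) \<le> 1 + cmod z" for n using fg(3) by simp
  ultimately obtain k x where k: "strict_mono k" "L.lim_to (\<lambda>n. f (k n)) x"
    using H_compact[where X = f and Y = "\<lambda>n. g n + z \<cdot> f n" and A = "1 + cmod z", OF fg(2)] by blast
  have "L.lim_to (\<lambda>n. g (k n)) 0"
  proof (rule L.lim_to_zeroI)
    fix n
      have "1 / real (Suc (k n)) \<le> 1 / real (Suc n)"
        using seq_suble[OF k(1), of n] by (intro divide_left_mono) auto
      then show "L.nrm (g (k n)) \<le> 1 / real (Suc n)"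
        using fg(4)[of "k n"] L.nrm_nonneg[OF fg(1)[of "k n"]] by simp
  qed (use fg in simp_all)
  from L.lim_to_add[OF this L.lim_to_scale[OF k(2), of z]]
  have "(x, 0 + z \<cdot> x) \<in> H" using fg(2) by (intro H_closed[OF _ k(2)]) auto
  then have "L.nrm x = 0" using assms by simp
  moreover have "L.nrm x = 1" using L.lim_to_nrm[OF k(2)] by (simp add: fg(3) LIMSEQ_const_iff)
  ultimately show False by simp
qed

text \<open>The abstract counterpart of \<open>resolvent_set\<close>, with distance zero in the role
  of equality almost everywhere.\<close>

definition resolvent :: "complex \<Rightarrow> bool" where
  "resolvent z \<longleftrightarrow> (\<exists>C. \<forall>g\<in>L. \<exists>f. (f, g + z \<cdot> f) \<in> H \<and> L.nrm f \<le> C * L.nrm g \<and>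
     (\<forall>f'. (f', g + z \<cdot> f') \<in> H \<longrightarrow> L.nrm (f' - f) = 0))"

text \<open>The range of H - z is closed because H - z is bounded below, and by self-adjointness its
  orthogonal complement is the kernel of H - cnj z. The two kernel hypotheses thus make H - z
  bijective up to null vectors.\<close>

lemma resolventI:
  assumes ker: "\<And>f. (f, z \<cdot> f) \<in> H \<Longrightarrow> L.nrm f = 0"
    and ker': "\<And>f. (f, cnj z \<cdot> f) \<in> H \<Longrightarrow> L.nrm f = 0"
  shows "resolvent z"
proof -
  obtain \<gamma> where \<gamma>: "\<gamma> > 0" "\<And>f g. g \<in> L \<Longrightarrow> (f, g + z \<cdot> f) \<in> H \<Longrightarrow> \<gamma> * L.nrm f \<le> L.nrm g"
    using bounded_below[OF ker] by blast
  define R where "R = {g\<in>L. \<exists>f. (f, g + z \<cdot> f) \<in> H}"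
  have diffH: "(f - f', (g - g') + z \<cdot> (f - f')) \<in> H" if "(f, g + z \<cdot> f) \<in> H" "(f', g' + z \<cdot> f') \<in> H" for f g f' g'
    using H_diff[OF that] by (simp add: algebra_simps L.scale_right_diff_distrib)
  have R: "L.subspace R" "R \<subseteq> L"
  proof (rule L.subspaceI)
    show "0 \<in> R" using H_zero by (auto simp: R_def intro!: exI[of _ 0])
  next
    fix g g' assume "g \<in> R" "g' \<in> R"
    then obtain f f' where "g \<in> L" "g' \<in> L" "(f, g + z \<cdot> f) \<in> H" "(f', g' + z \<cdot> f') \<in> H" by (auto simp: R_def)
    moreover from H_add[OF this(3,4)] have "(f + f', (g + g') + z \<cdot> (f + f')) \<in> H"
      by (simp add: algebra_simps L.scale_right_distrib)
    ultimately show "g + g' \<in> R" by (auto simp: R_def)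
  next
    fix a g assume "g \<in> R"
    then obtain f where "g \<in> L" "(f, g + z \<cdot> f) \<in> H" by (auto simp: R_def)
    moreover from H_scale[OF this(2), of a] have "(a \<cdot> f, a \<cdot> g + z \<cdot> (a \<cdot> f)) \<in> H"
      by (simp add: L.scale_right_distrib mult.commute)
    ultimately show "a \<cdot> g \<in> R" unfolding R_def using L.carrier_closed(4) by blast
  qed (auto simp: R_def)
  have "\<exists>f. (f, g + z \<cdot> f) \<in> H" if g: "g \<in> L" for g
  proof -
    from L.projection[OF R g] obtain p r where p: "\<And>n. r n \<in> R" "L.lim_to r p"
       "\<And>u. u \<in> R \<Longrightarrow> ip (g - p) u = 0" by blast
    have pL: "p \<in> L" and rL: "r n \<in> L" for n using p(2) by (auto simp: L.lim_to_def)
    obtain f where f: "\<And>n. (f n, r n + z \<cdot> f n) \<in> H" using p(1) unfolding R_def by simp metis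
    have fL: "f n \<in> L" for n using f H_D by blast
    \<comment> \<open>Closed range: the lower bound pulls Cauchy right hand sides back to Cauchy
      solutions.\<close>
    have "\<exists>x. L.lim_to f x"
    proof (rule L.complete_nrm[OF fL])
      fix e :: real assume "e > 0"
      then obtain N where N: "\<And>m n. m \<ge> N \<Longrightarrow> n \<ge> N \<Longrightarrow> L.nrm (r m - r n) < e * \<gamma>"
        using L.lim_to_Cauchy[OF p(2), of "e * \<gamma>"] \<gamma>(1) by auto
      have "L.nrm (f m - f n) < e" if "m \<ge> N" "n \<ge> N" for m n
      proof -
        have "\<gamma> * L.nrm (f m - f n) \<le> L.nrm (r m - r n)" using rL by (intro \<gamma>(2) diffH f) simp
        also have "\<dots> < \<gamma> * e" using N[OF that] by (simp add: mult.commute)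
        finally show ?thesis using \<gamma>(1) by simp
      qed
      then show "\<exists>N. \<forall>m\<ge>N. \<forall>n\<ge>N. L.nrm (f m - f n) < e" by blast
    qed
    then obtain x where x: "L.lim_to f x" by blast
    have px: "(x, p + z \<cdot> x) \<in> H"
      by (rule H_closed[OF f x L.lim_to_add[OF p(2) L.lim_to_scale[OF x]]])
    \<comment> \<open>Orthogonality to the range of H - z says that \<open>g - p\<close> lies in the
      kernel of H - cnj z, where \<open>ker'\<close> makes it null.\<close>
    have "(g - p, cnj z \<cdot> (g - p)) \<in> H"
    proof (rule H_adjointI)
      fix u v assume uv: "(u, v) \<in> H"
      note D = H_D[OF uv]
      have "v - z \<cdot> u \<in> R" using uv D(1-3) by (auto simp: R_def intro!: exI[of _ u])
      from p(3)[OF this] have "ip (g - p) (v - z \<cdot> u) = 0" .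
      then have "ip (v - z \<cdot> u) (g - p) = 0"
        using L.ip_commute[of "g - p" "v - z \<cdot> u"] g pL D by simp
      then show "ip v (g - p) = ip u (cnj z \<cdot> (g - p))"
        using g pL D by (simp add: L.ip_diff_left L.ip_scale_left L.ip_scale_right)
    qed (use g pL in auto)
    then have n0: "L.nrm (g - p) = 0" by (rule ker')
    have xL: "x \<in> L" using px H_D by blast
    have "(x, g + z \<cdot> x) \<in> H" by (rule H_null[OF px]) (use g n0 xL in auto)
    then show ?thesis by blast
  qed
  moreover have "L.nrm f \<le> (1 / \<gamma>) * L.nrm g" if "g \<in> L" "(f, g + z \<cdot> f) \<in> H" for f g
    using \<gamma>(2)[OF that] \<gamma>(1) by (simp add: field_simps)
  moreover have "L.nrm (f' - f) = 0" if "(f, g + z \<cdot> f) \<in> H" "(f', g + z \<cdot> f') \<in> H" for f f' g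
    using ker[of "f' - f"] diffH[OF that(2,1)] by simp
  ultimately show ?thesis unfolding resolvent_def by (intro exI[of _ "1 / \<gamma>"] ballI) blast
qed

lemma spectrum_real: "\<not> resolvent z \<Longrightarrow> Im z = 0"
  using resolventI[of z] nonreal_kernel[of _ z] nonreal_kernel[of _ "cnj z"] by fastforce

text \<open>At a real point the two kernel conditions of \<open>resolventI\<close> coincide, so
  their failure produces an eigenvector.\<close>

lemma spectrum_eigenvalue:
  assumes "\<not> resolvent z" shows "\<exists>f. (f, z \<cdot> f) \<in> H \<and> L.nrm f = 1"
proof -
  have "cnj z = z" using spectrum_real[OF assms] by (simp add: complex_eq_iff)
  then obtain f where f: "(f, z \<cdot> f) \<in> H" "L.nrm f \<noteq> 0" using resolventI[of z] assms by auto
  obtain a where "cmod a = 1 / L.nrm f" "(a \<cdot> f, a \<cdot> z \<cdot> f) \<in> H" "L.nrm (a \<cdot> f) = 1"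
    by (rule normalize[OF f])
  then show ?thesis by (intro exI[of _ "a \<cdot> f"]) (simp add: mult.commute)
qed

lemma spectrum_isolated:
  assumes z: "\<not> resolvent z"
  shows "\<exists>e>0. \<forall>w. \<not> resolvent w \<longrightarrow> dist z w < e \<longrightarrow> w = z"
proof (rule ccontr)
  assume neg: "\<not> ?thesis"
  have "\<exists>w. \<not> resolvent w \<and> dist z w < 1 / real (Suc n) \<and> w \<noteq> z" for n
    using neg by (metis of_nat_0_less_iff zero_less_Suc zero_less_divide_1_iff)
  then obtain w where w: "\<And>n. \<not> resolvent (w n)" "\<And>n::nat. dist z (w n) < 1 / real (Suc n)" "\<And>n. w n \<noteq> z"
    by metis
  obtain f where f: "\<And>n. (f n, w n \<cdot> f n) \<in> H" "\<And>n. L.nrm (f n) = 1"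
    using spectrum_eigenvalue[OF w(1)] by metis
  note D = H_D(1-3)[OF f(1)]
  have wz: "cmod (w n - z) < 1 / real (Suc n)" for n using w(2)[of n] by (simp add: dist_norm norm_minus_commute)
  have "L.nrm (w n \<cdot> f n) \<le> 1 + cmod z" for n
  proof -
    have "1 / real (Suc n) \<le> 1" by simp
    then have "cmod (w n) \<le> 1 + cmod z" using wz[of n] norm_triangle_ineq2[of "w n" z] by linarith
    then show ?thesis using D[of n] f(2)[of n] by (simp add: L.nrm_scale)
  qed
  moreover have "L.nrm (f n) \<le> 1 + cmod z" for n using f(2) by simp
  ultimately obtain k x where k: "strict_mono k" "L.lim_to (\<lambda>n. f (k n)) x"
    using H_compact[where X = f and Y = "\<lambda>n. w n \<cdot> f n" and A = "1 + cmod z", OF f(1)] by blast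
  have xL: "x \<in> L" using k(2) by (simp add: L.lim_to_def)
  \<comment> \<open>The image of \<open>f\<close> is (w - z) f + z f with vanishing first summand;
    so the images converge as well, and \<open>H_closed\<close> makes the limit an eigenvector for
    \<open>z\<close>.\<close>
  have "L.lim_to (\<lambda>n. (w (k n) - z) \<cdot> f (k n)) 0"
  proof (rule L.lim_to_zeroI)
    fix n
      have "1 / real (Suc (k n)) \<le> 1 / real (Suc n)"
        using seq_suble[OF k(1), of n] by (intro divide_left_mono) auto
      then show "L.nrm ((w (k n) - z) \<cdot> f (k n)) \<le> 1 / real (Suc n)"
        using wz[of "k n"] D[of "k n"] f(2) by (simp add: L.nrm_scale)
  qed (use D in simp_all)
  from L.lim_to_add[OF this L.lim_to_scale[OF k(2), of z]]
  have "L.lim_to (\<lambda>n. w (k n) \<cdot> f (k n)) (z \<cdot> x)" by (simp add: L.scale_left_diff_distrib)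
  then have xH: "(x, z \<cdot> x) \<in> H" using f(1) by (intro H_closed[OF _ k(2)]) auto
  have "cnj z = z" using spectrum_real[OF z] by (simp add: complex_eq_iff)
  have "ip (f n) x = 0" for n
  proof -
    have "w n * ip (f n) x = z * ip (f n) x"
      using H_symmetric[OF f(1) xH, of n] D[of n] xL \<open>cnj z = z\<close> by (simp add: L.ip_simps)
    then show ?thesis using w(3)[of n] by simp
  qed
  then have "ip x x = 0" using L.lim_to_ip_const[OF k(2) xL] by (simp add: LIMSEQ_const_iff)
  then have "L.nrm x = 0" using xL by (simp add: nrm_eq_0_iff)
  moreover have "L.nrm x = 1" using L.lim_to_nrm[OF k(2)] by (simp add: f(2) LIMSEQ_const_iff)
  ultimately show False by simp
qed

text \<open>On the eigenspace the shifted form is z + c times the squared norm. For small \<delta>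
  the form term is absorbed on the left, so an eigenvector orthogonal to all of \<open>F\<close> is
  null.\<close>

lemma eigenspace_finite_dimensional:
  fixes z :: complex
  defines "N \<equiv> {f. (f, z \<cdot> f) \<in> H}"
  shows "\<exists>B\<subseteq>N. finite B \<and> (\<forall>f\<in>N. \<exists>a. L.nrm (f - (\<Sum>b\<in>B. a b \<cdot> b)) = 0)"
proof -
  \<comment> \<open>Keeps \<delta> |z + c| below 1; the summand 1 allows z = -c.\<close>
  define \<delta> where "\<delta> = 1 / (2 * (cmod (z + c) + 1))"
  have pos: "0 < cmod (z + c) + 1" by (rule add_nonneg_pos) auto
  then have \<delta>: "\<delta> > 0" "\<delta> * cmod (z + c) < 1" by (auto simp: \<delta>_def divide_less_eq)
  from compact_embedding[OF \<delta>(1)] obtain F C where F: "finite F" "F \<subseteq> L" and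
    le: "\<And>f. f \<in> D \<Longrightarrow> Re (ip f f) \<le> \<delta> * Re (q f f + c * ip f f) + C * (\<Sum>e\<in>F. (cmod (ip f e))\<^sup>2)" by blast
  show ?thesis
  proof (rule L.finite_dimensional_if_separated[OF F])
    show "L.subspace N"
    proof (rule L.subspaceI)
      show "0 \<in> N" using H_zero by (simp add: N_def)
    next
      fix f g assume "f \<in> N" "g \<in> N"
      then show "f + g \<in> N" using H_add[of f "z \<cdot> f" g "z \<cdot> g"] by (simp add: N_def L.scale_right_distrib)
    next
      fix a f assume "f \<in> N"
      then show "a \<cdot> f \<in> N" using H_scale[of f "z \<cdot> f" a] by (simp add: N_def mult.commute)
    qed
    show "N \<subseteq> L" using H_D by (auto simp: N_def)
    fix f assume f: "f \<in> N" and orth: "\<And>e. e \<in> F \<Longrightarrow> ip f e = 0"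
    note D = H_D[OF f[unfolded N_def mem_Collect_eq]]
    have eq: "q f f + c * ip f f = (z + c) * ip f f"
      using D(4)[OF D(1)] D(1-3) by (simp add: L.ip_simps algebra_simps)
    have "Re (q f f + c * ip f f) \<le> cmod ((z + c) * ip f f)"
      unfolding eq by (rule complex_Re_le_cmod)
    also have "\<dots> = cmod (z + c) * (L.nrm f)\<^sup>2" using D by (simp add: L.ip_self norm_mult norm_power)
    finally have "\<delta> * Re (q f f + c * ip f f) \<le> \<delta> * (cmod (z + c) * (L.nrm f)\<^sup>2)"
      by (rule mult_left_mono) (use \<delta>(1) in simp)
    moreover have "(L.nrm f)\<^sup>2 \<le> \<delta> * Re (q f f + c * ip f f)"
      using le[OF D(1)] orth D by (simp add: L.nrm_square)
    ultimately have "(L.nrm f)\<^sup>2 * (1 - \<delta> * cmod (z + c)) \<le> 0" by (simp add: algebra_simps)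
    then have "(L.nrm f)\<^sup>2 \<le> 0" using \<delta>(2) by (simp add: mult_le_0_iff)
    then show "L.nrm f = 0" by simp
  qed
qed

end

section \<open>Completeness of $L^2$\<close>

lemma L2_iff:
  "f \<in> L2 \<longleftrightarrow> f \<in> borel_measurable lebesgue \<and> (\<integral>\<^sup>+x. ennreal ((cmod (f x))\<^sup>2) \<partial>lebesgue) < \<infinity>"
  unfolding L2_def by (auto simp: integrable_iff_bounded)

lemma L2_measurable [measurable_dest]: "f \<in> L2 \<Longrightarrow> f \<in> borel_measurable lebesgue"
  by (simp add: L2_def)

lemma L2_integrable_square: "f \<in> L2 \<Longrightarrow> integrable lebesgue (\<lambda>x. (cmod (f x))\<^sup>2)"
  by (simp add: L2_def)

lemma L2_bound:
  assumes f: "f \<in> borel_measurable lebesgue" and g: "g \<in> L2" and h: "h \<in> L2"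
    and le: "\<And>x. cmod (f x) \<le> A * cmod (g x) + B * cmod (h x)"
  shows "f \<in> L2"
proof -
  have "integrable lebesgue (\<lambda>x. 2 * A\<^sup>2 * (cmod (g x))\<^sup>2 + 2 * B\<^sup>2 * (cmod (h x))\<^sup>2)"
    using L2_integrable_square[OF g] L2_integrable_square[OF h] by simp
  then have "integrable lebesgue (\<lambda>x. (cmod (f x))\<^sup>2)"
  proof (rule Bochner_Integration.integrable_bound)
    show "AE x in lebesgue. norm ((cmod (f x))\<^sup>2) \<le> norm (2 * A\<^sup>2 * (cmod (g x))\<^sup>2 + 2 * B\<^sup>2 * (cmod (h x))\<^sup>2)"
    proof (intro AE_I2)
      fix x
      have "(cmod (f x))\<^sup>2 \<le> (A * cmod (g x) + B * cmod (h x))\<^sup>2"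
        using le[of x] by (intro power_mono) auto
      also have "\<dots> \<le> 2 * (A * cmod (g x))\<^sup>2 + 2 * (B * cmod (h x))\<^sup>2"
        using sum_squares_bound[of "A * cmod (g x)" "B * cmod (h x)"] by (simp add: power2_sum)
      finally show "norm ((cmod (f x))\<^sup>2) \<le> norm (2 * A\<^sup>2 * (cmod (g x))\<^sup>2 + 2 * B\<^sup>2 * (cmod (h x))\<^sup>2)"
        by (simp add: power_mult_distrib)
    qed
  qed (use f in measurable)
  then show ?thesis using f by (simp add: L2_def)
qed

lemma L2_zero [simp]: "(\<lambda>x. 0) \<in> L2"
  by (simp add: L2_def)

lemma L2_add [simp]: "f \<in> L2 \<Longrightarrow> g \<in> L2 \<Longrightarrow> (\<lambda>x. f x + g x) \<in> L2"
  by (rule L2_bound[where A = 1 and B = 1 and g = f and h = g]) (auto simp: norm_triangle_ineq)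

lemma L2_scale [simp]: "f \<in> L2 \<Longrightarrow> (\<lambda>x. c * f x) \<in> L2"
  by (rule L2_bound[where A = "cmod c" and B = 0 and g = f and h = f]) (auto simp: norm_mult)

lemma L2_diff [simp]: "f \<in> L2 \<Longrightarrow> g \<in> L2 \<Longrightarrow> (\<lambda>x. f x - g x) \<in> L2"
  by (rule L2_bound[where A = 1 and B = 1 and g = f and h = g]) (auto simp: norm_triangle_ineq4)

lemma L2_cnj [simp]: "f \<in> L2 \<Longrightarrow> (\<lambda>x. cnj (f x)) \<in> L2"
  unfolding L2_def by (auto intro: measurable_compose[OF _ borel_measurable_continuous_onI] continuous_intros)

text \<open>Completeness of Lebesgue measure: a function equal almost everywhere to a measurable one
  is measurable.\<close>

lemma L2_cong_AE:
  assumes "f \<in> L2" "AE x in lebesgue. g x = f x"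
  shows "g \<in> L2"
proof -
  have g: "g \<in> borel_measurable lebesgue"
  proof (rule borel_measurableI)
    fix U :: "complex set" assume U: "open U"
    show "g -` U \<inter> space lebesgue \<in> sets lebesgue"
    proof (rule completion.in_sets_AE[where A = "f -` U \<inter> space lebesgue"])
      show "f -` U \<inter> space lebesgue \<in> sets lebesgue"
        using L2_measurable[OF assms(1)] U by (intro measurable_sets) auto
    qed (use assms(2) in auto)
  qed
  moreover have "integrable lebesgue (\<lambda>x. (cmod (g x))\<^sup>2)"
    using assms g L2_integrable_square[OF assms(1)]
    by (subst integrable_cong_AE[where g = "\<lambda>x. (cmod (f x))\<^sup>2"]) auto
  ultimately show ?thesis by (simp add: L2_def)
qed

lemma L2_mult_integrable:
  assumes "f \<in> L2" "g \<in> L2"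
  shows "integrable lebesgue (\<lambda>x. f x * g x)"
proof (rule Bochner_Integration.integrable_bound)
  show "integrable lebesgue (\<lambda>x. (cmod (f x))\<^sup>2 + (cmod (g x))\<^sup>2)"
    using assms by (simp add: L2_integrable_square)
  show "AE x in lebesgue. norm (f x * g x) \<le> norm ((cmod (f x))\<^sup>2 + (cmod (g x))\<^sup>2)"
  proof (intro AE_I2)
    fix x
    have "2 * (cmod (f x) * cmod (g x)) \<le> (cmod (f x))\<^sup>2 + (cmod (g x))\<^sup>2"
      using sum_squares_bound[of "cmod (f x)" "cmod (g x)"] by simp
    moreover have "0 \<le> cmod (f x) * cmod (g x)" by simp
    ultimately show "norm (f x * g x) \<le> norm ((cmod (f x))\<^sup>2 + (cmod (g x))\<^sup>2)"
      unfolding norm_mult real_norm_def by linarith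
  qed
qed (use assms in measurable)

lemma L2_inner_integrable: "f \<in> L2 \<Longrightarrow> g \<in> L2 \<Longrightarrow> integrable lebesgue (\<lambda>x. f x * cnj (g x))"
  using L2_mult_integrable[of f "\<lambda>x. cnj (g x)"] by simp

lemma L2_inner_self: "L2_inner f f = of_real (LINT x|lebesgue. (cmod (f x))\<^sup>2)"
  by (simp add: L2_inner_def complex_norm_square[symmetric] del: of_real_power flip: of_real_power)

lemma L2_norm_eq: "L2_norm f = sqrt (Re (L2_inner f f))"
  by (simp add: L2_norm_def L2_inner_self)

lemma nn_integral_square:
  "f \<in> L2 \<Longrightarrow> (\<integral>\<^sup>+x. ennreal ((cmod (f x))\<^sup>2) \<partial>lebesgue) = ennreal ((L2_norm f)\<^sup>2)"
  by (subst nn_integral_eq_integral) (auto simp: L2_integrable_square L2_norm_def)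

lemma L2_norm_zero_iff:
  assumes "f \<in> L2" shows "L2_norm f = 0 \<longleftrightarrow> (AE x in lebesgue. f x = 0)"
  using integral_nonneg_eq_0_iff_AE[OF L2_integrable_square[OF assms]] by (simp add: L2_norm_def)

text \<open>Fatou's lemma in \<open>k\<close> turns the Cauchy bound for
  \<open>Y n - Y (r k)\<close> into one for \<open>Y n - y\<close>, so the whole sequence converges.
  The candidate \<open>y\<close> is given in advance, because one subsequence later serves two
  sequences, a sequence of functions and its multiples by the root of V_+.\<close>

lemma L2_Fatou:
  fixes Y :: "nat \<Rightarrow> 'a::euclidean_space \<Rightarrow> complex"
  assumes Y: "\<And>n. Y n \<in> L2" and y [measurable]: "y \<in> borel_measurable lebesgue"
    and lim: "AE x in lebesgue. (\<lambda>k. Y (r k) x) \<longlonglongrightarrow> y x" and r: "\<And>k. k \<le> r k"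
    and Cauchy: "\<And>e. e > 0 \<Longrightarrow> \<exists>N. \<forall>m\<ge>N. \<forall>n\<ge>N. (LINT x|lebesgue. (cmod (Y m x - Y n x))\<^sup>2) < e"
  shows "y \<in> L2" "(\<lambda>n. LINT x|lebesgue. (cmod (Y n x - y x))\<^sup>2) \<longlonglongrightarrow> 0"
proof -
  have [measurable]: "Y n \<in> borel_measurable lebesgue" for n using Y by measurable
  have bound: "\<exists>N. \<forall>n\<ge>N. (\<integral>\<^sup>+x. ennreal ((cmod (Y n x - y x))\<^sup>2) \<partial>lebesgue) \<le> ennreal e" if e: "e > 0" for e
  proof -
    obtain N where N: "\<And>m n. m \<ge> N \<Longrightarrow> n \<ge> N \<Longrightarrow> (LINT x|lebesgue. (cmod (Y m x - Y n x))\<^sup>2) < e"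
      using Cauchy[OF e] by blast
    have "(\<integral>\<^sup>+x. ennreal ((cmod (Y n x - y x))\<^sup>2) \<partial>lebesgue) \<le> ennreal e" if n: "n \<ge> N" for n
    proof -
      have "(\<integral>\<^sup>+x. ennreal ((cmod (Y n x - y x))\<^sup>2) \<partial>lebesgue) =
          (\<integral>\<^sup>+x. liminf (\<lambda>k. ennreal ((cmod (Y n x - Y (r k) x))\<^sup>2)) \<partial>lebesgue)"
      proof (rule nn_integral_cong_AE, use lim in \<open>rule AE_mp\<close>, intro AE_I2 impI)
        fix x assume "(\<lambda>k. Y (r k) x) \<longlonglongrightarrow> y x"
        then have "(\<lambda>k. ennreal ((cmod (Y n x - Y (r k) x))\<^sup>2)) \<longlonglongrightarrow> ennreal ((cmod (Y n x - y x))\<^sup>2)"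
          by (intro tendsto_intros)
        then show "ennreal ((cmod (Y n x - y x))\<^sup>2) = liminf (\<lambda>k. ennreal ((cmod (Y n x - Y (r k) x))\<^sup>2))"
          by (intro lim_imp_Liminf[symmetric]) auto
      qed
      also have "\<dots> \<le> liminf (\<lambda>k. \<integral>\<^sup>+x. ennreal ((cmod (Y n x - Y (r k) x))\<^sup>2) \<partial>lebesgue)"
        by (rule nn_integral_liminf) measurable
      also have "\<dots> \<le> ennreal e"
      proof (rule Liminf_le)
        show "\<forall>\<^sub>F k in sequentially. (\<integral>\<^sup>+x. ennreal ((cmod (Y n x - Y (r k) x))\<^sup>2) \<partial>lebesgue) \<le> ennreal e"
          unfolding eventually_sequentially
        proof (intro exI allI impI)
          fix k assume "N \<le> k"
          then have "N \<le> r k" using r[of k] by linarith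
          have "(\<integral>\<^sup>+x. ennreal ((cmod (Y n x - Y (r k) x))\<^sup>2) \<partial>lebesgue) = ennreal (LINT x|lebesgue. (cmod (Y n x - Y (r k) x))\<^sup>2)"
            using Y by (intro nn_integral_eq_integral L2_integrable_square) auto
          also have "\<dots> \<le> ennreal e" using N[OF n \<open>N \<le> r k\<close>] by (intro ennreal_leI) simp
          finally show "(\<integral>\<^sup>+x. ennreal ((cmod (Y n x - Y (r k) x))\<^sup>2) \<partial>lebesgue) \<le> ennreal e" .
        qed
      qed simp
      finally show ?thesis .
    qed
    then show ?thesis by blast
  qed
  have "\<exists>N. \<forall>n\<ge>N. (\<lambda>x. Y n x - y x) \<in> L2"
  proof -
    obtain N where "\<And>n. n \<ge> N \<Longrightarrow> (\<integral>\<^sup>+x. ennreal ((cmod (Y n x - y x))\<^sup>2) \<partial>lebesgue) \<le> ennreal 1"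
      using bound[of 1] by auto
    then have "\<And>n. n \<ge> N \<Longrightarrow> (\<integral>\<^sup>+x. ennreal ((cmod (Y n x - y x))\<^sup>2) \<partial>lebesgue) < \<infinity>"
      by (metis ennreal_less_top infinity_ennreal_def order.strict_trans1)
    then show ?thesis unfolding L2_iff by (intro exI[of _ N]) simp
  qed
  then obtain N where "(\<lambda>x. Y N x - y x) \<in> L2" by blast
  from L2_diff[OF Y[of N] this] show yL2: "y \<in> L2" by simp
  show "(\<lambda>n. LINT x|lebesgue. (cmod (Y n x - y x))\<^sup>2) \<longlonglongrightarrow> 0"
  proof (rule LIMSEQ_I)
    fix e :: real assume e: "e > 0"
    from bound[of "e / 2"] e obtain N where
      N: "\<And>n. n \<ge> N \<Longrightarrow> (\<integral>\<^sup>+x. ennreal ((cmod (Y n x - y x))\<^sup>2) \<partial>lebesgue) \<le> ennreal (e / 2)" by auto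
    have "norm ((LINT x|lebesgue. (cmod (Y n x - y x))\<^sup>2) - 0) < e" if "n \<ge> N" for n
    proof -
      have "ennreal (LINT x|lebesgue. (cmod (Y n x - y x))\<^sup>2) \<le> ennreal (e / 2)"
        using N[OF that] Y yL2 by (subst nn_integral_eq_integral[symmetric]) (auto intro!: L2_integrable_square)
      then have "(LINT x|lebesgue. (cmod (Y n x - y x))\<^sup>2) \<le> e / 2" using e by (subst (asm) ennreal_le_iff) auto
      then show ?thesis using e by simp
    qed
    then show "\<exists>N. \<forall>n\<ge>N. norm ((LINT x|lebesgue. (cmod (Y n x - y x))\<^sup>2) - 0) < e" by blast
  qed
qed

text \<open>Each term of a convergent series is bounded by the sum, so a k is at most a constant
  times 2^-k. Integrated bounds on squares thereby become pointwise absolute summability.\<close>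

lemma summable_if_weighted_squares:
  fixes a :: "nat \<Rightarrow> real"
  assumes a: "\<And>k. 0 \<le> a k" and fin: "(\<Sum>k. ennreal (4 ^ k * (a k)\<^sup>2)) < \<infinity>"
  shows "summable a"
proof -
  obtain G where G: "(\<Sum>k. ennreal (4 ^ k * (a k)\<^sup>2)) = ennreal G" "0 \<le> G"
    using fin unfolding infinity_ennreal_def less_top_ennreal by blast
  have "a k \<le> sqrt G * (1 / 2) ^ k" for k
  proof -
    have "ennreal (4 ^ k * (a k)\<^sup>2) \<le> ennreal G"
      using sum_le_suminf[of "\<lambda>k. ennreal (4 ^ k * (a k)\<^sup>2)" "{k}"] by (simp add: G)
    then have "4 ^ k * (a k)\<^sup>2 \<le> G" using G(2) by simp
    moreover have "4 ^ k * (a k)\<^sup>2 = (2 ^ k * a k)\<^sup>2"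
      using power_mult[of "2 :: real" 2 k] power_mult[of "2 :: real" k 2] by (simp add: power_mult_distrib mult.commute)
    ultimately have "2 ^ k * a k \<le> sqrt G" by (intro real_le_rsqrt) simp
    then have "(2 ^ k * a k) * (1 / 2) ^ k \<le> sqrt G * (1 / 2) ^ k" by (rule mult_right_mono) simp
    then show ?thesis by (simp add: power_one_over)
  qed
  then show ?thesis
    using a by (intro summable_comparison_test'[where N = 0 and g = "\<lambda>k. sqrt G * (1 / 2) ^ k", OF summable_mult[OF summable_geometric]]) simp_all
qed

lemma L2_Cauchy_AE_subsequence:
  fixes X :: "nat \<Rightarrow> 'a::euclidean_space \<Rightarrow> complex"
  assumes X: "\<And>n. X n \<in> L2"
    and Cauchy: "\<And>e. e > 0 \<Longrightarrow> \<exists>N. \<forall>m\<ge>N. \<forall>n\<ge>N. (LINT x|lebesgue. (cmod (X m x - X n x))\<^sup>2) < e"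
  shows "\<exists>r f. (\<forall>k::nat. k \<le> r k) \<and> f \<in> borel_measurable lebesgue \<and> (AE x in lebesgue. (\<lambda>k. X (r k) x) \<longlonglongrightarrow> f x)"
proof -
  have [measurable]: "X n \<in> borel_measurable lebesgue" for n using X by measurable
  \<comment> \<open>The rate 8^-k leaves a summable 2^-k after multiplication by the weight
    4^k.\<close>
  have "\<exists>N. \<forall>k. \<forall>m\<ge>N k. \<forall>n\<ge>N k. (LINT x|lebesgue. (cmod (X m x - X n x))\<^sup>2) < (1 / 8) ^ k"
    by (intro choice allI Cauchy) simp
  then obtain N where N: "\<And>k m n. m \<ge> N k \<Longrightarrow> n \<ge> N k \<Longrightarrow> (LINT x|lebesgue. (cmod (X m x - X n x))\<^sup>2) < (1 / 8) ^ k"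
    by blast
  \<comment> \<open>The partial sum puts both \<open>r k\<close> and \<open>r (Suc k)\<close> above
    \<open>N k\<close> without monotonicity of \<open>N\<close>.\<close>
  define r where "r k = k + (\<Sum>j\<le>k. N j)" for k
  have r: "k \<le> r k" "N k \<le> r k" "N k \<le> r (Suc k)" for k
    using member_le_sum[of k "{..k}" N] member_le_sum[of k "{..Suc k}" N] by (auto simp: r_def)
  define a where "a k x = cmod (X (r (Suc k)) x - X (r k) x)" for k x
  have [measurable]: "a k \<in> borel_measurable lebesgue" for k unfolding a_def by measurable
  have "(\<integral>\<^sup>+x. (\<Sum>k. ennreal (4 ^ k * (a k x)\<^sup>2)) \<partial>lebesgue) = (\<Sum>k. \<integral>\<^sup>+x. ennreal (4 ^ k * (a k x)\<^sup>2) \<partial>lebesgue)"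
    by (rule nn_integral_suminf) measurable
  also have "\<dots> \<le> (\<Sum>k. ennreal ((1 / 2) ^ k))"
  proof (rule suminf_le)
    fix k
    have i: "integrable lebesgue (\<lambda>x. (a k x)\<^sup>2)" using X unfolding a_def by (intro L2_integrable_square) auto
    have "(\<integral>\<^sup>+x. ennreal (4 ^ k * (a k x)\<^sup>2) \<partial>lebesgue) = ennreal (4 ^ k * (LINT x|lebesgue. (a k x)\<^sup>2))"
      using i by (subst nn_integral_eq_integral) auto
    also have "\<dots> \<le> ennreal (4 ^ k * (1 / 8) ^ k)"
      using N[OF r(3) r(2), of k] unfolding a_def by (intro ennreal_leI mult_left_mono) auto
    also have "4 ^ k * (1 / 8) ^ k = (1 / 2 :: real) ^ k" by (simp add: power_mult_distrib[symmetric])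
    finally show "(\<integral>\<^sup>+x. ennreal (4 ^ k * (a k x)\<^sup>2) \<partial>lebesgue) \<le> ennreal ((1 / 2) ^ k)" .
  qed auto
  also have "\<dots> < \<infinity>"
    by (subst suminf_ennreal2) (auto simp: summable_geometric)
  finally have "AE x in lebesgue. (\<Sum>k. ennreal (4 ^ k * (a k x)\<^sup>2)) \<noteq> \<infinity>"
    by (intro nn_integral_noteq_infinite) auto
  then have conv: "AE x in lebesgue. convergent (\<lambda>k. X (r k) x)"
  proof (rule AE_mp, intro AE_I2 impI)
    fix x assume "(\<Sum>k. ennreal (4 ^ k * (a k x)\<^sup>2)) \<noteq> \<infinity>"
    then have "summable (\<lambda>k. a k x)"
      by (intro summable_if_weighted_squares) (auto simp: a_def less_top)
    then have "summable (\<lambda>k. X (r (Suc k)) x - X (r k) x)"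
      unfolding a_def by (rule summable_norm_cancel)
    then have "convergent (\<lambda>n. X (r n) x - X (r 0) x)"
      by (simp add: summable_iff_convergent sum_lessThan_telescope[of "\<lambda>k. X (r k) x"])
    then show "convergent (\<lambda>k. X (r k) x)"
      using convergent_diff_const_right_iff by blast
  qed
  show ?thesis
  proof (intro exI[of _ r] exI[of _ "\<lambda>x. lim (\<lambda>k. X (r k) x)"] conjI allI r)
    show "(\<lambda>x. lim (\<lambda>k. X (r k) x)) \<in> borel_measurable lebesgue"
      by (rule borel_measurable_lim_metric) measurable
    show "AE x in lebesgue. (\<lambda>k. X (r k) x) \<longlonglongrightarrow> lim (\<lambda>k. X (r k) x)"
      using conv by (rule AE_mp) (auto simp: convergent_LIMSEQ_iff)
  qed
qed

abbreviation (input) fscale :: "complex \<Rightarrow> ('a \<Rightarrow> complex) \<Rightarrow> 'a \<Rightarrow> complex" where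
  "fscale c f \<equiv> (\<lambda>x. c * f x)"

lemma vector_space_fscale: "vector_space (fscale :: complex \<Rightarrow> ('a \<Rightarrow> complex) \<Rightarrow> _)"
  by standard (auto simp: fun_eq_iff algebra_simps)

interpretation fscale: vector_space fscale
  by (rule vector_space_fscale)

lemma diff_fun_eq: "(f :: 'a \<Rightarrow> complex) - g = (\<lambda>x. f x - g x)"
  by (simp add: fun_eq_iff)

lemma L2_subspace: "fscale.subspace L2"
  by (rule fscale.subspaceI) (auto simp: plus_fun_def zero_fun_def)

interpretation L2: semi_hilbert fscale "L2 :: ('a::euclidean_space \<Rightarrow> complex) set" L2_inner
proof (unfold_locales)
  show "fscale.subspace L2" by (rule L2_subspace)
next
  fix f g h :: "'a \<Rightarrow> complex" assume "f \<in> L2" "g \<in> L2" "h \<in> L2"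
  then show "L2_inner (f + g) h = L2_inner f h + L2_inner g h"
    by (simp add: L2_inner_def ring_distribs L2_inner_integrable)
next
  fix c and f g :: "'a \<Rightarrow> complex" assume "f \<in> L2" "g \<in> L2"
  then show "L2_inner (fscale c f) g = c * L2_inner f g"
    by (simp add: L2_inner_def mult.assoc)
next
  fix f g :: "'a \<Rightarrow> complex" assume "f \<in> L2" "g \<in> L2"
  show "L2_inner g f = cnj (L2_inner f g)"
    unfolding L2_inner_def Bochner_Integration.integral_cnj[symmetric] by (simp add: mult.commute)
next
  fix f :: "'a \<Rightarrow> complex" assume "f \<in> L2"
  show "0 \<le> Re (L2_inner f f)" by (simp add: L2_inner_self)
next
  fix X :: "nat \<Rightarrow> 'a \<Rightarrow> complex"
  assume X: "\<And>n. X n \<in> L2" and C: "\<And>e. 0 < e \<Longrightarrow> \<exists>N. \<forall>m\<ge>N. \<forall>n\<ge>N. Re (L2_inner (X m - X n) (X m - X n)) < e"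
  have C': "\<exists>N. \<forall>m\<ge>N. \<forall>n\<ge>N. (LINT x|lebesgue. (cmod (X m x - X n x))\<^sup>2) < e" if "e > 0" for e
    using C[OF that] by (simp add: L2_inner_self)
  obtain r f where r: "\<And>k::nat. k \<le> r k" "f \<in> borel_measurable lebesgue" "AE x in lebesgue. (\<lambda>k. X (r k) x) \<longlonglongrightarrow> f x"
    using L2_Cauchy_AE_subsequence[OF X C'] by blast
  have "f \<in> L2" "(\<lambda>n. LINT x|lebesgue. (cmod (X n x - f x))\<^sup>2) \<longlonglongrightarrow> 0"
    using L2_Fatou[where Y = X and y = f and r = r, OF X r(2,3,1) C'] by simp_all
  then show "\<exists>x\<in>L2. (\<lambda>n. Re (L2_inner (X n - x) (X n - x))) \<longlonglongrightarrow> 0"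
    by (intro bexI[of _ f]) (simp_all add: L2_inner_self)
qed

lemma L2_nrm: "L2.nrm f = L2_norm f"
  by (simp add: L2.nrm_def L2_norm_eq)

lemmas L2_Cauchy_Schwarz = L2.Cauchy_Schwarz[unfolded L2_nrm]

section \<open>Test functions\<close>

lemma Ck_SucI:
  assumes "\<And>x. (f has_derivative f' x) (at x)" "\<And>b. b \<in> Basis \<Longrightarrow> Ck k (\<lambda>x. f' x b)"
  shows "Ck (Suc k) f"
proof -
  have "frechet_derivative f (at x) = f' x" for x
    using frechet_derivative_at[OF assms(1)[of x]] by simp
  then show ?thesis using assms by (auto simp: differentiable_def)
qed

lemma Ck_Suc_has_derivative:
  "Ck (Suc k) f \<Longrightarrow> (f has_derivative frechet_derivative f (at x)) (at x)"
  by (auto simp: frechet_derivative_works)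

lemma Ck_continuous: "Ck k f \<Longrightarrow> continuous_on UNIV f"
  by (cases k) (auto intro!: differentiable_imp_continuous_on simp: differentiable_on_def)

lemma Ck_mono: "Ck (Suc k) f \<Longrightarrow> Ck k f"
proof (induction k arbitrary: f)
  case 0
  then show ?case using Ck_continuous[OF 0] by simp
next
  case (Suc k)
  then show ?case by (subst Ck.simps(2)) (subst (asm) Ck.simps(2), blast)
qed

lemma Ck_const [simp]: "Ck k (\<lambda>x. c)"
  by (induction k arbitrary: c) auto

lemma Ck_add: "Ck k f \<Longrightarrow> Ck k g \<Longrightarrow> Ck k (\<lambda>x. f x + g x)"
proof (induction k arbitrary: f g)
  case 0
  then show ?case by (auto intro: continuous_intros)
next
  case (Suc k)
  show ?case
  proof (rule Ck_SucI[OF has_derivative_add])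
    show "Ck k (\<lambda>x. frechet_derivative f (at x) b + frechet_derivative g (at x) b)" if "b \<in> Basis" for b
      using Suc that by simp
  qed (intro Ck_Suc_has_derivative[OF Suc.prems(1)] Ck_Suc_has_derivative[OF Suc.prems(2)])+
qed

lemma Ck_mult: "Ck k f \<Longrightarrow> Ck k g \<Longrightarrow> Ck k (\<lambda>x. f x * g x)"
proof (induction k arbitrary: f g)
  case 0
  then show ?case by (auto intro: continuous_intros)
next
  case (Suc k)
  show ?case
  proof (rule Ck_SucI[OF has_derivative_mult])
    show "Ck k (\<lambda>x. f x * frechet_derivative g (at x) b + frechet_derivative f (at x) b * g x)" if "b \<in> Basis" for b
      using Suc.prems that
      by (intro Ck_add Suc.IH Ck_mono[OF Suc.prems(1)] Ck_mono[OF Suc.prems(2)]) simp_all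
  qed (intro Ck_Suc_has_derivative[OF Suc.prems(1)] Ck_Suc_has_derivative[OF Suc.prems(2)])+
qed

lemma Ck_prod: "(\<And>i. i \<in> I \<Longrightarrow> Ck k (f i)) \<Longrightarrow> Ck k (\<lambda>x. \<Prod>i\<in>I. f i x)"
  by (induction I rule: infinite_finite_induct) (auto intro: Ck_mult)

lemma Ck_translate: "Ck k f \<Longrightarrow> Ck k (\<lambda>x. f (x + a))"
proof (induction k arbitrary: f)
  case 0
  then show ?case by (auto intro!: continuous_on_compose2[of UNIV f] continuous_intros)
next
  case (Suc k)
  show ?case
  proof (rule Ck_SucI)
    fix x
    have "((\<lambda>x. x + a) has_derivative (\<lambda>h. h)) (at x)" by (auto intro!: derivative_eq_intros)
    from has_derivative_compose[OF this Ck_Suc_has_derivative[OF Suc.prems]]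
    show "((\<lambda>x. f (x + a)) has_derivative frechet_derivative f (at (x + a))) (at x)" .
  qed (use Suc in auto)
qed

lemma frechet_derivative_translate:
  assumes "f differentiable (at (x + a))"
  shows "frechet_derivative (\<lambda>x. f (x + a)) (at x) = frechet_derivative f (at (x + a))"
proof -
  have "((\<lambda>x. x + a) has_derivative (\<lambda>h. h)) (at x)" by (auto intro!: derivative_eq_intros)
  from has_derivative_compose[OF this, of f "frechet_derivative f (at (x + a))"] assms
  show ?thesis by (intro frechet_derivative_at[symmetric]) (simp add: frechet_derivative_works)
qed

text \<open>The whole ladder of derivatives is carried along: a partial derivative of the function
  at level \<open>i\<close> is a constant times the one at level \<open>Suc i\<close>, which closes
  the induction on \<open>k\<close>.\<close>

lemma Ck_line:
  fixes d :: "nat \<Rightarrow> real \<Rightarrow> real"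
  assumes "\<And>i t. (d i has_real_derivative d (Suc i) t) (at t)"
  shows "Ck k (\<lambda>x. d i (s * (x \<bullet> v) + e))"
proof (induction k arbitrary: i)
  case 0
  have "continuous_on UNIV (d i)" using assms by (auto intro: DERIV_continuous_on)
  then show ?case by (auto intro!: continuous_on_compose2[of UNIV "d i"] continuous_intros)
next
  case (Suc k)
  show ?case
  proof (rule Ck_SucI)
    fix x :: 'a
    have "((\<lambda>x. s * (x \<bullet> v) + e) has_derivative (\<lambda>h. s * (h \<bullet> v))) (at x)"
      by (auto intro!: derivative_eq_intros)
    from has_derivative_compose[OF this assms[unfolded has_field_derivative_def]]
    show "((\<lambda>x. d i (s * (x \<bullet> v) + e)) has_derivative (\<lambda>h. d (Suc i) (s * (x \<bullet> v) + e) * (s * (h \<bullet> v)))) (at x)" .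
  qed (intro Ck_mult Suc Ck_const)
qed

section \<open>The smooth function exp(-1/t) and bumps on boxes\<close>

lemma tendsto_poly_div_exp_0: "((\<lambda>s. s ^ k * poly p s / exp s) \<longlongrightarrow> (0::real)) at_top"
proof (induction p arbitrary: k)
  case 0
  then show ?case by simp
next
  case (pCons a p)
  \<comment> \<open>Horner step: the free power \<open>k\<close> absorbs the factor \<open>s\<close>
    in front of the tail \<open>p\<close>.\<close>
  have "((\<lambda>s. a * (s ^ k / exp s) + s ^ Suc k * poly p s / exp s) \<longlongrightarrow> a * 0 + 0) at_top"
    by (intro tendsto_add tendsto_mult tendsto_const tendsto_power_div_exp_0 pCons.IH)
  then show ?case by (simp add: algebra_simps add_divide_distrib)
qed

text \<open>For t > 0 the i-th derivative of exp(-1/t) is P_i(1/t) exp(-1/t). With s = 1/t the chain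
  rule gives P_{i+1}(s) = s^2 (P_i(s) - P_i'(s)), and \<open>[:0, 0, 1:]\<close> is s^2.\<close>

primrec bump_poly :: "nat \<Rightarrow> real poly" where
  "bump_poly 0 = 1"
| "bump_poly (Suc i) = [:0, 0, 1:] * (bump_poly i - pderiv (bump_poly i))"

definition bump1 :: "nat \<Rightarrow> real \<Rightarrow> real" where
  "bump1 i t = (if t > 0 then poly (bump_poly i) (inverse t) * exp (- inverse t) else 0)"

lemma bump1_DERIV: "(bump1 i has_real_derivative bump1 (Suc i) t) (at t)"
proof (cases t "0 :: real" rule: linorder_cases)
  case less
  have "((\<lambda>t. 0) has_real_derivative 0) (at t)" by simp
  then have "(bump1 i has_real_derivative 0) (at t)"
    by (rule has_field_derivative_transform_within_open[where S = "{..<0}"]) (use less in \<open>auto simp: bump1_def\<close>)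
  then show ?thesis using less by (simp add: bump1_def)
next
  case greater
  have "((\<lambda>t. poly (bump_poly i) (inverse t) * exp (- inverse t)) has_real_derivative bump1 (Suc i) t) (at t)"
    using greater
    by (auto intro!: derivative_eq_intros DERIV_chain2[OF poly_DERIV] simp: bump1_def power2_eq_square algebra_simps)
  then show ?thesis
    by (rule has_field_derivative_transform_within_open[where S = "{0<..}"]) (use greater in \<open>auto simp: bump1_def\<close>)
next
  case equal
  \<comment> \<open>From the right, s = 1/h turns the quotient into s P(s) / exp(s), which tends to
    zero; from the left it is identically zero.\<close>
  have "((\<lambda>h. bump1 i h / h) \<longlongrightarrow> 0) (at_right 0)"
  proof (rule Lim_transform_eventually)
    have "((\<lambda>s. s ^ 1 * poly (bump_poly i) s / exp s) \<longlongrightarrow> 0) at_top" by (rule tendsto_poly_div_exp_0)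
    from filterlim_compose[OF this filterlim_inverse_at_top_right]
    show "((\<lambda>h. inverse h ^ 1 * poly (bump_poly i) (inverse h) / exp (inverse h)) \<longlongrightarrow> 0) (at_right 0)" .
    show "\<forall>\<^sub>F h in at_right 0. inverse h ^ 1 * poly (bump_poly i) (inverse h) / exp (inverse h) = bump1 i h / h"
      unfolding eventually_at_right_field
      by (intro exI[of _ 1]) (auto simp: bump1_def exp_minus field_simps)
  qed
  moreover have "((\<lambda>h. bump1 i h / h) \<longlongrightarrow> 0) (at_left 0)"
  proof (rule Lim_transform_eventually[OF tendsto_const])
    show "\<forall>\<^sub>F h in at_left 0. 0 = bump1 i h / h"
      unfolding eventually_at_left_field
      by (intro exI[of _ "-1"]) (auto simp: bump1_def)
  qed
  ultimately have "((\<lambda>h. bump1 i h / h) \<longlongrightarrow> 0) (at 0)" by (simp add: filterlim_split_at)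
  then show ?thesis by (simp add: equal DERIV_def bump1_def)
qed

text \<open>Since \<open>exp (-1 / (k t))\<close> tends to 1 for every \<open>t > 0\<close>, rescaling alone makes
  these products converge to the indicator function of the box.\<close>

definition box_bump :: "'a::euclidean_space \<Rightarrow> 'a \<Rightarrow> nat \<Rightarrow> 'a \<Rightarrow> real" where
  "box_bump l u n x = (\<Prod>b\<in>Basis. bump1 0 (real (Suc n) * (x \<bullet> b) + (- real (Suc n) * (l \<bullet> b))) *
     bump1 0 (- real (Suc n) * (x \<bullet> b) + real (Suc n) * (u \<bullet> b)))"

lemma box_bump_support: "x \<notin> box l u \<Longrightarrow> box_bump l u n x = 0"
proof -
  assume "x \<notin> box l u"
  then obtain b where b: "b \<in> Basis" "\<not> (l \<bullet> b < x \<bullet> b) \<or> \<not> (x \<bullet> b < u \<bullet> b)" by (auto simp: mem_box)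
  then have "real (Suc n) * (x \<bullet> b) + (- real (Suc n) * (l \<bullet> b)) \<le> 0 \<or> - real (Suc n) * (x \<bullet> b) + real (Suc n) * (u \<bullet> b) \<le> 0"
    by (auto simp: not_less simp del: of_nat_Suc)
  then show ?thesis unfolding box_bump_def using b(1)
    by (intro prod_zero) (auto simp: bump1_def intro!: bexI[of _ b])
qed

lemma box_bump_bounds: "0 \<le> box_bump l u n x" "box_bump l u n x \<le> 1"
proof -
  have b: "0 \<le> bump1 0 t \<and> bump1 0 t \<le> 1" for t by (auto simp: bump1_def)
  show "0 \<le> box_bump l u n x" using b by (auto simp: box_bump_def intro!: prod_nonneg)
  show "box_bump l u n x \<le> 1" using b unfolding box_bump_def
    by (intro prod_le_1) (auto intro!: mult_le_one)
qed

lemma test_function_box_bump: "test_function (box_bump l u n)"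
  unfolding test_function_def
proof (intro conjI allI)
  show "Ck k (box_bump l u n)" for k
    unfolding box_bump_def by (intro Ck_prod Ck_mult Ck_line bump1_DERIV)
  have "{x. box_bump l u n x \<noteq> 0} \<subseteq> cbox l u"
    using box_bump_support[of _ l u n] box_subset_cbox by blast
  then show "compact (closure {x. box_bump l u n x \<noteq> 0})"
    by (meson bounded_cbox bounded_subset compact_closure)
qed

lemma box_bump_tendsto:
  "(\<lambda>n. box_bump l u n x) \<longlonglongrightarrow> indicator (box l u) x"
proof (cases "x \<in> box l u")
  case False
  then show ?thesis by (simp add: box_bump_support)
next
  case True
  have lim: "(\<lambda>n. bump1 0 (real (Suc n) * t)) \<longlonglongrightarrow> 1" if "t > 0" for t
  proof -
    have "(\<lambda>n. exp (- (inverse t * (1 / real (Suc n))))) \<longlonglongrightarrow> exp (- (inverse t * 0))"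
      by (intro tendsto_intros LIMSEQ_Suc[OF lim_1_over_n])
    moreover have "bump1 0 (real (Suc n) * t) = exp (- (inverse t * (1 / real (Suc n))))" for n
      using that by (simp add: bump1_def inverse_eq_divide mult.commute del: of_nat_Suc)
    ultimately show ?thesis by simp
  qed
  have "(\<lambda>n. box_bump l u n x) \<longlonglongrightarrow> (\<Prod>b\<in>(Basis::'a set). 1 * 1)"
    unfolding box_bump_def
  proof (intro tendsto_prod tendsto_mult)
    fix b :: 'a assume "b \<in> Basis"
    then have "x \<bullet> b - l \<bullet> b > 0" "u \<bullet> b - x \<bullet> b > 0" using True by (auto simp: mem_box)
    from lim[OF this(1)] lim[OF this(2)]
    show "(\<lambda>n. bump1 0 (real (Suc n) * (x \<bullet> b) + - real (Suc n) * (l \<bullet> b))) \<longlonglongrightarrow> 1"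
      "(\<lambda>n. bump1 0 (- real (Suc n) * (x \<bullet> b) + real (Suc n) * (u \<bullet> b))) \<longlonglongrightarrow> 1"
      by (simp_all add: algebra_simps)
  qed
  then show ?thesis using True by simp
qed

section \<open>The fundamental lemma of the calculus of variations\<close>

lemma test_function_continuous: "test_function \<phi> \<Longrightarrow> continuous_on UNIV \<phi>"
  by (auto simp: test_function_def intro: Ck_continuous)

text \<open>Lebesgue differentiation: outside a null set \<open>f x\<close> is the limit of the
  averages over cubes with lowest corner \<open>x\<close>, and these vanish since open and closed
  boxes have the same integral.\<close>

lemma AE_zero_if_box_integrals_zero:
  fixes f :: "'a::euclidean_space \<Rightarrow> complex"
  assumes int: "\<And>l u. set_integrable lebesgue (cbox l u) f"
    and zero: "\<And>l u. (LINT x:box l u|lebesgue. f x) = 0"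
  shows "AE x in lebesgue. f x = 0"
proof -
  have "integral (cbox l u) f = 0" for l u
  proof -
    have "set_integrable lebesgue (box l u) f"
      by (rule set_integrable_subset[OF int _ box_subset_cbox]) simp
    from set_lebesgue_integral_eq_integral(2)[OF this]
    show ?thesis using zero[of l u] by (simp add: integral_open_interval)
  qed
  moreover have "f integrable_on cbox l u" for l u
    using set_lebesgue_integral_eq_integral(1)[OF int] .
  then obtain N where N: "negligible N" "\<And>x e. \<lbrakk>x \<notin> N; 0 < e\<rbrakk> \<Longrightarrow> \<exists>d>0. \<forall>h. 0 < h \<and> h < d \<longrightarrow>
       norm (integral (cbox x (x + h *\<^sub>R One)) f /\<^sub>R h ^ DIM('a) - f x) < e"
    by (rule integrable_ccontinuous_explicit[of f]) blast+
  ultimately have "f x = 0" if xN: "x \<notin> N" for x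
  proof -
    have "norm (f x) < e" if e: "e > 0" for e
    proof -
      obtain d where "d > 0" "\<And>h. 0 < h \<and> h < d \<Longrightarrow>
         norm (integral (cbox x (x + h *\<^sub>R One)) f /\<^sub>R h ^ DIM('a) - f x) < e"
        using N(2)[OF xN e] by blast
      from this(2)[of "d / 2"] this(1) \<open>\<And>l u. integral (cbox l u) f = 0\<close> show ?thesis by simp
    qed
    then show ?thesis by (metis less_irrefl zero_less_norm_iff)
  qed
  then show ?thesis
    using N(1) by (intro AE_I'[of N]) (auto simp: negligible_iff_null_sets)
qed

text \<open>The bumps converge to the indicator of an open box and stay below that of the closed
  box, so dominated convergence makes every box integral vanish.\<close>

lemma AE_zero_if_orthogonal_to_test_functions:
  fixes f :: "'a::euclidean_space \<Rightarrow> complex"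
  assumes int: "\<And>l u. set_integrable lebesgue (cbox l u) f"
    and zero: "\<And>\<phi>. test_function \<phi> \<Longrightarrow> (LINT x|lebesgue. \<phi> x *\<^sub>R f x) = 0"
  shows "AE x in lebesgue. f x = 0"
proof (rule AE_zero_if_box_integrals_zero[OF int])
  fix l u :: 'a
  have meas: "(\<lambda>x. indicator (cbox l u) x *\<^sub>R f x) \<in> borel_measurable lebesgue"
    using int[of l u] by (auto simp: set_integrable_def)
  \<comment> \<open>Measurability is at hand for \<open>f\<close> cut off to the closed box; a
    factor that vanishes outside the open box makes this cut-off invisible.\<close>
  have ind: "\<phi> *\<^sub>R f x = \<phi> *\<^sub>R (indicator (cbox l u) x *\<^sub>R f x)" if "x \<notin> box l u \<Longrightarrow> \<phi> = 0" for x and \<phi> :: real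
    using that box_subset_cbox[of l u] by (cases "x \<in> cbox l u") (auto simp: subset_iff)
  have "(\<lambda>n. LINT x|lebesgue. box_bump l u n x *\<^sub>R f x) \<longlonglongrightarrow> (LINT x|lebesgue. indicator (box l u) x *\<^sub>R f x)"
  proof (rule integral_dominated_convergence[where w = "\<lambda>x. norm (indicator (cbox l u) x *\<^sub>R f x)"])
    have "(\<lambda>x. indicator (box l u) x *\<^sub>R (indicator (cbox l u) x *\<^sub>R f x)) \<in> borel_measurable lebesgue"
      by (rule borel_measurable_scaleR[OF borel_measurable_indicator meas]) simp
    moreover have "indicator (box l u) x *\<^sub>R (indicator (cbox l u) x *\<^sub>R f x) = indicator (box l u) x *\<^sub>R f x" for x
      by (rule ind[symmetric]) simp
    ultimately show "(\<lambda>x. indicator (box l u) x *\<^sub>R f x) \<in> borel_measurable lebesgue"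
      by (simp only:)
    show "(\<lambda>x. box_bump l u n x *\<^sub>R f x) \<in> borel_measurable lebesgue" for n
    proof -
      have "box_bump l u n \<in> borel_measurable lebesgue"
        using test_function_continuous[OF test_function_box_bump, of l u n]
        by (intro measurable_completion) (simp add: borel_measurable_continuous_onI)
      then have "(\<lambda>x. box_bump l u n x *\<^sub>R (indicator (cbox l u) x *\<^sub>R f x)) \<in> borel_measurable lebesgue"
        using meas by (rule borel_measurable_scaleR)
      moreover have "box_bump l u n x *\<^sub>R (indicator (cbox l u) x *\<^sub>R f x) = box_bump l u n x *\<^sub>R f x" for x
        by (rule ind[symmetric]) (rule box_bump_support)
      ultimately show ?thesis by (simp only:)
    qed
    show "integrable lebesgue (\<lambda>x. norm (indicator (cbox l u) x *\<^sub>R f x))"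
      using int[of l u] unfolding set_integrable_def by (rule integrable_norm)
    show "AE x in lebesgue. (\<lambda>n. box_bump l u n x *\<^sub>R f x) \<longlonglongrightarrow> indicator (box l u) x *\<^sub>R f x"
      by (intro AE_I2 tendsto_intros box_bump_tendsto)
    show "AE x in lebesgue. norm (box_bump l u n x *\<^sub>R f x) \<le> norm (indicator (cbox l u) x *\<^sub>R f x)" for n
    proof (intro AE_I2)
      fix x
      have "norm (box_bump l u n x *\<^sub>R (indicator (cbox l u) x *\<^sub>R f x)) \<le> 1 * norm (indicator (cbox l u) x *\<^sub>R f x)"
        unfolding norm_scaleR using box_bump_bounds[of l u n x] by (intro mult_right_mono) auto
      moreover have "box_bump l u n x *\<^sub>R (indicator (cbox l u) x *\<^sub>R f x) = box_bump l u n x *\<^sub>R f x"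
        by (rule ind[symmetric]) (rule box_bump_support)
      ultimately show "norm (box_bump l u n x *\<^sub>R f x) \<le> norm (indicator (cbox l u) x *\<^sub>R f x)"
        by (simp only: mult_1)
    qed
  qed
  then have "(LINT x|lebesgue. indicator (box l u) x *\<^sub>R f x) = 0"
    by (simp add: zero[OF test_function_box_bump] LIMSEQ_const_iff)
  then show "(LINT x:box l u|lebesgue. f x) = 0" by (simp add: set_lebesgue_integral_def)
qed

section \<open>Translations and integration by parts\<close>

lemma translate_measurable [measurable]: "(\<lambda>x. x + a) \<in> lebesgue \<rightarrow>\<^sub>M (lebesgue :: 'a::euclidean_space measure)"
  and distr_lebesgue_translate: "distr lebesgue lebesgue (\<lambda>x. x + a) = (lebesgue :: 'a::euclidean_space measure)"
proof -
  have T: "(\<lambda>x::'a. a + (\<Sum>j\<in>Basis. (1 * (x \<bullet> j)) *\<^sub>R j)) = (\<lambda>x. x + a)"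
    by (simp add: fun_eq_iff euclidean_representation add.commute)
  show "(\<lambda>x. x + a) \<in> lebesgue \<rightarrow>\<^sub>M lebesgue"
    using lebesgue_affine_measurable[of "\<lambda>_. 1" a] unfolding T by simp
  show "distr lebesgue lebesgue (\<lambda>x. x + a) = lebesgue"
    using lebesgue_affine_euclidean[of "\<lambda>_. 1" a] unfolding T by (simp add: density_1)
qed

lemma nn_integral_lebesgue_translate:
  fixes f :: "'a::euclidean_space \<Rightarrow> ennreal"
  assumes "f \<in> borel_measurable lebesgue"
  shows "(\<integral>\<^sup>+x. f (x + a) \<partial>lebesgue) = (\<integral>\<^sup>+x. f x \<partial>lebesgue)"
  using nn_integral_distr[OF translate_measurable, of f a] assms by (simp add: distr_lebesgue_translate)

lemma integral_lebesgue_translate: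
  fixes f :: "'a::euclidean_space \<Rightarrow> 'b::{banach, second_countable_topology}"
  assumes "f \<in> borel_measurable lebesgue"
  shows "(LINT x|lebesgue. f (x + a)) = (LINT x|lebesgue. f x)"
  using integral_distr[OF translate_measurable, of f a] assms by (simp add: distr_lebesgue_translate)

lemma L2_translate:
  assumes "f \<in> L2" shows "(\<lambda>x. f (x + a)) \<in> L2" "L2_norm (\<lambda>x. f (x + a)) = L2_norm f"
proof -
  have f: "f \<in> borel_measurable lebesgue" using assms by measurable
  have m: "(\<lambda>x. f (x + a)) \<in> borel_measurable lebesgue"
    using measurable_compose[OF translate_measurable f] .
  show "(\<lambda>x. f (x + a)) \<in> L2"
    using assms m nn_integral_lebesgue_translate[of "\<lambda>x. ennreal ((cmod (f x))\<^sup>2)" a] f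
    unfolding L2_iff by simp
  show "L2_norm (\<lambda>x. f (x + a)) = L2_norm f"
    unfolding L2_norm_def using integral_lebesgue_translate[of "\<lambda>x. (cmod (f x))\<^sup>2" a] f by simp
qed

lemma L2_locally_integrable:
  assumes "f \<in> L2" "compact K" shows "set_integrable lebesgue K f"
proof -
  have "(\<lambda>x. complex_of_real (indicator K x)) \<in> L2"
  proof -
    have "integrable lebesgue (indicator K :: _ \<Rightarrow> real)"
      using assms(2) by (intro integrable_real_indicator) (auto simp: compact_imp_closed emeasure_compact_finite[unfolded infinity_ennreal_def])
    moreover have "(cmod (complex_of_real (indicator K x)))\<^sup>2 = indicator K x" for x by (simp add: indicator_def)
    moreover have "(\<lambda>x. complex_of_real (indicator K x)) \<in> borel_measurable lebesgue"
      using assms(2)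
      by (intro measurable_compose[OF borel_measurable_indicator borel_measurable_continuous_onI] continuous_intros)
        (simp add: compact_imp_closed)
    ultimately show ?thesis by (simp add: L2_def)
  qed
  from L2_mult_integrable[OF this assms(1)] show ?thesis
    by (simp add: set_integrable_def scaleR_conv_of_real)
qed

lemma continuous_compact_support_integrable:
  fixes \<phi> :: "'a::euclidean_space \<Rightarrow> real" and u :: "'a \<Rightarrow> 'b::{banach, second_countable_topology}"
  assumes \<phi>: "continuous_on UNIV \<phi>" and K: "compact K" "\<And>x. x \<notin> K \<Longrightarrow> \<phi> x = 0"
    and u: "set_integrable lebesgue K u"
  shows "integrable lebesgue (\<lambda>x. \<phi> x *\<^sub>R u x)"
proof -
  have "bounded (\<phi> ` K)"
    using K(1) \<phi> by (intro compact_imp_bounded compact_continuous_image continuous_on_subset[OF \<phi>]) auto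
  then obtain B where B: "\<And>x. x \<in> K \<Longrightarrow> \<bar>\<phi> x\<bar> \<le> B" by (auto simp: bounded_iff)
  have eq: "\<phi> x *\<^sub>R u x = \<phi> x *\<^sub>R (indicator K x *\<^sub>R u x)" for x
    using K(2)[of x] by (cases "x \<in> K") auto
  have "integrable lebesgue (\<lambda>x. \<phi> x *\<^sub>R (indicator K x *\<^sub>R u x))"
  proof (rule Bochner_Integration.integrable_bound)
    show "integrable lebesgue (\<lambda>x. B *\<^sub>R (indicator K x *\<^sub>R u x))"
      using u unfolding set_integrable_def by (rule integrable_scaleR_right)
    show "(\<lambda>x. \<phi> x *\<^sub>R (indicator K x *\<^sub>R u x)) \<in> borel_measurable lebesgue"
    proof (rule borel_measurable_scaleR)
      show "\<phi> \<in> borel_measurable lebesgue"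
        using \<phi> by (intro measurable_completion) (simp add: borel_measurable_continuous_onI)
      show "(\<lambda>x. indicator K x *\<^sub>R u x) \<in> borel_measurable lebesgue"
        using u unfolding set_integrable_def by (rule borel_measurable_integrable)
    qed
    show "AE x in lebesgue. norm (\<phi> x *\<^sub>R (indicator K x *\<^sub>R u x)) \<le> norm (B *\<^sub>R (indicator K x *\<^sub>R u x))"
    proof (intro AE_I2)
      fix x
      show "norm (\<phi> x *\<^sub>R (indicator K x *\<^sub>R u x)) \<le> norm (B *\<^sub>R (indicator K x *\<^sub>R u x))"
      proof (cases "x \<in> K")
        case True
        have "\<bar>\<phi> x\<bar> \<le> \<bar>B\<bar>" using B[OF True] by linarith
        then show ?thesis using True by (simp add: mult_right_mono)
      qed simp
    qed
  qed
  then show ?thesis by (simp only: eq[symmetric])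
qed

definition C1_compact :: "('a::euclidean_space \<Rightarrow> real) \<Rightarrow> bool" where
  "C1_compact \<phi> \<longleftrightarrow> Ck 1 \<phi> \<and> compact (closure {x. \<phi> x \<noteq> 0})"

lemma test_function_C1: "test_function \<phi> \<Longrightarrow> C1_compact \<phi>"
  by (auto simp: test_function_def C1_compact_def)

lemma compact_supportI:
  assumes "compact K" "\<And>x. x \<notin> K \<Longrightarrow> \<phi> x = 0"
  shows "compact (closure {x::'a::euclidean_space. \<phi> x \<noteq> (0::real)})"
proof -
  have "{x. \<phi> x \<noteq> 0} \<subseteq> K" using assms(2) by auto
  then show ?thesis using assms(1) by (meson bounded_subset compact_closure compact_imp_bounded)
qed

lemma C1_compact_support:
  assumes "C1_compact \<phi>"
  shows "\<exists>R>0. \<forall>x. x \<notin> cball 0 R \<longrightarrow> \<phi> x = 0 \<and> (\<forall>b. frechet_derivative \<phi> (at x) b = 0)"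
proof -
  have "bounded (closure {x. \<phi> x \<noteq> 0})" using assms by (auto simp: C1_compact_def compact_imp_bounded)
  then obtain R where R: "R > 0" "closure {x. \<phi> x \<noteq> 0} \<subseteq> cball 0 R"
    unfolding bounded_pos by (auto simp: subset_iff)
  have z: "\<phi> x = 0" if "x \<notin> cball 0 R" for x
    using subsetD[OF R(2), of x] subsetD[OF closure_subset, of x "{x. \<phi> x \<noteq> 0}"] that by auto
  have "frechet_derivative \<phi> (at x) b = 0" if x: "x \<notin> cball 0 R" for x b
  proof -
    have "((\<lambda>_. 0) has_derivative (\<lambda>_. 0)) (at x)" by simp
    then have "(\<phi> has_derivative (\<lambda>_. 0)) (at x)"
      by (rule has_derivative_transform_within_open[of _ _ _ _ "- cball 0 R"]) (use x z in auto)
    then show ?thesis by (metis frechet_derivative_at)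
  qed
  then show ?thesis using R(1) z by blast
qed

lemma C1_compact_derivative_continuous:
  "C1_compact \<phi> \<Longrightarrow> b \<in> Basis \<Longrightarrow> continuous_on UNIV (\<lambda>x. frechet_derivative \<phi> (at x) b)"
  by (auto simp: C1_compact_def)

lemma C1_compact_continuous: "C1_compact \<phi> \<Longrightarrow> continuous_on UNIV \<phi>"
  unfolding C1_compact_def by (blast dest: Ck_continuous)

lemma C1_compact_differentiable: "C1_compact \<phi> \<Longrightarrow> \<phi> differentiable (at x)"
  by (auto simp: C1_compact_def)

lemma C1_compact_translate:
  assumes "C1_compact \<phi>" shows "C1_compact (\<lambda>x. \<phi> (x + a))"
proof -
  obtain R where R: "\<And>x. x \<notin> cball 0 R \<Longrightarrow> \<phi> x = 0" using C1_compact_support[OF assms] by blast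
  have "compact (closure {x. \<phi> (x + a) \<noteq> 0})"
    by (rule compact_supportI[of "cball (- a) R"]) (auto intro!: R simp: dist_norm norm_minus_commute add.commute)
  then show ?thesis using assms by (auto simp: C1_compact_def intro: Ck_translate simp del: Ck.simps)
qed

lemma test_function_translate:
  assumes "test_function \<phi>" shows "test_function (\<lambda>x. \<phi> (x + a))"
  using C1_compact_translate[OF test_function_C1[OF assms], of a] assms
  by (auto simp: test_function_def C1_compact_def intro: Ck_translate)

lemma line_DERIV:
  fixes \<phi> :: "'a::euclidean_space \<Rightarrow> real"
  assumes "\<And>x. \<phi> differentiable (at x)"
  shows "((\<lambda>r. \<phi> (x + r *\<^sub>R b)) has_real_derivative frechet_derivative \<phi> (at (x + r *\<^sub>R b)) b) (at r)"
proof -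
  have d: "(\<phi> has_derivative frechet_derivative \<phi> (at (x + r *\<^sub>R b))) (at (x + r *\<^sub>R b))"
    using assms by (simp add: frechet_derivative_works)
  have "((\<lambda>r. x + r *\<^sub>R b) has_derivative (\<lambda>h. h *\<^sub>R b)) (at r)" by (auto intro!: derivative_eq_intros)
  from has_derivative_compose[OF this d]
  have "((\<lambda>r. \<phi> (x + r *\<^sub>R b)) has_derivative (\<lambda>h. frechet_derivative \<phi> (at (x + r *\<^sub>R b)) (h *\<^sub>R b))) (at r)" .
  moreover have "frechet_derivative \<phi> (at (x + r *\<^sub>R b)) (h *\<^sub>R b) = frechet_derivative \<phi> (at (x + r *\<^sub>R b)) b * h" for h
    using linear_cmul[OF has_derivative_linear[OF d]] by simp
  ultimately show ?thesis by (simp add: has_field_derivative_def)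
qed

text \<open>Differentiation under the integral with a weight that is merely locally integrable:
  translates close to \<open>s\<close> live in one compact set, and the mean value inequality bounds
  the difference quotients. With weight 1 this yields integration by parts; with the real or
  imaginary part of an \<open>L2\<close> function it yields the translation estimate.\<close>

lemma translated_integral_DERIV:
  fixes u :: "'a::euclidean_space \<Rightarrow> real"
  assumes \<phi>: "C1_compact \<phi>" and b: "b \<in> Basis" and u: "\<And>K. compact K \<Longrightarrow> set_integrable lebesgue K u"
  shows "((\<lambda>s. LINT x|lebesgue. \<phi> (x + s *\<^sub>R b) *\<^sub>R u x) has_real_derivative
     (LINT x|lebesgue. frechet_derivative \<phi> (at (x + s *\<^sub>R b)) b *\<^sub>R u x)) (at s)"
proof -
  obtain R where R: "R > 0" "\<And>x. x \<notin> cball 0 R \<Longrightarrow> \<phi> x = 0"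
    "\<And>x b. x \<notin> cball 0 R \<Longrightarrow> frechet_derivative \<phi> (at x) b = 0"
    using C1_compact_support[OF \<phi>] by blast
  let ?d = "\<lambda>x. frechet_derivative \<phi> (at x) b"
  have "bounded (?d ` cball 0 R)"
    by (intro compact_imp_bounded compact_continuous_image
        continuous_on_subset[OF C1_compact_derivative_continuous[OF \<phi> b]]) auto
  then obtain B0 where "\<forall>x\<in>cball 0 R. \<bar>?d x\<bar> \<le> B0" by (auto simp: bounded_iff)
  then have B: "\<bar>?d x\<bar> \<le> max B0 0" for x
    using R(3)[of x b] by (cases "x \<in> cball 0 R") (auto simp: le_max_iff_disj)
  define B where "B = max B0 0"
  \<comment> \<open>Contains the support of every translate by \<open>r\<close> with |r - s| <=
    1.\<close>
  define K where "K = cball (0::'a) (R + \<bar>s\<bar> + 1)"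
  have K: "compact K" by (simp add: K_def)
  have out: "x + r *\<^sub>R b \<notin> cball 0 R" if "x \<notin> K" "\<bar>r - s\<bar> \<le> 1" for x r
  proof -
    have "norm x \<le> norm (x + r *\<^sub>R b) + norm (r *\<^sub>R b)"
      using norm_triangle_ineq4[of "x + r *\<^sub>R b" "r *\<^sub>R b"] by simp
    then show ?thesis using that b by (auto simp: K_def)
  qed
  have out0: "\<phi> (x + r *\<^sub>R b) = 0" if "x \<notin> K" "\<bar>r - s\<bar> \<le> 1" for x r
    by (rule R(2)[OF out[OF that]])
  have int: "integrable lebesgue (\<lambda>x. \<phi> (x + r *\<^sub>R b) *\<^sub>R u x)" if "\<bar>r - s\<bar> \<le> 1" for r
    by (rule continuous_compact_support_integrable[OF C1_compact_continuous[OF C1_compact_translate[OF \<phi>]] K _ u[OF K]])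
      (rule R(2)[OF out[OF _ that]])
  have q_le: "\<bar>\<phi> (x + (s + h) *\<^sub>R b) - \<phi> (x + s *\<^sub>R b)\<bar> \<le> B * \<bar>h\<bar>" for x h
  proof -
    have "norm (\<phi> (x + (s + h) *\<^sub>R b) - \<phi> (x + s *\<^sub>R b)) \<le> B * norm ((s + h) - s)"
      by (rule field_differentiable_bound[where S = UNIV])
        (use B line_DERIV[OF C1_compact_differentiable[OF \<phi>]] in \<open>auto simp: B_def\<close>)
    then show ?thesis by simp
  qed
  have "((\<lambda>h. ((LINT x|lebesgue. \<phi> (x + (s + h) *\<^sub>R b) *\<^sub>R u x) - (LINT x|lebesgue. \<phi> (x + s *\<^sub>R b) *\<^sub>R u x)) / h)
      \<longlongrightarrow> (LINT x|lebesgue. ?d (x + s *\<^sub>R b) *\<^sub>R u x)) (at 0)"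
    unfolding tendsto_at_iff_sequentially comp_def
  proof (intro allI impI)
    fix h :: "nat \<Rightarrow> real" assume h: "\<forall>i. h i \<in> UNIV - {0}" and lim: "h \<longlonglongrightarrow> 0"
    let ?q = "\<lambda>i x. ((\<phi> (x + (s + h i) *\<^sub>R b) - \<phi> (x + s *\<^sub>R b)) / h i) *\<^sub>R u x"
    have ev: "\<forall>\<^sub>F i in sequentially. \<bar>h i\<bar> \<le> 1"
    proof -
      have "\<forall>\<^sub>F i in sequentially. dist (h i) 0 < 1" using lim by (rule tendstoD) simp
      then show ?thesis by (rule eventually_mono) simp
    qed
    have eq: "\<forall>\<^sub>F i in sequentially. (LINT x|lebesgue. ?q i x) =
      ((LINT x|lebesgue. \<phi> (x + (s + h i) *\<^sub>R b) *\<^sub>R u x) - (LINT x|lebesgue. \<phi> (x + s *\<^sub>R b) *\<^sub>R u x)) / h i"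
      using ev
    proof (rule eventually_mono)
      fix i assume "\<bar>h i\<bar> \<le> 1"
      then have "integrable lebesgue (\<lambda>x. \<phi> (x + (s + h i) *\<^sub>R b) *\<^sub>R u x)" by (intro int) simp
      moreover have "integrable lebesgue (\<lambda>x. \<phi> (x + s *\<^sub>R b) *\<^sub>R u x)" by (intro int) simp
      moreover have "?q i x = (\<phi> (x + (s + h i) *\<^sub>R b) *\<^sub>R u x - \<phi> (x + s *\<^sub>R b) *\<^sub>R u x) / h i" for x
        by (simp add: diff_divide_distrib left_diff_distrib)
      ultimately show "(LINT x|lebesgue. ?q i x) =
        ((LINT x|lebesgue. \<phi> (x + (s + h i) *\<^sub>R b) *\<^sub>R u x) - (LINT x|lebesgue. \<phi> (x + s *\<^sub>R b) *\<^sub>R u x)) / h i"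
        by (simp only: Bochner_Integration.integral_diff integral_divide_zero)
    qed
    have mu: "(\<lambda>x. indicator K x *\<^sub>R u x) \<in> borel_measurable lebesgue"
      using u[OF K] unfolding set_integrable_def by (rule borel_measurable_integrable)
    have meas: "(\<lambda>x. p x *\<^sub>R u x) \<in> borel_measurable lebesgue"
      if "continuous_on UNIV p" "\<And>x. x \<notin> K \<Longrightarrow> p x = 0" for p :: "'a \<Rightarrow> real"
      using continuous_compact_support_integrable[OF that(1) K that(2) u[OF K]] by (rule borel_measurable_integrable)
    \<comment> \<open>Dominated convergence needs its bound at every index, whereas the supports lie
      in \<open>K\<close> only for steps of size at most 1. The finitely many larger steps are
      replaced by 1.\<close>
    define c where "c i = (if \<bar>h i\<bar> \<le> 1 then h i else 1)" for i
    let ?p = "\<lambda>i x. ((\<phi> (x + (s + c i) *\<^sub>R b) - \<phi> (x + s *\<^sub>R b)) / c i) *\<^sub>R u x"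
    have c: "c i \<noteq> 0" "\<bar>c i\<bar> \<le> 1" for i using h by (auto simp: c_def)
    have evc: "\<forall>\<^sub>F i in sequentially. c i = h i" using ev by (rule eventually_mono) (simp add: c_def)
    have "(\<lambda>i. LINT x|lebesgue. ?p i x) \<longlonglongrightarrow> (LINT x|lebesgue. ?d (x + s *\<^sub>R b) *\<^sub>R u x)"
    proof (rule integral_dominated_convergence[where w = "\<lambda>x. B * norm (indicator K x *\<^sub>R u x)"])
      show "(\<lambda>x. ?d (x + s *\<^sub>R b) *\<^sub>R u x) \<in> borel_measurable lebesgue"
      proof (rule meas)
        show "continuous_on UNIV (\<lambda>x. ?d (x + s *\<^sub>R b))"
          by (rule continuous_on_compose2[OF C1_compact_derivative_continuous[OF \<phi> b]]) (auto intro!: continuous_intros)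
        show "?d (x + s *\<^sub>R b) = 0" if "x \<notin> K" for x
          by (rule R(3), rule out[OF that]) simp
      qed
      show "?p i \<in> borel_measurable lebesgue" for i
      proof (rule meas)
        have cont: "continuous_on UNIV (\<lambda>x. \<phi> (x + a))" for a
          by (rule C1_compact_continuous[OF C1_compact_translate[OF \<phi>]])
        show "continuous_on UNIV (\<lambda>x. (\<phi> (x + (s + c i) *\<^sub>R b) - \<phi> (x + s *\<^sub>R b)) / c i)"
          by (intro continuous_intros cont) (use c in auto)
        fix x assume "x \<notin> K"
        then have "\<phi> (x + (s + c i) *\<^sub>R b) = 0" "\<phi> (x + s *\<^sub>R b) = 0"
          using out0[of x "s + c i"] out0[of x s] c(2)[of i] by simp_all
        then show "(\<phi> (x + (s + c i) *\<^sub>R b) - \<phi> (x + s *\<^sub>R b)) / c i = 0" by simp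
      qed
      show "integrable lebesgue (\<lambda>x. B * norm (indicator K x *\<^sub>R u x))"
        using u[OF K] unfolding set_integrable_def by (intro integrable_mult_right integrable_norm)
      show "AE x in lebesgue. (\<lambda>i. ?p i x) \<longlonglongrightarrow> ?d (x + s *\<^sub>R b) *\<^sub>R u x"
      proof (intro AE_I2 tendsto_scaleR tendsto_const)
        fix x
        have "((\<lambda>h. (\<phi> (x + (s + h) *\<^sub>R b) - \<phi> (x + s *\<^sub>R b)) / h) \<longlongrightarrow> ?d (x + s *\<^sub>R b)) (at 0)"
          using line_DERIV[OF C1_compact_differentiable[OF \<phi>], of x b s] by (simp add: DERIV_def)
        moreover have "c \<longlonglongrightarrow> 0" by (rule Lim_transform_eventually[OF lim]) (use evc in \<open>auto elim: eventually_mono\<close>)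
        ultimately show "(\<lambda>i. (\<phi> (x + (s + c i) *\<^sub>R b) - \<phi> (x + s *\<^sub>R b)) / c i) \<longlonglongrightarrow> ?d (x + s *\<^sub>R b)"
          using c(1) unfolding tendsto_at_iff_sequentially comp_def by blast
      qed
      show "AE x in lebesgue. norm (?p i x) \<le> B * norm (indicator K x *\<^sub>R u x)" for i
      proof (intro AE_I2)
        fix x
        show "norm (?p i x) \<le> B * norm (indicator K x *\<^sub>R u x)"
        proof (cases "x \<in> K")
          case True
          have "\<bar>(\<phi> (x + (s + c i) *\<^sub>R b) - \<phi> (x + s *\<^sub>R b)) / c i\<bar> \<le> B"
            using q_le[of x "c i"] c(1)[of i] by (simp add: divide_le_eq)
          then have "norm (?p i x) \<le> B * norm (u x)" unfolding norm_scaleR by (intro mult_right_mono) auto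
          then show ?thesis using True by simp
        next
          case False
          then have "\<phi> (x + (s + c i) *\<^sub>R b) = 0" "\<phi> (x + s *\<^sub>R b) = 0"
            using out0[of x "s + c i"] out0[of x s] c(2)[of i] by simp_all
          then show ?thesis using False by simp
        qed
      qed
    qed
    moreover have "\<forall>\<^sub>F i in sequentially. (LINT x|lebesgue. ?p i x) =
      ((LINT x|lebesgue. \<phi> (x + (s + h i) *\<^sub>R b) *\<^sub>R u x) - (LINT x|lebesgue. \<phi> (x + s *\<^sub>R b) *\<^sub>R u x)) / h i"
      using eq evc by eventually_elim simp
    ultimately show "(\<lambda>i. ((LINT x|lebesgue. \<phi> (x + (s + h i) *\<^sub>R b) *\<^sub>R u x) - (LINT x|lebesgue. \<phi> (x + s *\<^sub>R b) *\<^sub>R u x)) / h i)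
      \<longlonglongrightarrow> (LINT x|lebesgue. ?d (x + s *\<^sub>R b) *\<^sub>R u x)"
      by (rule Lim_transform_eventually)
  qed
  then show ?thesis by (simp add: DERIV_def)
qed

text \<open>The integral of a translate does not depend on the translation, so its derivative vanishes.\<close>

lemma integral_derivative_zero:
  assumes \<phi>: "C1_compact \<phi>" and b: "b \<in> Basis"
  shows "(LINT x|lebesgue. frechet_derivative \<phi> (at x) b) = 0"
proof -
  have "\<phi> \<in> borel_measurable lebesgue"
    using C1_compact_continuous[OF \<phi>] by (intro measurable_completion) (simp add: borel_measurable_continuous_onI)
  then have const: "(LINT x|lebesgue. \<phi> (x + s *\<^sub>R b)) = (LINT x|lebesgue. \<phi> x)" for s
    by (rule integral_lebesgue_translate)
  have 1: "set_integrable lebesgue K (\<lambda>x. 1::real)" if "compact K" for K :: "'a set"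
    unfolding set_integrable_def using that
    by (auto intro!: integrable_real_indicator simp: compact_imp_closed emeasure_compact_finite[unfolded infinity_ennreal_def])
  have "((\<lambda>s. LINT x|lebesgue. \<phi> (x + s *\<^sub>R b)) has_real_derivative (LINT x|lebesgue. frechet_derivative \<phi> (at x) b)) (at 0)"
    using translated_integral_DERIV[OF \<phi> b, of "\<lambda>x. 1" 0] 1 by simp
  then have "((\<lambda>s::real. LINT x|lebesgue. \<phi> x) has_real_derivative (LINT x|lebesgue. frechet_derivative \<phi> (at x) b)) (at 0)"
    by (simp add: const)
  from DERIV_unique[OF this DERIV_const] show ?thesis .
qed

section \<open>Weak derivatives\<close>

lemma continuous_compact_support_L2:
  assumes \<phi>: "continuous_on UNIV \<phi>" and K: "compact K" "\<And>x. x \<notin> K \<Longrightarrow> \<phi> x = 0"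
  shows "(\<lambda>x::'a::euclidean_space. complex_of_real (\<phi> x)) \<in> L2"
proof -
  have 1: "set_integrable lebesgue K (\<lambda>x. 1::real)"
    unfolding set_integrable_def using K(1)
    by (auto intro!: integrable_real_indicator simp: compact_imp_closed emeasure_compact_finite[unfolded infinity_ennreal_def])
  have "integrable lebesgue (\<lambda>x. (\<phi> x)\<^sup>2 *\<^sub>R (1::real))"
    by (rule continuous_compact_support_integrable[OF _ K(1) _ 1]) (use \<phi> K(2) in \<open>auto intro!: continuous_intros\<close>)
  moreover have "\<phi> \<in> borel_measurable lebesgue"
    using \<phi> by (intro measurable_completion) (simp add: borel_measurable_continuous_onI)
  then have "(\<lambda>x. complex_of_real (\<phi> x)) \<in> borel_measurable lebesgue"
    by (rule measurable_compose) (intro borel_measurable_continuous_onI continuous_intros)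
  ultimately show ?thesis by (simp add: L2_def)
qed

lemma C1_compact_L2:
  assumes "C1_compact \<phi>"
  shows "(\<lambda>x. complex_of_real (\<phi> x)) \<in> L2"
    "b \<in> Basis \<Longrightarrow> (\<lambda>x. complex_of_real (frechet_derivative \<phi> (at x) b)) \<in> L2"
proof -
  obtain R where R: "\<And>x. x \<notin> cball 0 R \<Longrightarrow> \<phi> x = 0"
    "\<And>x b. x \<notin> cball 0 R \<Longrightarrow> frechet_derivative \<phi> (at x) b = 0"
    using C1_compact_support[OF assms] by blast
  show "(\<lambda>x. complex_of_real (\<phi> x)) \<in> L2"
    by (rule continuous_compact_support_L2[OF C1_compact_continuous[OF assms] compact_cball R(1)])
  show "b \<in> Basis \<Longrightarrow> (\<lambda>x. complex_of_real (frechet_derivative \<phi> (at x) b)) \<in> L2"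
    by (rule continuous_compact_support_L2[OF C1_compact_derivative_continuous[OF assms] compact_cball R(2)])
qed

lemma integral_scaleR_eq_L2_inner:
  "(LINT x|lebesgue. \<phi> x *\<^sub>R f x) = L2_inner f (\<lambda>x. complex_of_real (\<phi> x))"
  by (simp add: L2_inner_def scaleR_conv_of_real mult.commute)

lemma integrable_scaleR_L2:
  "(\<lambda>x. complex_of_real (\<phi> x)) \<in> L2 \<Longrightarrow> f \<in> L2 \<Longrightarrow> integrable lebesgue (\<lambda>x. \<phi> x *\<^sub>R f x)"
  using L2_mult_integrable[of "\<lambda>x. complex_of_real (\<phi> x)" f] by (simp add: scaleR_conv_of_real)

lemma zero_outside_closure: "x \<notin> closure {x. \<phi> x \<noteq> 0} \<Longrightarrow> \<phi> x = 0"
  using subsetD[OF closure_subset, of x "{x. \<phi> x \<noteq> 0}"] by auto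

lemma test_function_add:
  assumes "test_function \<phi>" "test_function \<psi>" shows "test_function (\<lambda>x. \<phi> x + \<psi> x)"
proof -
  have "compact (closure {x. \<phi> x + \<psi> x \<noteq> 0})"
  proof (rule compact_supportI)
    show "compact (closure {x. \<phi> x \<noteq> 0} \<union> closure {x. \<psi> x \<noteq> 0})"
      using assms unfolding test_function_def by (blast intro: compact_Un)
    fix x assume "x \<notin> closure {x. \<phi> x \<noteq> 0} \<union> closure {x. \<psi> x \<noteq> 0}"
    then have "\<phi> x = 0" "\<psi> x = 0" using zero_outside_closure[of x \<phi>] zero_outside_closure[of x \<psi>] by blast+
    then show "\<phi> x + \<psi> x = 0" by simp
  qed
  then show ?thesis using assms unfolding test_function_def by (blast intro: Ck_add)
qed

lemma test_function_scale:
  assumes "test_function \<phi>" shows "test_function (\<lambda>x. c * \<phi> x)"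
proof -
  have "compact (closure {x. c * \<phi> x \<noteq> 0})"
  proof (rule compact_supportI)
    show "compact (closure {x. \<phi> x \<noteq> 0})" using assms unfolding test_function_def by blast
    fix x assume "x \<notin> closure {x. \<phi> x \<noteq> 0}"
    then have "\<phi> x = 0" by (rule zero_outside_closure)
    then show "c * \<phi> x = 0" by simp
  qed
  then show ?thesis using assms by (simp add: test_function_def Ck_mult)
qed

text \<open>The derivative of the product of two test functions has integral zero, and the product
  rule splits it into the two sides.\<close>

lemma test_function_has_weak_pderiv:
  assumes \<phi>: "test_function \<phi>" and b: "b \<in> Basis"
  shows "has_weak_pderiv (\<lambda>x. complex_of_real (\<phi> x)) b (\<lambda>x. complex_of_real (frechet_derivative \<phi> (at x) b))"
  unfolding has_weak_pderiv_def
proof (intro allI impI)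
  fix \<psi> :: "'a \<Rightarrow> real" assume \<psi>: "test_function \<psi>"
  note C = test_function_C1[OF \<phi>] test_function_C1[OF \<psi>]
  note L = C1_compact_L2[OF C(1)] C1_compact_L2[OF C(2)]
  have "compact (closure {x. \<psi> x * \<phi> x \<noteq> 0})"
  proof (rule compact_supportI)
    show "compact (closure {x. \<phi> x \<noteq> 0})" using \<phi> unfolding test_function_def by blast
    fix x assume "x \<notin> closure {x. \<phi> x \<noteq> 0}"
    then have "\<phi> x = 0" by (rule zero_outside_closure)
    then show "\<psi> x * \<phi> x = 0" by simp
  qed
  then have C1: "C1_compact (\<lambda>x. \<psi> x * \<phi> x)"
    using \<phi> \<psi> unfolding C1_compact_def test_function_def by (blast intro: Ck_mult)
  have "frechet_derivative (\<lambda>x. \<psi> x * \<phi> x) (at x) b = frechet_derivative \<psi> (at x) b * \<phi> x + \<psi> x * frechet_derivative \<phi> (at x) b" for x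
  proof -
    have "((\<lambda>x. \<psi> x * \<phi> x) has_derivative (\<lambda>h. \<psi> x * frechet_derivative \<phi> (at x) h + frechet_derivative \<psi> (at x) h * \<phi> x)) (at x)"
      by (rule has_derivative_mult) (use C1_compact_differentiable[OF C(1)] C1_compact_differentiable[OF C(2)] in \<open>simp_all add: frechet_derivative_works\<close>)
    from frechet_derivative_at[OF this, symmetric] show ?thesis by simp
  qed
  then have "(LINT x|lebesgue. complex_of_real (frechet_derivative \<psi> (at x) b * \<phi> x + \<psi> x * frechet_derivative \<phi> (at x) b)) = 0"
    using integral_derivative_zero[OF C1 b] by (simp only: integral_complex_of_real of_real_0)
  moreover have "integrable lebesgue (\<lambda>x. frechet_derivative \<psi> (at x) b *\<^sub>R complex_of_real (\<phi> x))"
    "integrable lebesgue (\<lambda>x. \<psi> x *\<^sub>R complex_of_real (frechet_derivative \<phi> (at x) b))"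
    using L b by (auto intro: integrable_scaleR_L2)
  ultimately have "(LINT x|lebesgue. frechet_derivative \<psi> (at x) b *\<^sub>R complex_of_real (\<phi> x)) +
      (LINT x|lebesgue. \<psi> x *\<^sub>R complex_of_real (frechet_derivative \<phi> (at x) b)) = 0"
    by (subst Bochner_Integration.integral_add[symmetric]) (simp_all add: scaleR_conv_of_real)
  then show "(LINT x|lebesgue. frechet_derivative \<psi> (at x) b *\<^sub>R complex_of_real (\<phi> x)) =
      - (LINT x|lebesgue. \<psi> x *\<^sub>R complex_of_real (frechet_derivative \<phi> (at x) b))"
    by (simp add: eq_neg_iff_add_eq_0)
qed

lemma test_function_H1: "test_function \<phi> \<Longrightarrow> (\<lambda>x. complex_of_real (\<phi> x)) \<in> H1"
  unfolding H1_def using C1_compact_L2[OF test_function_C1] test_function_has_weak_pderiv by blast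

section \<open>Duality with test functions and the calculus of weak derivatives\<close>

lemma L2_AE_zero_if_orthogonal_to_test_functions:
  assumes f: "f \<in> L2" and zero: "\<And>\<phi>. test_function \<phi> \<Longrightarrow> L2_inner f (\<lambda>x. complex_of_real (\<phi> x)) = 0"
  shows "AE x in lebesgue. f x = 0"
  by (rule AE_zero_if_orthogonal_to_test_functions)
    (use zero in \<open>auto intro!: L2_locally_integrable[OF f] simp: integral_scaleR_eq_L2_inner\<close>)

lemma L2_norm_mono:
  assumes "f \<in> L2" "g \<in> L2" "\<And>x. cmod (f x) \<le> cmod (g x)" shows "L2_norm f \<le> L2_norm g"
  unfolding L2_norm_def using assms
  by (intro real_sqrt_le_mono integral_mono L2_integrable_square power_mono) auto

text \<open>Complex combinations of test functions are dense, because the residual of the projection of \<open>w\<close>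
  onto their closure is orthogonal to them, hence null.\<close>

lemma L2_norm_le_if_tested:
  assumes w: "w \<in> L2" and M: "\<And>\<phi>. test_function \<phi> \<Longrightarrow>
    cmod (LINT x|lebesgue. \<phi> x *\<^sub>R w x) \<le> M * L2_norm (\<lambda>x. complex_of_real (\<phi> x))" and M0: "0 \<le> M"
  shows "L2_norm w \<le> 2 * M"
proof -
  \<comment> \<open>Projection needs a complex subspace while test functions are real. Bounding the
    two parts of an element separately costs the factor 2 of the conclusion.\<close>
  define S where "S = {\<lambda>x. complex_of_real (\<phi> x) + \<i> * complex_of_real (\<psi> x) | \<phi> \<psi> :: 'a \<Rightarrow> real. test_function \<phi> \<and> test_function \<psi>}"
  have tL: "test_function \<phi> \<Longrightarrow> (\<lambda>x. complex_of_real (\<phi> x)) \<in> L2" for \<phi> :: "'a \<Rightarrow> real"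
    by (rule C1_compact_L2[OF test_function_C1])
  have SI: "(\<lambda>x. complex_of_real (\<phi> x) + \<i> * complex_of_real (\<psi> x)) \<in> S"
    if "test_function \<phi>" "test_function \<psi>" for \<phi> \<psi> :: "'a \<Rightarrow> real"
    using that by (auto simp: S_def)
  have S_sub: "S \<subseteq> L2" by (auto simp: S_def tL)
  have t0: "test_function (\<lambda>x::'a. 0)"
    by (auto simp: test_function_def)
  have S: "fscale.subspace S"
  proof (rule fscale.subspaceI)
    show "0 \<in> S" using SI[OF t0 t0] by (simp add: zero_fun_def)
  next
    fix f g assume "f \<in> S" "g \<in> S"
    then obtain \<phi> \<psi> \<phi>' \<psi>' where t: "test_function \<phi>" "test_function \<psi>" "test_function \<phi>'" "test_function \<psi>'"
      and fg: "f = (\<lambda>x. complex_of_real (\<phi> x) + \<i> * complex_of_real (\<psi> x))" "g = (\<lambda>x. complex_of_real (\<phi>' x) + \<i> * complex_of_real (\<psi>' x))"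
      unfolding S_def by auto
    have eq: "f + g = (\<lambda>x. complex_of_real (\<phi> x + \<phi>' x) + \<i> * complex_of_real (\<psi> x + \<psi>' x))"
      by (simp add: fg fun_eq_iff algebra_simps)
    show "f + g \<in> S" unfolding eq using test_function_add[OF t(1,3)] test_function_add[OF t(2,4)] by (rule SI)
  next
    fix c f assume "f \<in> S"
    then obtain \<phi> \<psi> where t: "test_function \<phi>" "test_function \<psi>"
      and f: "f = (\<lambda>x. complex_of_real (\<phi> x) + \<i> * complex_of_real (\<psi> x))"
      unfolding S_def by auto
    have eq: "fscale c f = (\<lambda>x. complex_of_real (Re c * \<phi> x + (- Im c) * \<psi> x) + \<i> * complex_of_real (Im c * \<phi> x + Re c * \<psi> x))"
      by (simp add: f fun_eq_iff complex_eq_iff)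
    have "test_function (\<lambda>x. Re c * \<phi> x + (- Im c) * \<psi> x)" "test_function (\<lambda>x. Im c * \<phi> x + Re c * \<psi> x)"
      using test_function_add[OF test_function_scale[OF t(1)] test_function_scale[OF t(2)]] by blast+
    then show "fscale c f \<in> S" unfolding eq by (rule SI)
  qed
  obtain p r where pr: "\<And>n. r n \<in> S" "L2.lim_to r p" "\<And>u. u \<in> S \<Longrightarrow> L2_inner (w - p) u = 0"
    using L2.projection[OF S S_sub w] by blast
  have pL: "p \<in> L2" and rL: "r n \<in> L2" for n using pr(2) by (auto simp: L2.lim_to_def)
  have wpL: "w - p \<in> L2" using w pL by simp
  have "AE x in lebesgue. (w - p) x = 0"
  proof (rule L2_AE_zero_if_orthogonal_to_test_functions[OF wpL])
    fix \<phi> :: "'a \<Rightarrow> real" assume "test_function \<phi>"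
    then have "(\<lambda>x. complex_of_real (\<phi> x)) \<in> S" using SI[OF _ t0, of \<phi>] by simp
    then show "L2_inner (w - p) (\<lambda>x. complex_of_real (\<phi> x)) = 0" by (rule pr(3))
  qed
  then have n0: "L2_norm (w - p) = 0" using L2_norm_zero_iff[OF wpL] by simp
  have bound: "cmod (L2_inner w (r n)) \<le> 2 * M * L2_norm (r n)" for n
  proof -
    obtain \<phi> \<psi> where t: "test_function \<phi>" "test_function \<psi>"
      and f: "r n = (\<lambda>x. complex_of_real (\<phi> x) + \<i> * complex_of_real (\<psi> x))"
      using pr(1)[of n] unfolding S_def by auto
    have "r n = (\<lambda>x. complex_of_real (\<phi> x)) + fscale \<i> (\<lambda>x. complex_of_real (\<psi> x))"
      by (simp add: f fun_eq_iff)
    then have "L2_inner w (r n) = L2_inner w (\<lambda>x. complex_of_real (\<phi> x)) + cnj \<i> * L2_inner w (\<lambda>x. complex_of_real (\<psi> x))"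
      using w tL[OF t(1)] tL[OF t(2)] L2.carrier_closed(4)[OF tL[OF t(2)], of \<i>] by (simp only: L2.ip_add_right L2.ip_scale_right)
    then have "cmod (L2_inner w (r n)) \<le> cmod (L2_inner w (\<lambda>x. complex_of_real (\<phi> x))) + cmod (L2_inner w (\<lambda>x. complex_of_real (\<psi> x)))"
      by (metis complex_cnj_i mult_1 norm_ii norm_minus_cancel norm_mult norm_triangle_ineq)
    also have "\<dots> \<le> M * L2_norm (\<lambda>x. complex_of_real (\<phi> x)) + M * L2_norm (\<lambda>x. complex_of_real (\<psi> x))"
      using M[OF t(1)] M[OF t(2)] by (simp add: integral_scaleR_eq_L2_inner)
    also have "\<dots> \<le> M * L2_norm (r n) + M * L2_norm (r n)"
    proof (intro add_mono mult_left_mono M0 L2_norm_mono tL t rL)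
      fix x
      show "cmod (complex_of_real (\<phi> x)) \<le> cmod (r n x)" "cmod (complex_of_real (\<psi> x)) \<le> cmod (r n x)"
        using abs_Re_le_cmod[of "r n x"] abs_Im_le_cmod[of "r n x"] by (simp_all add: f)
    qed
    finally show ?thesis by simp
  qed
  have "cmod (L2_inner w p) \<le> 2 * M * L2_norm p"
  proof (rule LIMSEQ_le)
    show "(\<lambda>n. cmod (L2_inner w (r n))) \<longlonglongrightarrow> cmod (L2_inner w p)"
      by (intro tendsto_norm L2.lim_to_ip_const' pr w)
    show "(\<lambda>n. 2 * M * L2_norm (r n)) \<longlonglongrightarrow> 2 * M * L2_norm p"
      using L2.lim_to_nrm[OF pr(2)] unfolding L2_nrm by (intro tendsto_intros)
  qed (use bound in auto)
  \<comment> \<open>As \<open>w - p\<close> is null, \<open>w\<close> may replace \<open>p\<close>,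
    and the bound becomes |w|^2 <= 2 M |w|.\<close>
  moreover have "L2_inner w p = L2_inner w w"
  proof -
    have "cmod (L2_inner w (w - p)) \<le> L2_norm w * L2_norm (w - p)" using w wpL by (rule L2_Cauchy_Schwarz)
    then have "L2_inner w (w - p) = 0" using n0 by simp
    then show ?thesis using w pL by (simp only: L2.ip_diff_right) simp
  qed
  moreover have "L2_norm p = L2_norm w"
    using L2.nrm_triangle_diff[of w p 0] L2.nrm_triangle_diff[of p w 0] L2.nrm_minus_commute[of p w] w pL n0
    by (simp add: L2_nrm)
  moreover have "cmod (L2_inner w w) = (L2_norm w)\<^sup>2"
    using L2.ip_self[OF w] unfolding L2_nrm by (simp add: norm_power)
  ultimately have "L2_norm w * L2_norm w \<le> 2 * M * L2_norm w" by (simp add: power2_eq_square)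
  then show ?thesis
    using L2.nrm_nonneg[OF w] M0 unfolding L2_nrm by (cases "L2_norm w = 0") auto
qed

lemma has_weak_pderiv_unique:
  assumes "has_weak_pderiv f b g" "has_weak_pderiv f b g'" "g \<in> L2" "g' \<in> L2"
  shows "AE x in lebesgue. g x = g' x"
proof -
  have "AE x in lebesgue. (g - g') x = 0"
  proof (rule L2_AE_zero_if_orthogonal_to_test_functions)
    fix \<phi> :: "'a \<Rightarrow> real" assume t: "test_function \<phi>"
    have "L2_inner g (\<lambda>x. complex_of_real (\<phi> x)) = L2_inner g' (\<lambda>x. complex_of_real (\<phi> x))"
      using assms(1,2) t unfolding has_weak_pderiv_def by (simp add: integral_scaleR_eq_L2_inner[symmetric])
    then show "L2_inner (g - g') (\<lambda>x. complex_of_real (\<phi> x)) = 0"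
      using assms(3,4) C1_compact_L2(1)[OF test_function_C1[OF t]] by (simp only: L2.ip_diff_left) simp
  qed (use assms L2.carrier_closed(3) in blast)
  then show ?thesis by simp
qed

lemma has_weak_pderiv_iff_L2_inner:
  "has_weak_pderiv f b g \<longleftrightarrow> (\<forall>\<phi>. test_function \<phi> \<longrightarrow>
     L2_inner f (\<lambda>x. complex_of_real (frechet_derivative \<phi> (at x) b)) = - L2_inner g (\<lambda>x. complex_of_real (\<phi> x)))"
  by (simp add: has_weak_pderiv_def integral_scaleR_eq_L2_inner)

lemma has_weak_pderiv_add:
  assumes "has_weak_pderiv f b g" "has_weak_pderiv f' b g'" "f \<in> L2" "g \<in> L2" "f' \<in> L2" "g' \<in> L2" "b \<in> Basis"
  shows "has_weak_pderiv (f + f') b (g + g')"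
  unfolding has_weak_pderiv_iff_L2_inner
proof (intro allI impI)
  fix \<phi> :: "'a \<Rightarrow> real" assume t: "test_function \<phi>"
  then show "L2_inner (f + f') (\<lambda>x. complex_of_real (frechet_derivative \<phi> (at x) b)) =
      - L2_inner (g + g') (\<lambda>x. complex_of_real (\<phi> x))"
    using assms C1_compact_L2(1)[OF test_function_C1[OF t]] C1_compact_L2(2)[OF test_function_C1[OF t] assms(7)]
    by (simp add: L2.ip_add_left has_weak_pderiv_iff_L2_inner)
qed

lemma has_weak_pderiv_scale:
  assumes "has_weak_pderiv f b g" "f \<in> L2" "g \<in> L2" "b \<in> Basis"
  shows "has_weak_pderiv (fscale c f) b (fscale c g)"
  unfolding has_weak_pderiv_iff_L2_inner
proof (intro allI impI)
  fix \<phi> :: "'a \<Rightarrow> real" assume t: "test_function \<phi>"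
  then show "L2_inner (fscale c f) (\<lambda>x. complex_of_real (frechet_derivative \<phi> (at x) b)) =
      - L2_inner (fscale c g) (\<lambda>x. complex_of_real (\<phi> x))"
    using assms C1_compact_L2(1)[OF test_function_C1[OF t]] C1_compact_L2(2)[OF test_function_C1[OF t] assms(4)]
    by (simp add: L2.ip_scale_left has_weak_pderiv_iff_L2_inner)
qed

text \<open>Against a fixed test function both sides are continuous in \<open>L2\<close>. This makes
  the weak gradient a closed operation and the form domain complete.\<close>

lemma has_weak_pderiv_limit:
  assumes "\<And>n. has_weak_pderiv (X n) b (Y n)" "L2.lim_to X f" "L2.lim_to Y g" "b \<in> Basis"
  shows "has_weak_pderiv f b g"
  unfolding has_weak_pderiv_iff_L2_inner
proof (intro allI impI)
  fix \<phi> :: "'a \<Rightarrow> real" assume t: "test_function \<phi>"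
  note L = C1_compact_L2(1)[OF test_function_C1[OF t]] C1_compact_L2(2)[OF test_function_C1[OF t] assms(4)]
  have "(\<lambda>n. - L2_inner (Y n) (\<lambda>x. complex_of_real (\<phi> x))) \<longlonglongrightarrow> - L2_inner g (\<lambda>x. complex_of_real (\<phi> x))"
    by (intro tendsto_minus L2.lim_to_ip_const assms L)
  moreover have "(\<lambda>n. L2_inner (X n) (\<lambda>x. complex_of_real (frechet_derivative \<phi> (at x) b))) \<longlonglongrightarrow>
      L2_inner f (\<lambda>x. complex_of_real (frechet_derivative \<phi> (at x) b))"
    by (intro L2.lim_to_ip_const assms L)
  moreover have "L2_inner (X n) (\<lambda>x. complex_of_real (frechet_derivative \<phi> (at x) b)) = - L2_inner (Y n) (\<lambda>x. complex_of_real (\<phi> x))" for n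
    using assms(1)[of n] t unfolding has_weak_pderiv_iff_L2_inner by blast
  ultimately show "L2_inner f (\<lambda>x. complex_of_real (frechet_derivative \<phi> (at x) b)) = - L2_inner g (\<lambda>x. complex_of_real (\<phi> x))"
    using LIMSEQ_unique by simp
qed

text \<open>Tested against \<open>\<phi>\<close>, the translate \<open>f (x + t b)\<close> has \<open>t\<close>-derivative bounded by
  \<open>L2_norm g * L2_norm \<phi>\<close>.\<close>

lemma L2_translation_estimate:
  fixes f g :: "'a::euclidean_space \<Rightarrow> complex"
  assumes f: "f \<in> L2" and g: "g \<in> L2" and b: "b \<in> Basis" and weak: "has_weak_pderiv f b g"
  shows "L2_norm (\<lambda>x. f (x + t *\<^sub>R b) - f x) \<le> 4 * \<bar>t\<bar> * L2_norm g"
proof -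
  have ng: "0 \<le> L2_norm g" using L2.nrm_nonneg[OF g] by (simp add: L2_nrm)
  \<comment> \<open>One factor 2 stems from \<open>L2_norm_le_if_tested\<close>, the other from the
    separate treatment of real and imaginary parts.\<close>
  have "L2_norm (\<lambda>x. f (x + t *\<^sub>R b) - f x) \<le> 2 * (2 * (\<bar>t\<bar> * L2_norm g))"
  proof (rule L2_norm_le_if_tested)
    show "(\<lambda>x. f (x + t *\<^sub>R b) - f x) \<in> L2" using f by (simp add: L2_translate)
    fix \<phi> :: "'a \<Rightarrow> real" assume \<phi>: "test_function \<phi>"
    define G where "G s = (LINT x|lebesgue. \<phi> (x + s *\<^sub>R b) *\<^sub>R f x)" for s
    note \<phi>C = test_function_C1[OF \<phi>]
    note \<phi>L = C1_compact_L2[OF C1_compact_translate[OF \<phi>C]]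
    have fd: "frechet_derivative (\<lambda>x. \<phi> (x + a)) (at x) = frechet_derivative \<phi> (at (x + a))" for a x
      by (rule frechet_derivative_translate[OF C1_compact_differentiable[OF \<phi>C]])
    \<comment> \<open>The derivative formula is for real weights; \<open>p\<close> will be
      \<open>Re\<close> and \<open>Im\<close>.\<close>
    have part: "\<bar>p (G (- t)) - p (G 0)\<bar> \<le> L2_norm g * L2_norm (\<lambda>x. complex_of_real (\<phi> x)) * \<bar>t\<bar>"
      if p: "bounded_linear p" and p_le: "\<And>z. \<bar>p z\<bar> \<le> cmod z" for p :: "complex \<Rightarrow> real"
    proof -
      interpret p: bounded_linear p by fact
      have pint: "p (LINT x|lebesgue. \<psi> x *\<^sub>R h x) = (LINT x|lebesgue. \<psi> x *\<^sub>R p (h x))"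
        if "(\<lambda>x. complex_of_real (\<psi> x)) \<in> L2" "h \<in> L2" for \<psi> :: "'a \<Rightarrow> real" and h
        using integral_bounded_linear[OF p integrable_scaleR_L2[OF that]] by (simp add: p.scaleR)
      have pG: "p (G s) = (LINT x|lebesgue. \<phi> (x + s *\<^sub>R b) *\<^sub>R p (f x))" for s
        unfolding G_def by (rule pint[OF \<phi>L(1) f])
      \<comment> \<open>A translated test function is a test function, so the weak derivative trades
        the derivative of \<open>\<phi>\<close> for \<open>g\<close>.\<close>
      have deriv: "((\<lambda>s. p (G s)) has_real_derivative p (- (LINT x|lebesgue. \<phi> (x + s *\<^sub>R b) *\<^sub>R g x))) (at s)" for s
      proof -
        have "p (- (LINT x|lebesgue. \<phi> (x + s *\<^sub>R b) *\<^sub>R g x)) =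
            p (LINT x|lebesgue. frechet_derivative \<phi> (at (x + s *\<^sub>R b)) b *\<^sub>R f x)"
          using weak[unfolded has_weak_pderiv_def, rule_format, OF test_function_translate[OF \<phi>, of "s *\<^sub>R b"]]
          unfolding fd by simp
        also have "\<dots> = (LINT x|lebesgue. frechet_derivative \<phi> (at (x + s *\<^sub>R b)) b *\<^sub>R p (f x))"
          using \<phi>L(2)[OF b, of "s *\<^sub>R b"] unfolding fd by (intro pint f)
        finally show ?thesis
          unfolding pG
          by (simp only:) (rule translated_integral_DERIV[OF \<phi>C b], unfold set_integrable_def, subst p.scaleR[symmetric],
              rule integrable_bounded_linear[OF p], fold set_integrable_def, rule L2_locally_integrable[OF f])
      qed
      have bound: "\<bar>p (- (LINT x|lebesgue. \<phi> (x + s *\<^sub>R b) *\<^sub>R g x))\<bar> \<le> L2_norm g * L2_norm (\<lambda>x. complex_of_real (\<phi> x))" for s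
      proof -
        have "\<bar>p (- (LINT x|lebesgue. \<phi> (x + s *\<^sub>R b) *\<^sub>R g x))\<bar> \<le> cmod (LINT x|lebesgue. \<phi> (x + s *\<^sub>R b) *\<^sub>R g x)"
          using p_le[of "- (LINT x|lebesgue. \<phi> (x + s *\<^sub>R b) *\<^sub>R g x)"] by simp
        also have "\<dots> \<le> L2_norm g * L2_norm (\<lambda>x. complex_of_real (\<phi> (x + s *\<^sub>R b)))"
          unfolding integral_scaleR_eq_L2_inner by (rule L2_Cauchy_Schwarz[OF g \<phi>L(1)])
        also have "L2_norm (\<lambda>x. complex_of_real (\<phi> (x + s *\<^sub>R b))) = L2_norm (\<lambda>x. complex_of_real (\<phi> x))"
          by (rule L2_translate(2)[OF C1_compact_L2(1)[OF \<phi>C]])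
        finally show ?thesis .
      qed
      have "norm (p (G (- t)) - p (G 0)) \<le> L2_norm g * L2_norm (\<lambda>x. complex_of_real (\<phi> x)) * norm (- t - 0)"
        by (rule field_differentiable_bound[where S = UNIV and f' = "\<lambda>s. p (- (LINT x|lebesgue. \<phi> (x + s *\<^sub>R b) *\<^sub>R g x))"])
          (use deriv bound in simp_all)
      then show ?thesis by simp
    qed
    \<comment> \<open>Substitution moves the translation from \<open>f\<close> to the test function
      and reverses its sign.\<close>
    have "(LINT x|lebesgue. \<phi> x *\<^sub>R f (x + t *\<^sub>R b)) = G (- t)"
    proof -
      have "(\<lambda>x. \<phi> (x + (- t) *\<^sub>R b) *\<^sub>R f x) \<in> borel_measurable lebesgue"
        by (rule borel_measurable_integrable[OF integrable_scaleR_L2[OF \<phi>L(1) f]])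
      from integral_lebesgue_translate[OF this, of "t *\<^sub>R b"] show ?thesis by (simp add: G_def)
    qed
    moreover have "(LINT x|lebesgue. \<phi> x *\<^sub>R f x) = G 0" by (simp add: G_def)
    moreover have "(LINT x|lebesgue. \<phi> x *\<^sub>R (f (x + t *\<^sub>R b) - f x)) =
        (LINT x|lebesgue. \<phi> x *\<^sub>R f (x + t *\<^sub>R b)) - (LINT x|lebesgue. \<phi> x *\<^sub>R f x)"
      unfolding scaleR_diff_right
      by (intro Bochner_Integration.integral_diff integrable_scaleR_L2 C1_compact_L2(1)[OF \<phi>C] f L2_translate)
    ultimately have "cmod (LINT x|lebesgue. \<phi> x *\<^sub>R (f (x + t *\<^sub>R b) - f x)) = cmod (G (- t) - G 0)" by simp
    also have "\<dots> \<le> \<bar>Re (G (- t)) - Re (G 0)\<bar> + \<bar>Im (G (- t)) - Im (G 0)\<bar>"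
      using cmod_le[of "G (- t) - G 0"] by simp
    also have "\<dots> \<le> L2_norm g * L2_norm (\<lambda>x. complex_of_real (\<phi> x)) * \<bar>t\<bar> + L2_norm g * L2_norm (\<lambda>x. complex_of_real (\<phi> x)) * \<bar>t\<bar>"
      by (intro add_mono part bounded_linear_Re bounded_linear_Im abs_Re_le_cmod abs_Im_le_cmod)
    finally show "cmod (LINT x|lebesgue. \<phi> x *\<^sub>R (f (x + t *\<^sub>R b) - f x)) \<le> 2 * (\<bar>t\<bar> * L2_norm g) * L2_norm (\<lambda>x. complex_of_real (\<phi> x))"
      by (simp add: algebra_simps)
  qed (use ng in simp)
  then show ?thesis by simp
qed

section \<open>Compactness of the embedding of the form domain\<close>

lemma H1_L2: "f \<in> H1 \<Longrightarrow> f \<in> L2"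
  by (simp add: H1_def)

lemma weak_pderiv:
  assumes "f \<in> H1" "b \<in> Basis"
  shows "weak_pderiv b f \<in> L2" "has_weak_pderiv f b (weak_pderiv b f)"
proof -
  have "\<exists>g. g \<in> L2 \<and> has_weak_pderiv f b g" using assms by (auto simp: H1_def)
  from someI_ex[OF this] show "weak_pderiv b f \<in> L2" "has_weak_pderiv f b (weak_pderiv b f)"
    by (auto simp: weak_pderiv_def)
qed

lemma weak_pderiv_norm_le: "f \<in> H1 \<Longrightarrow> b \<in> Basis \<Longrightarrow> L2_norm (weak_pderiv b f) \<le> grad_norm f"
  unfolding grad_norm_def
  by (intro real_le_rsqrt member_le_sum[of b Basis "\<lambda>b. (L2_norm (weak_pderiv b f))\<^sup>2"]) auto

text \<open>Weak derivatives are given along the basis only, so \<open>h\<close> is reached one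
  coordinate at a time; each move costs at most 4 r times the gradient norm.\<close>

lemma H1_translation_estimate:
  fixes f :: "'a::euclidean_space \<Rightarrow> complex" and r :: real
  assumes f: "f \<in> H1" and h: "norm h \<le> r"
  shows "L2_norm (\<lambda>x. f (x + h) - f x) \<le> 4 * DIM('a) * r * grad_norm f"
proof -
  note fL = H1_L2[OF f]
  have r: "0 \<le> r" using h norm_ge_zero order_trans by blast
  have partial: "L2_norm (\<lambda>x. f (x + (\<Sum>b\<in>B. (h \<bullet> b) *\<^sub>R b)) - f x) \<le> 4 * card B * r * grad_norm f"
    if "finite B" "B \<subseteq> Basis" for B
    using that
  proof (induction B rule: finite_induct)
    case empty
    then show ?case by (simp add: L2_norm_def)
  next
    case (insert b B)
    define a where "a = (\<Sum>b\<in>B. (h \<bullet> b) *\<^sub>R b)"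
    have b: "b \<in> Basis" using insert.prems by simp
    let ?u = "\<lambda>x. f (x + (h \<bullet> b) *\<^sub>R b) - f x"
    have u: "?u \<in> L2" using fL by (simp add: L2_translate)
    have "L2_norm ?u \<le> 4 * \<bar>h \<bullet> b\<bar> * L2_norm (weak_pderiv b f)"
      by (rule L2_translation_estimate[OF fL weak_pderiv(1)[OF f b] b weak_pderiv(2)[OF f b]])
    also have "\<dots> \<le> 4 * r * grad_norm f"
      using Basis_le_norm[OF b, of h] h L2.nrm_nonneg[OF weak_pderiv(1)[OF f b], unfolded L2_nrm] r
      by (intro mult_mono weak_pderiv_norm_le f b) auto
    finally have 1: "L2_norm (\<lambda>x. ?u (x + a)) \<le> 4 * r * grad_norm f" using L2_translate(2)[OF u] by simp
    have 2: "L2_norm (\<lambda>x. f (x + a) - f x) \<le> 4 * card B * r * grad_norm f"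
      using insert.IH insert.prems unfolding a_def by simp
    have "(\<lambda>x. f (x + (\<Sum>b\<in>insert b B. (h \<bullet> b) *\<^sub>R b)) - f x) = (\<lambda>x. ?u (x + a)) + (\<lambda>x. f (x + a) - f x)"
      using insert.hyps by (simp add: fun_eq_iff a_def algebra_simps)
    moreover have "(\<lambda>x. ?u (x + a)) \<in> L2" by (rule L2_translate(1)[OF u])
    moreover have "(\<lambda>x. f (x + a) - f x) \<in> L2" using fL by (simp add: L2_translate)
    ultimately have "L2_norm (\<lambda>x. f (x + (\<Sum>b\<in>insert b B. (h \<bullet> b) *\<^sub>R b)) - f x) \<le>
        4 * r * grad_norm f + 4 * card B * r * grad_norm f"
      using L2.nrm_triangle[of "\<lambda>x. ?u (x + a)" "\<lambda>x. f (x + a) - f x"] 1 2 unfolding L2_nrm by simp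
    then show ?case using insert.hyps by (simp add: algebra_simps)
  qed
  from partial[of Basis] show ?thesis by (simp add: euclidean_representation)
qed

section \<open>Local averages and oscillation of Borel functions\<close>

lemma nn_integral_lborel_translate:
  fixes f :: "'a::euclidean_space \<Rightarrow> ennreal"
  assumes [measurable]: "f \<in> borel_measurable borel"
  shows "(\<integral>\<^sup>+x. f (a + x) \<partial>lborel) = (\<integral>\<^sup>+x. f x \<partial>lborel)"
proof -
  have "(\<integral>\<^sup>+x. f x \<partial>lborel) = (\<integral>\<^sup>+x. f x \<partial>distr lborel borel ((+) a))" by (simp only: lborel_distr_plus)
  also have "\<dots> = (\<integral>\<^sup>+x. f (a + x) \<partial>lborel)" by (rule nn_integral_distr) auto
  finally show ?thesis by simp
qed

lemma norm_square_add_le: "(norm (a + b :: 'a::real_normed_vector))\<^sup>2 \<le> 2 * (norm a)\<^sup>2 + 2 * (norm b)\<^sup>2"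
proof -
  have "(norm (a + b))\<^sup>2 \<le> (norm a + norm b)\<^sup>2" by (intro power_mono norm_triangle_ineq) simp
  also have "\<dots> \<le> 2 * (norm a)\<^sup>2 + 2 * (norm b)\<^sup>2"
    using sum_squares_bound[of "norm a" "norm b"] by (simp add: power2_sum)
  finally show ?thesis .
qed

lemma pred_mem_ball [measurable]:
  "Measurable.pred borel (\<lambda>x::'a::euclidean_space. x \<in> ball a r)"
  "Measurable.pred borel (\<lambda>x::'a::euclidean_space. x \<in> cball a r)"
  unfolding mem_ball mem_cball by measurable

text \<open>At \<open>r = 2 * \<epsilon>\<close> this is K(x) of the overview. Over
  \<open>lborel\<close> the map (x, h) -> f(x + h) is jointly measurable for Borel \<open>f\<close>,
  and values in \<open>ennreal\<close> permit Tonelli before finiteness is known.\<close>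

definition oscillation :: "('a::euclidean_space \<Rightarrow> complex) \<Rightarrow> real \<Rightarrow> 'a \<Rightarrow> ennreal" where
  "oscillation f r x = (\<integral>\<^sup>+h. indicator (ball 0 r) h * ennreal ((cmod (f x - f (x + h)))\<^sup>2) \<partial>lborel)"

lemma measurable_lborel_pair:
  "borel_measurable (lborel \<Otimes>\<^sub>M lborel) = borel_measurable (borel \<Otimes>\<^sub>M borel)"
  "borel_measurable (borel \<Otimes>\<^sub>M lborel) = borel_measurable (borel \<Otimes>\<^sub>M borel)"
  by (intro measurable_cong_sets sets_pair_measure_cong sets_lborel refl)+

text \<open>With a moving centre, the condition on \<open>dist\<close> is visibly measurable in
  centre and point jointly.\<close>

lemma indicator_ball: "indicator (ball x r) y = (if dist x y < r then 1 else 0)"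
  by (simp add: indicator_def)

lemma oscillation_measurable [measurable]:
  assumes [measurable]: "f \<in> borel_measurable borel"
  shows "oscillation f r \<in> borel_measurable borel"
  unfolding oscillation_def indicator_ball
  by (rule lborel.borel_measurable_nn_integral, unfold measurable_lborel_pair) measurable

lemma nn_integral_oscillation_le:
  fixes f :: "'a::euclidean_space \<Rightarrow> complex"
  assumes [measurable]: "f \<in> borel_measurable borel"
    and T: "\<And>h. h \<in> ball 0 r \<Longrightarrow> (\<integral>\<^sup>+x. ennreal ((cmod (f x - f (x + h)))\<^sup>2) \<partial>lborel) \<le> T"
  shows "(\<integral>\<^sup>+x. oscillation f r x \<partial>lborel) \<le> emeasure lborel (ball (0::'a::euclidean_space) r) * T"
proof -
  have "(\<integral>\<^sup>+x. oscillation f r x \<partial>lborel) =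
      (\<integral>\<^sup>+h. \<integral>\<^sup>+x. indicator (ball 0 r) h * ennreal ((cmod (f x - f (x + h)))\<^sup>2) \<partial>lborel \<partial>lborel)"
    unfolding oscillation_def indicator_ball
    by (rule lborel_pair.Fubini', unfold measurable_lborel_pair) measurable
  also have "\<dots> = (\<integral>\<^sup>+h. indicator (ball 0 r) h * (\<integral>\<^sup>+x. ennreal ((cmod (f x - f (x + h)))\<^sup>2) \<partial>lborel) \<partial>lborel)"
    by (intro nn_integral_cong nn_integral_cmult) measurable
  also have "\<dots> \<le> (\<integral>\<^sup>+h. indicator (ball (0::'a) r) h * T \<partial>lborel)"
    by (intro nn_integral_mono) (auto simp: indicator_def intro: T)
  also have "\<dots> = emeasure lborel (ball (0::'a) r) * T"
    by (subst nn_integral_multc) (auto intro!: borel_measurable_indicator)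
  finally show ?thesis .
qed

lemma indicator_ball_L2: "(\<lambda>x. complex_of_real (indicator (ball y r) x)) \<in> L2"
proof -
  have "integrable lebesgue (indicator (ball y r) :: _ \<Rightarrow> real)"
    by (intro integrable_real_indicator) (auto simp: emeasure_bounded_finite[unfolded infinity_ennreal_def])
  moreover have "(cmod (complex_of_real (indicator (ball y r) x)))\<^sup>2 = indicator (ball y r) x" for x
    by (simp add: indicator_def)
  moreover have "(\<lambda>x. complex_of_real (indicator (ball y r) x)) \<in> borel_measurable lebesgue"
    by (intro measurable_compose[OF borel_measurable_indicator borel_measurable_continuous_onI] continuous_intros) simp
  ultimately show ?thesis by (simp add: L2_def)
qed

text \<open>Cauchy--Schwarz for \<open>w * f x\<close> minus the integral of \<open>f\<close> over the ball.\<close>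

lemma near_bound:
  fixes f :: "'a::euclidean_space \<Rightarrow> complex"
  assumes [measurable]: "f \<in> borel_measurable borel" and f: "f \<in> L2" and x: "x \<in> ball y \<epsilon>"
  defines "w \<equiv> measure lborel (ball (0::'a) \<epsilon>)"
  shows "ennreal (w\<^sup>2 * (cmod (f x))\<^sup>2) \<le>
    ennreal (2 * (cmod (L2_inner f (\<lambda>z. complex_of_real (indicator (ball y \<epsilon>) z))))\<^sup>2) + ennreal (2 * w) * oscillation f (2 * \<epsilon>) x"
proof -
  define \<kappa> where "\<kappa> z = complex_of_real (indicator (ball y \<epsilon>) z)" for z
  have \<kappa>: "\<kappa> \<in> L2" unfolding \<kappa>_def by (rule indicator_ball_L2)
  have w0: "0 \<le> w" by (simp add: w_def)
  have wy: "w = measure lebesgue (ball y \<epsilon>)"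
  proof -
    have "ball y \<epsilon> = (+) y ` ball 0 \<epsilon>" by simp
    then show ?thesis using measure_translation[of y "ball 0 \<epsilon>"] by (simp add: w_def)
  qed
  have \<kappa>\<kappa>: "L2_inner \<kappa> \<kappa> = of_real w"
  proof -
    have "(cmod (\<kappa> z))\<^sup>2 = indicator (ball y \<epsilon>) z" for z by (simp add: \<kappa>_def indicator_def)
    then show ?thesis by (simp add: L2_inner_self wy)
  qed
  \<comment> \<open>Pairing with \<open>\<kappa>\<close> gives w f(x) minus the integral of f over
    the ball. Where \<open>a\<close> is nonzero, z and x share a ball of radius \<epsilon>, hence
    the oscillation radius 2 \<epsilon>.\<close>
  define a where "a z = \<kappa> z * (f x - f z)" for z
  have af: "a = fscale (f x) \<kappa> - (\<lambda>z. \<kappa> z * f z)" by (simp add: a_def fun_eq_iff algebra_simps)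
  have \<kappa>f: "(\<lambda>z. \<kappa> z * f z) \<in> L2"
    by (rule L2_bound[OF borel_measurable_times[OF L2_measurable[OF \<kappa>] L2_measurable[OF f]] f f, of 1 0])
      (auto simp: \<kappa>_def indicator_def norm_mult)
  have aL: "a \<in> L2" unfolding af using \<kappa>f L2.carrier_closed(4)[OF \<kappa>, of "f x"] by (rule L2.carrier_closed(3)[rotated])
  have "L2_inner a \<kappa> = f x * of_real w - L2_inner (\<lambda>z. \<kappa> z * f z) \<kappa>"
    unfolding af using \<kappa> \<kappa>f L2.carrier_closed(4)[OF \<kappa>, of "f x"] by (simp only: L2.ip_diff_left L2.ip_scale_left \<kappa>\<kappa>)
  moreover have "L2_inner (\<lambda>z. \<kappa> z * f z) \<kappa> = L2_inner f \<kappa>"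
    unfolding L2_inner_def by (intro Bochner_Integration.integral_cong) (auto simp: \<kappa>_def indicator_def)
  ultimately have eq: "of_real w * f x = L2_inner f \<kappa> + L2_inner a \<kappa>" by simp
  have "(cmod (L2_inner a \<kappa>))\<^sup>2 \<le> (L2_norm a * L2_norm \<kappa>)\<^sup>2"
    by (intro power_mono L2_Cauchy_Schwarz aL \<kappa>) simp
  also have "(L2_norm \<kappa>)\<^sup>2 = w" using w0 by (simp add: L2_norm_eq \<kappa>\<kappa>)
  then have "(L2_norm a * L2_norm \<kappa>)\<^sup>2 = w * (L2_norm a)\<^sup>2" by (simp add: power_mult_distrib)
  finally have a_le: "(cmod (L2_inner a \<kappa>))\<^sup>2 \<le> w * (L2_norm a)\<^sup>2" .
  have "(cmod (of_real w * f x))\<^sup>2 \<le> 2 * (cmod (L2_inner f \<kappa>))\<^sup>2 + 2 * (cmod (L2_inner a \<kappa>))\<^sup>2"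
    unfolding eq by (rule norm_square_add_le)
  then have main: "w\<^sup>2 * (cmod (f x))\<^sup>2 \<le> 2 * (cmod (L2_inner f \<kappa>))\<^sup>2 + 2 * w * (L2_norm a)\<^sup>2"
    using a_le by (simp add: norm_mult power_mult_distrib)
  have "ennreal ((L2_norm a)\<^sup>2) = (\<integral>\<^sup>+z. ennreal ((cmod (a z))\<^sup>2) \<partial>lborel)"
    using nn_integral_square[OF aL] by (simp add: nn_integral_completion)
  also have "\<dots> = (\<integral>\<^sup>+h. ennreal ((cmod (a (x + h)))\<^sup>2) \<partial>lborel)"
    unfolding a_def \<kappa>_def indicator_ball by (rule nn_integral_lborel_translate[symmetric]) measurable
  also have "\<dots> \<le> oscillation f (2 * \<epsilon>) x"
    unfolding oscillation_def
  proof (intro nn_integral_mono)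
    fix h
    show "ennreal ((cmod (a (x + h)))\<^sup>2) \<le> indicator (ball 0 (2 * \<epsilon>)) h * ennreal ((cmod (f x - f (x + h)))\<^sup>2)"
    proof (cases "x + h \<in> ball y \<epsilon>")
      case True
      have "norm h \<le> dist y x + dist y (x + h)"
        using norm_triangle_ineq4[of "y - x" "y - (x + h)"] by (simp add: dist_norm)
      then have "h \<in> ball 0 (2 * \<epsilon>)" using True x by simp
      then show ?thesis using True by (simp add: a_def \<kappa>_def)
    qed (simp add: a_def \<kappa>_def)
  qed
  finally have osc: "ennreal ((L2_norm a)\<^sup>2) \<le> oscillation f (2 * \<epsilon>) x" .
  have "ennreal (w\<^sup>2 * (cmod (f x))\<^sup>2) \<le> ennreal (2 * (cmod (L2_inner f \<kappa>))\<^sup>2 + 2 * w * (L2_norm a)\<^sup>2)"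
    using main by (rule ennreal_leI)
  also have "\<dots> = ennreal (2 * (cmod (L2_inner f \<kappa>))\<^sup>2) + ennreal (2 * w) * ennreal ((L2_norm a)\<^sup>2)"
    using w0 by (simp add: ennreal_plus ennreal_mult)
  also have "\<dots> \<le> ennreal (2 * (cmod (L2_inner f \<kappa>))\<^sup>2) + ennreal (2 * w) * oscillation f (2 * \<epsilon>) x"
    by (intro add_left_mono mult_left_mono osc) simp
  finally show ?thesis unfolding \<kappa>_def .
qed

text \<open>Integrate |f(x)|^2 <= 2 |f(x) - f(x + h)|^2 + 2 |f(x + h)|^2 over |h| < \<epsilon>. The
  oscillation is enlarged to radius 2 \<epsilon> so that it is the same quantity as in
  \<open>near_bound\<close>.\<close>

lemma far_bound:
  fixes f :: "'a::euclidean_space \<Rightarrow> complex"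
  assumes [measurable]: "f \<in> borel_measurable borel" and \<epsilon>: "\<epsilon> > 0"
  defines "w \<equiv> measure lborel (ball (0::'a) \<epsilon>)"
  shows "ennreal (w * (cmod (f x))\<^sup>2) \<le> 2 * oscillation f (2 * \<epsilon>) x +
    2 * (\<integral>\<^sup>+y. indicator (ball x \<epsilon>) y * ennreal ((cmod (f y))\<^sup>2) \<partial>lborel)"
proof -
  have "ennreal (w * (cmod (f x))\<^sup>2) = ennreal w * ennreal ((cmod (f x))\<^sup>2)"
    by (simp add: ennreal_mult w_def)
  also have "ennreal w = emeasure lborel (ball (0::'a) \<epsilon>)"
    unfolding w_def using emeasure_bounded_finite[OF bounded_ball, of "0::'a" \<epsilon>]
    by (intro emeasure_eq_ennreal_measure[symmetric]) simp
  also have "\<dots> * ennreal ((cmod (f x))\<^sup>2) = (\<integral>\<^sup>+h. indicator (ball (0::'a) \<epsilon>) h * ennreal ((cmod (f x))\<^sup>2) \<partial>lborel)"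
    by (subst nn_integral_multc) (auto intro!: borel_measurable_indicator)
  also have "\<dots> \<le> (\<integral>\<^sup>+h. 2 * (indicator (ball 0 (2 * \<epsilon>)) h * ennreal ((cmod (f x - f (x + h)))\<^sup>2)) +
      2 * (indicator (ball x \<epsilon>) (x + h) * ennreal ((cmod (f (x + h)))\<^sup>2)) \<partial>lborel)"
  proof (intro nn_integral_mono)
    fix h :: 'a
    show "indicator (ball 0 \<epsilon>) h * ennreal ((cmod (f x))\<^sup>2) \<le>
      2 * (indicator (ball 0 (2 * \<epsilon>)) h * ennreal ((cmod (f x - f (x + h)))\<^sup>2)) +
      2 * (indicator (ball x \<epsilon>) (x + h) * ennreal ((cmod (f (x + h)))\<^sup>2))"
    proof (cases "h \<in> ball 0 \<epsilon>")
      case True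
      then have "h \<in> ball 0 (2 * \<epsilon>)" "x + h \<in> ball x \<epsilon>" using \<epsilon> by (auto simp: dist_norm)
      moreover have "(cmod (f x))\<^sup>2 \<le> 2 * (cmod (f x - f (x + h)))\<^sup>2 + 2 * (cmod (f (x + h)))\<^sup>2"
        using norm_square_add_le[of "f x - f (x + h)" "f (x + h)"] by simp
      then have "ennreal ((cmod (f x))\<^sup>2) \<le> ennreal (2 * (cmod (f x - f (x + h)))\<^sup>2 + 2 * (cmod (f (x + h)))\<^sup>2)"
        by (rule ennreal_leI)
      then have "ennreal ((cmod (f x))\<^sup>2) \<le> 2 * ennreal ((cmod (f x - f (x + h)))\<^sup>2) + 2 * ennreal ((cmod (f (x + h)))\<^sup>2)"
        by (simp add: ennreal_plus ennreal_mult)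
      ultimately show ?thesis using True by simp
    qed simp
  qed
  also have "\<dots> = 2 * oscillation f (2 * \<epsilon>) x + 2 * (\<integral>\<^sup>+h. indicator (ball x \<epsilon>) (x + h) * ennreal ((cmod (f (x + h)))\<^sup>2) \<partial>lborel)"
  proof -
    have 1: "(\<lambda>h. indicator (ball 0 (2 * \<epsilon>)) h * ennreal ((cmod (f x - f (x + h)))\<^sup>2)) \<in> borel_measurable lborel"
      unfolding indicator_ball by measurable
    have 2: "(\<lambda>h. indicator (ball x \<epsilon>) (x + h) * ennreal ((cmod (f (x + h)))\<^sup>2)) \<in> borel_measurable lborel"
      unfolding indicator_ball by measurable
    show ?thesis
      unfolding oscillation_def nn_integral_cmult[OF 1, symmetric] nn_integral_cmult[OF 2, symmetric]
      by (rule nn_integral_add) (use 1 2 in measurable)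
  qed
  also have "(\<integral>\<^sup>+h. indicator (ball x \<epsilon>) (x + h) * ennreal ((cmod (f (x + h)))\<^sup>2) \<partial>lborel) =
      (\<integral>\<^sup>+y. indicator (ball x \<epsilon>) y * ennreal ((cmod (f y))\<^sup>2) \<partial>lborel)"
    unfolding indicator_ball by (rule nn_integral_lborel_translate) measurable
  finally show ?thesis .
qed

lemma tail_average_bound:
  fixes f :: "'a::euclidean_space \<Rightarrow> complex"
  assumes [measurable]: "f \<in> borel_measurable borel" "E \<in> sets borel"
    and E: "\<And>y. emeasure lborel (E \<inter> ball y \<epsilon>) \<le> \<eta>"
  shows "(\<integral>\<^sup>+x. indicator E x * (\<integral>\<^sup>+y. indicator (ball x \<epsilon>) y * ennreal ((cmod (f y))\<^sup>2) \<partial>lborel) \<partial>lborel) \<le>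
    \<eta> * (\<integral>\<^sup>+y. ennreal ((cmod (f y))\<^sup>2) \<partial>lborel)"
proof -
  have "(\<integral>\<^sup>+x. indicator E x * (\<integral>\<^sup>+y. indicator (ball x \<epsilon>) y * ennreal ((cmod (f y))\<^sup>2) \<partial>lborel) \<partial>lborel) =
      (\<integral>\<^sup>+x. \<integral>\<^sup>+y. indicator E x * (indicator (ball x \<epsilon>) y * ennreal ((cmod (f y))\<^sup>2)) \<partial>lborel \<partial>lborel)"
    unfolding indicator_ball by (intro nn_integral_cong nn_integral_cmult[symmetric]) simp
  also have "\<dots> = (\<integral>\<^sup>+y. \<integral>\<^sup>+x. indicator E x * (indicator (ball x \<epsilon>) y * ennreal ((cmod (f y))\<^sup>2)) \<partial>lborel \<partial>lborel)"
    unfolding indicator_ball by (rule lborel_pair.Fubini', unfold measurable_lborel_pair) measurable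
  also have "\<dots> = (\<integral>\<^sup>+y. \<integral>\<^sup>+x. indicator (E \<inter> ball y \<epsilon>) x * ennreal ((cmod (f y))\<^sup>2) \<partial>lborel \<partial>lborel)"
    by (intro nn_integral_cong) (auto simp: indicator_def dist_commute)
  also have "\<dots> = (\<integral>\<^sup>+y. emeasure lborel (E \<inter> ball y \<epsilon>) * ennreal ((cmod (f y))\<^sup>2) \<partial>lborel)"
    by (intro nn_integral_cong) (simp add: nn_integral_multc borel_measurable_indicator)
  also have "\<dots> \<le> (\<integral>\<^sup>+y. \<eta> * ennreal ((cmod (f y))\<^sup>2) \<partial>lborel)"
    by (intro nn_integral_mono mult_right_mono E) simp
  also have "\<dots> = \<eta> * (\<integral>\<^sup>+y. ennreal ((cmod (f y))\<^sup>2) \<partial>lborel)"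
    by (rule nn_integral_cmult) measurable
  finally show ?thesis .
qed

text \<open>Supplies the Borel functions to which the Tonelli arguments above apply.\<close>

lemma L2_borel_representative:
  assumes "f \<in> L2"
  obtains f' where "f' \<in> borel_measurable borel" "f' \<in> L2" "AE x in lebesgue. f' x = f x"
proof -
  have f: "f \<in> borel_measurable lebesgue" using assms by measurable
  obtain u where u: "u \<in> borel_measurable borel" "AE x in lborel. Re (f x) = u x"
    using completion_ex_borel_measurable_real[of "\<lambda>x. Re (f x)" lborel] f by auto
  obtain v where v: "v \<in> borel_measurable borel" "AE x in lborel. Im (f x) = v x"
    using completion_ex_borel_measurable_real[of "\<lambda>x. Im (f x)" lborel] f by auto
  have 1: "(\<lambda>x. Complex (u x) (v x)) \<in> borel_measurable borel"
    using u(1) v(1) by (simp add: borel_measurable_complex_iff)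
  have "AE x in lborel. Complex (u x) (v x) = f x"
    using u(2) v(2) by eventually_elim (simp add: complex_eq_iff)
  then have 2: "AE x in lebesgue. Complex (u x) (v x) = f x" by (rule AE_completion)
  show ?thesis using that[OF 1 L2_cong_AE[OF assms 2] 2] .
qed

lemma L2_inner_cong_AE:
  assumes "f \<in> L2" "f' \<in> L2" "g \<in> L2" "AE x in lebesgue. f' x = f x"
  shows "L2_inner f' g = L2_inner f g"
  unfolding L2_inner_def
  by (rule integral_cong_AE) (use assms L2_inner_integrable[THEN borel_measurable_integrable] in auto)

lemma L2_norm_cong_AE:
  assumes "AE x in lebesgue. cmod (f' x) = cmod (f x)" "f \<in> L2" "f' \<in> L2"
  shows "L2_norm f' = L2_norm f"
  unfolding L2_norm_def
  by (intro arg_cong[of _ _ sqrt] integral_cong_AE) (use assms L2_integrable_square[THEN borel_measurable_integrable] in auto)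

lemma AE_translate:
  assumes "AE x in lebesgue. P (x :: 'a::euclidean_space)" shows "AE x in lebesgue. P (x + a)"
proof -
  have "AE x in distr lebesgue lebesgue (\<lambda>x. x + a). P x" 
    by (subst distr_lebesgue_translate) (rule assms)
  then show ?thesis by (rule AE_distrD[OF translate_measurable])
qed

text \<open>\<open>T\<close> and \<open>P\<close> stand for multiples of the squared norms of the gradient and of $V_+^{1/2} f$; only the
  translation estimate is used, so that \<open>f\<close> may be replaced by a Borel representative.\<close>

lemma compactness_inequality_local:
  fixes V :: "'a::euclidean_space \<Rightarrow> real"
  assumes V: "V \<in> borel_measurable borel"
    and small: "\<forall>t>0. ((\<lambda>a. measure lebesgue {x \<in> cball a 1. V x < t}) \<longlongrightarrow> 0) at_infinity"
    and \<delta>: "\<delta> > 0"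
  shows "\<exists>F C. finite F \<and> F \<subseteq> L2 \<and> 0 \<le> C \<and> (\<forall>f\<in>L2. \<forall>T P. f \<in> borel_measurable borel \<longrightarrow> 0 \<le> T \<longrightarrow> 0 \<le> P \<longrightarrow>
      (\<forall>h r. norm h \<le> r \<longrightarrow> (L2_norm (\<lambda>x. f (x + h) - f x))\<^sup>2 \<le> r\<^sup>2 * T) \<longrightarrow>
      (\<integral>\<^sup>+x. ennreal (pos_part V x * (cmod (f x))\<^sup>2) \<partial>lborel) \<le> ennreal P \<longrightarrow>
      (L2_norm f)\<^sup>2 \<le> \<delta> * (T + P + (L2_norm f)\<^sup>2) + C * (\<Sum>e\<in>F. (cmod (L2_inner f e))\<^sup>2))"
proof -
  define n where "n = DIM('a)"
  \<comment> \<open>The oscillation terms will add up to 4 Q / w = 16 2^n \<epsilon>^2 T, which is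
    at most \<delta> T because \<epsilon>^2 <= \<epsilon>. The bound 1 keeps \<epsilon>-balls inside
    the unit balls of (i).\<close>
  define \<epsilon> where "\<epsilon> = min 1 (\<delta> / (16 * 2 ^ n))"
  have \<epsilon>: "0 < \<epsilon>" "\<epsilon> \<le> 1" "16 * 2 ^ n * \<epsilon>\<^sup>2 \<le> \<delta>"
  proof -
    show "0 < \<epsilon>" "\<epsilon> \<le> 1" using \<delta> by (auto simp: \<epsilon>_def)
    have "\<epsilon>\<^sup>2 \<le> 1 * \<epsilon>" unfolding power2_eq_square using \<open>0 < \<epsilon>\<close> \<open>\<epsilon> \<le> 1\<close> by (intro mult_right_mono) auto
    also have "1 * \<epsilon> \<le> \<delta> / (16 * 2 ^ n)" by (simp add: \<epsilon>_def)
    finally show "16 * 2 ^ n * \<epsilon>\<^sup>2 \<le> \<delta>" by (simp add: field_simps)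
  qed
  define w where "w = measure lborel (ball (0::'a) \<epsilon>)"
  have w: "0 < w" unfolding w_def using \<epsilon>(1) by (simp add: content_ball_pos)
  have w2: "measure lborel (ball (0::'a) (2 * \<epsilon>)) = 2 ^ n * w"
    unfolding w_def n_def using \<epsilon>(1) by (simp add: content_ball power_mult_distrib)
  have ew: "emeasure lborel (ball (0::'a) r) = ennreal (measure lborel (ball (0::'a) r))" for r
    using emeasure_bounded_finite[OF bounded_ball, of "0::'a" r] by (intro emeasure_eq_ennreal_measure) simp
  \<comment> \<open>Where V >= \<theta>, |f|^2 is at most \<delta> V_+ |f|^2; and
    \<open>\<eta>\<close> is chosen so that the tail term 2 \<eta> N / w equals \<delta> N.\<close>
  define \<theta> where "\<theta> = 1 / \<delta>"
  define \<eta> where "\<eta> = \<delta> * w / 2"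
  have pos: "\<theta> > 0" "\<eta> > 0" using \<delta> w by (auto simp: \<theta>_def \<eta>_def)
  have "\<forall>\<^sub>F a in at_infinity. measure lebesgue {x \<in> cball a 1. V x < \<theta>} < \<eta>"
    using small[rule_format, OF pos(1)] pos(2) by (rule order_tendstoD(2))
  then obtain R0 where R0: "\<And>a. R0 \<le> norm a \<Longrightarrow> measure lebesgue {x \<in> cball a 1. V x < \<theta>} < \<eta>"
    unfolding eventually_at_infinity by blast
  \<comment> \<open>A ball of radius \<epsilon> <= 1 about a point of norm below \<open>R0\<close>
    misses \<open>E\<close>; at all other centres the measure bound applies.\<close>
  define R where "R = max R0 0 + 1"
  define E where "E = {x. norm x > R \<and> V x < \<theta>}"
  have [measurable]: "V \<in> borel_measurable borel" by fact
  have E_sets [measurable]: "E \<in> sets borel" unfolding E_def by measurable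
  have E: "emeasure lborel (E \<inter> ball y \<epsilon>) \<le> ennreal \<eta>" for y
  proof (cases "R0 \<le> norm y")
    case True
    have m: "{x \<in> cball y 1. V x < \<theta>} \<in> sets borel" by measurable
    have "emeasure lborel (E \<inter> ball y \<epsilon>) \<le> emeasure lborel {x \<in> cball y 1. V x < \<theta>}"
      using \<epsilon> m by (intro emeasure_mono) (auto simp: E_def)
    also have "\<dots> = ennreal (measure lborel {x \<in> cball y 1. V x < \<theta>})"
    proof (rule emeasure_eq_ennreal_measure)
      have "bounded {x \<in> cball y 1. V x < \<theta>}" by (rule bounded_subset[OF bounded_cball]) auto
      from emeasure_bounded_finite[OF this] show "emeasure lborel {x \<in> cball y 1. V x < \<theta>} \<noteq> top" by simp
    qed
    also have "\<dots> \<le> ennreal \<eta>" using R0[OF True] m by (intro ennreal_leI) simp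
    finally show ?thesis .
  next
    case False
    have "E \<inter> ball y \<epsilon> = {}"
    proof -
      have "\<not> (norm x > R \<and> dist y x < \<epsilon>)" for x
        using norm_triangle_sub[of x y] False \<epsilon>(2) max.cobounded1[of R0 0]
        unfolding R_def dist_norm norm_minus_commute[of y x] by linarith
      then show ?thesis by (auto simp: E_def)
    qed
    then show ?thesis by simp
  qed
  obtain Y where Y: "finite Y" "cball (0::'a) R \<subseteq> (\<Union>y\<in>Y. ball y \<epsilon>)"
  proof -
    have "cball (0::'a) R \<subseteq> (\<Union>y\<in>UNIV. ball y \<epsilon>)" using centre_in_ball \<epsilon>(1) by blast
    from compactE_image[OF compact_cball open_ball this] show ?thesis using that by metis
  qed
  define \<kappa> :: "'a \<Rightarrow> 'a \<Rightarrow> complex" where "\<kappa> y z = complex_of_real (indicator (ball y \<epsilon>) z)" for y z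
  define F where "F = \<kappa> ` Y"
  \<comment> \<open>From \<open>near_bound\<close>, integrated over the ball of radius R and divided
    by w^2.\<close>
  define C where "C = 2 * measure lborel (cball (0::'a) R) / w\<^sup>2"
  have F: "finite F" "F \<subseteq> L2" using Y(1) by (auto simp: F_def \<kappa>_def[abs_def] indicator_ball_L2)
  have C: "0 \<le> C" by (simp add: C_def)
  have "(L2_norm f)\<^sup>2 \<le> \<delta> * (T + P + (L2_norm f)\<^sup>2) + C * (\<Sum>e\<in>F. (cmod (L2_inner f e))\<^sup>2)"
    if f: "f \<in> L2" and fb: "f \<in> borel_measurable borel" and T0: "0 \<le> T" and P0: "0 \<le> P"
      and trans: "\<And>h r. norm h \<le> r \<Longrightarrow> (L2_norm (\<lambda>x. f (x + h) - f x))\<^sup>2 \<le> r\<^sup>2 * T"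
      and P: "(\<integral>\<^sup>+x. ennreal (pos_part V x * (cmod (f x))\<^sup>2) \<partial>lborel) \<le> ennreal P" for f T P
  proof -
    note [measurable] = fb
    define N where "N = (L2_norm f)\<^sup>2"
    define S where "S = (\<Sum>e\<in>F. (cmod (L2_inner f e))\<^sup>2)"
    define g where "g x = ennreal ((cmod (f x))\<^sup>2)" for x
    have [measurable]: "g \<in> borel_measurable borel" unfolding g_def by measurable
    have N: "(\<integral>\<^sup>+x. g x \<partial>lborel) = ennreal N"
      using nn_integral_square[OF f] by (simp add: nn_integral_completion N_def g_def)
    have S0: "0 \<le> S" by (auto simp: S_def intro: sum_nonneg)
    have N0: "0 \<le> N" by (simp add: N_def)
    \<comment> \<open>The volume of the ball of radius 2 \<epsilon> times the translation bound at
      that distance.\<close>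
    define Q where "Q = 2 ^ n * w * ((2 * \<epsilon>)\<^sup>2 * T)"
    have Q0: "0 \<le> Q" using w T0 by (simp add: Q_def)
    have osc: "(\<integral>\<^sup>+x. oscillation f (2 * \<epsilon>) x \<partial>lborel) \<le> ennreal Q"
    proof -
      have "(\<integral>\<^sup>+x. oscillation f (2 * \<epsilon>) x \<partial>lborel) \<le> emeasure lborel (ball (0::'a) (2 * \<epsilon>)) * ennreal ((2 * \<epsilon>)\<^sup>2 * T)"
      proof (rule nn_integral_oscillation_le[OF fb])
        fix h :: 'a assume h: "h \<in> ball 0 (2 * \<epsilon>)"
        have "(\<lambda>x. f (x + h) - f x) \<in> L2" using f by (simp add: L2_translate)
        from nn_integral_square[OF this]
        have "(\<integral>\<^sup>+x. ennreal ((cmod (f x - f (x + h)))\<^sup>2) \<partial>lborel) = ennreal ((L2_norm (\<lambda>x. f (x + h) - f x))\<^sup>2)"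
          by (simp add: nn_integral_completion norm_minus_commute)
        also have "\<dots> \<le> ennreal ((2 * \<epsilon>)\<^sup>2 * T)" using trans[of h "2 * \<epsilon>"] h by (intro ennreal_leI) simp
        finally show "(\<integral>\<^sup>+x. ennreal ((cmod (f x - f (x + h)))\<^sup>2) \<partial>lborel) \<le> ennreal ((2 * \<epsilon>)\<^sup>2 * T)" .
      qed
      also have "\<dots> = ennreal Q" using w T0 by (simp add: ew w2 Q_def ennreal_mult)
      finally show ?thesis .
    qed
    have near: "(\<integral>\<^sup>+x. indicator (cball 0 R) x * g x \<partial>lborel) \<le> ennreal (C * S + 2 * Q / w)"
    proof -
      have "ennreal (w\<^sup>2) * (\<integral>\<^sup>+x. indicator (cball 0 R) x * g x \<partial>lborel) =
          (\<integral>\<^sup>+x. ennreal (w\<^sup>2) * (indicator (cball 0 R) x * g x) \<partial>lborel)"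
        by (rule nn_integral_cmult[symmetric]) measurable
      also have "\<dots> \<le> (\<integral>\<^sup>+x. ennreal (2 * S) * indicator (cball 0 R) x + ennreal (2 * w) * oscillation f (2 * \<epsilon>) x \<partial>lborel)"
      proof (rule nn_integral_mono)
        fix x :: 'a
        show "ennreal (w\<^sup>2) * (indicator (cball 0 R) x * g x) \<le>
          ennreal (2 * S) * indicator (cball 0 R) x + ennreal (2 * w) * oscillation f (2 * \<epsilon>) x"
        proof (cases "x \<in> cball 0 R")
          case True
          then obtain y where y: "y \<in> Y" "x \<in> ball y \<epsilon>" using Y(2) by blast
          have "(cmod (L2_inner f (\<kappa> y)))\<^sup>2 \<le> S"
            unfolding S_def using F(1) y(1) by (intro member_le_sum) (auto simp: F_def)
          then have "ennreal (2 * (cmod (L2_inner f (\<kappa> y)))\<^sup>2) \<le> ennreal (2 * S)" by (intro ennreal_leI) simp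
          moreover have "ennreal (w\<^sup>2 * (cmod (f x))\<^sup>2) \<le>
              ennreal (2 * (cmod (L2_inner f (\<kappa> y)))\<^sup>2) + ennreal (2 * w) * oscillation f (2 * \<epsilon>) x"
            using near_bound[OF fb f y(2)] unfolding w_def \<kappa>_def .
          ultimately have "ennreal (w\<^sup>2 * (cmod (f x))\<^sup>2) \<le> ennreal (2 * S) + ennreal (2 * w) * oscillation f (2 * \<epsilon>) x"
            by (meson add_right_mono order_trans)
          then show ?thesis using True by (simp add: g_def ennreal_mult)
        qed simp
      qed
      also have "\<dots> = ennreal (2 * S) * emeasure lborel (cball (0::'a) R) + ennreal (2 * w) * (\<integral>\<^sup>+x. oscillation f (2 * \<epsilon>) x \<partial>lborel)"
        by (subst nn_integral_add) (simp_all add: nn_integral_cmult)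
      also have "\<dots> \<le> ennreal (2 * S) * emeasure lborel (cball (0::'a) R) + ennreal (2 * w) * ennreal Q"
        by (intro add_left_mono mult_left_mono osc) simp
      also have "emeasure lborel (cball (0::'a) R) = ennreal (measure lborel (cball (0::'a) R))"
        using emeasure_bounded_finite[OF bounded_cball, of "0::'a" R] by (intro emeasure_eq_ennreal_measure) simp
      also have "ennreal (2 * S) * ennreal (measure lborel (cball (0::'a) R)) + ennreal (2 * w) * ennreal Q =
          ennreal (2 * S * measure lborel (cball (0::'a) R) + 2 * w * Q)"
        using S0 w Q0 by (simp add: ennreal_mult ennreal_plus)
      also have "2 * S * measure lborel (cball (0::'a) R) + 2 * w * Q = w\<^sup>2 * (C * S + 2 * Q / w)"
        using w by (simp add: C_def field_simps power2_eq_square)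
      also have "ennreal \<dots> = ennreal (w\<^sup>2) * ennreal (C * S + 2 * Q / w)"
        using w C S0 Q0 by (intro ennreal_mult) auto
      finally show ?thesis
        using w by (subst (asm) ennreal_mult_le_mult_iff) auto
    qed
    have far: "(\<integral>\<^sup>+x. indicator E x * g x \<partial>lborel) \<le> ennreal (2 * Q / w + 2 * \<eta> * N / w)"
    proof -
      let ?A = "\<lambda>x. \<integral>\<^sup>+y. indicator (ball x \<epsilon>) y * ennreal ((cmod (f y))\<^sup>2) \<partial>lborel"
      have A [measurable]: "?A \<in> borel_measurable borel"
        unfolding indicator_ball
        by (rule lborel.borel_measurable_nn_integral, unfold measurable_lborel_pair) measurable
      have "ennreal w * (\<integral>\<^sup>+x. indicator E x * g x \<partial>lborel) = (\<integral>\<^sup>+x. ennreal w * (indicator E x * g x) \<partial>lborel)"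
        by (rule nn_integral_cmult[symmetric]) measurable
      also have "\<dots> \<le> (\<integral>\<^sup>+x. 2 * oscillation f (2 * \<epsilon>) x + 2 * (indicator E x * ?A x) \<partial>lborel)"
      proof (rule nn_integral_mono)
        fix x :: 'a
        have "ennreal w * g x \<le> 2 * oscillation f (2 * \<epsilon>) x + 2 * ?A x"
          using far_bound[OF fb \<epsilon>(1), of x] w unfolding w_def g_def by (simp add: ennreal_mult)
        then show "ennreal w * (indicator E x * g x) \<le> 2 * oscillation f (2 * \<epsilon>) x + 2 * (indicator E x * ?A x)"
          by (cases "x \<in> E") simp_all
      qed
      also have "\<dots> = 2 * (\<integral>\<^sup>+x. oscillation f (2 * \<epsilon>) x \<partial>lborel) + 2 * (\<integral>\<^sup>+x. indicator E x * ?A x \<partial>lborel)"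
        by (subst nn_integral_add) (measurable, simp add: nn_integral_cmult)
      also have "\<dots> \<le> 2 * ennreal Q + 2 * (ennreal \<eta> * ennreal N)"
        using tail_average_bound[OF fb E_sets E] unfolding g_def[symmetric] N
        by (intro add_mono mult_left_mono osc) simp_all
      also have "\<dots> = ennreal (2 * Q + 2 * (\<eta> * N))"
        using Q0 N0 pos(2) by (simp add: ennreal_mult ennreal_plus)
      also have "2 * Q + 2 * (\<eta> * N) = w * (2 * Q / w + 2 * \<eta> * N / w)"
        using w by (simp add: field_simps)
      also have "ennreal \<dots> = ennreal w * ennreal (2 * Q / w + 2 * \<eta> * N / w)"
        using w Q0 N0 pos(2) by (intro ennreal_mult) auto
      finally show ?thesis
        using w by (subst (asm) ennreal_mult_le_mult_iff) auto
    qed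
    have high: "(\<integral>\<^sup>+x. indicator {x. \<theta> \<le> V x} x * g x \<partial>lborel) \<le> ennreal (\<delta> * P)"
    proof -
      have "(\<integral>\<^sup>+x. indicator {x. \<theta> \<le> V x} x * g x \<partial>lborel) \<le>
          (\<integral>\<^sup>+x. ennreal \<delta> * ennreal (pos_part V x * (cmod (f x))\<^sup>2) \<partial>lborel)"
      proof (rule nn_integral_mono)
        fix x :: 'a
        show "indicator {x. \<theta> \<le> V x} x * g x \<le> ennreal \<delta> * ennreal (pos_part V x * (cmod (f x))\<^sup>2)"
        proof (cases "\<theta> \<le> V x")
          case True
          then have "pos_part V x = V x" using pos(1) by (simp add: pos_part_def)
          then have "1 \<le> \<delta> * pos_part V x" using True \<delta> by (simp add: \<theta>_def field_simps)
          then have "1 * (cmod (f x))\<^sup>2 \<le> \<delta> * pos_part V x * (cmod (f x))\<^sup>2" by (intro mult_right_mono) auto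
          then have "g x \<le> ennreal (\<delta> * (pos_part V x * (cmod (f x))\<^sup>2))" unfolding g_def
            by (intro ennreal_leI) (simp add: mult.assoc)
          also have "\<dots> = ennreal \<delta> * ennreal (pos_part V x * (cmod (f x))\<^sup>2)"
            using \<delta> by (intro ennreal_mult) (auto simp: pos_part_def)
          finally show ?thesis using True by simp
        qed simp
      qed
      also have "\<dots> = ennreal \<delta> * (\<integral>\<^sup>+x. ennreal (pos_part V x * (cmod (f x))\<^sup>2) \<partial>lborel)"
        unfolding pos_part_def by (rule nn_integral_cmult) measurable
      also have "\<dots> \<le> ennreal \<delta> * ennreal P" by (intro mult_left_mono P) simp
      also have "\<dots> = ennreal (\<delta> * P)" using \<delta> P0 by (intro ennreal_mult[symmetric]) auto
      finally show ?thesis .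
    qed
    have nonneg: "0 \<le> C * S + 2 * Q / w" "0 \<le> 2 * Q / w + 2 * \<eta> * N / w" "0 \<le> \<delta> * P"
      using C S0 Q0 w N0 P0 pos(2) \<delta> by auto
    \<comment> \<open>The near ball, the tail \<open>E\<close> and the set V >= \<theta> cover the
      space; overlaps only enlarge the right hand side.\<close>
    have "ennreal N \<le> (\<integral>\<^sup>+x. (indicator (cball 0 R) x * g x + indicator E x * g x) + indicator {x. \<theta> \<le> V x} x * g x \<partial>lborel)"
      unfolding N[symmetric]
    proof (rule nn_integral_mono)
      fix x :: 'a
      have "x \<in> cball 0 R \<or> x \<in> E \<or> x \<in> {x. \<theta> \<le> V x}" by (auto simp: E_def)
      then show "g x \<le> (indicator (cball 0 R) x * g x + indicator E x * g x) + indicator {x. \<theta> \<le> V x} x * g x"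
        by (elim disjE) (simp_all add: add_increasing add_increasing2 del: mem_cball)
    qed
    also have "\<dots> = ((\<integral>\<^sup>+x. indicator (cball 0 R) x * g x \<partial>lborel) + (\<integral>\<^sup>+x. indicator E x * g x \<partial>lborel)) +
        (\<integral>\<^sup>+x. indicator {x. \<theta> \<le> V x} x * g x \<partial>lborel)"
    proof -
      have m: "(\<lambda>x. indicator (cball 0 R) x * g x) \<in> borel_measurable lborel"
        "(\<lambda>x. indicator E x * g x) \<in> borel_measurable lborel"
        "(\<lambda>x. indicator {x. \<theta> \<le> V x} x * g x) \<in> borel_measurable lborel"
        by measurable
      show ?thesis
        unfolding nn_integral_add[OF m(1,2), symmetric]
        by (rule nn_integral_add) (use m in measurable)
    qed
    also have "\<dots> \<le> (ennreal (C * S + 2 * Q / w) + ennreal (2 * Q / w + 2 * \<eta> * N / w)) + ennreal (\<delta> * P)"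
      by (intro add_mono near far high)
    also have "\<dots> = ennreal ((C * S + 2 * Q / w) + (2 * Q / w + 2 * \<eta> * N / w) + \<delta> * P)"
      using nonneg by (simp only: ennreal_plus add_nonneg_nonneg)
    finally have "N \<le> (C * S + 2 * Q / w) + (2 * Q / w + 2 * \<eta> * N / w) + \<delta> * P"
      using nonneg by (subst (asm) ennreal_le_iff) (auto intro: add_nonneg_nonneg)
    moreover have "2 * \<eta> * N / w = \<delta> * N" using w by (simp add: \<eta>_def)
    moreover have "2 * Q / w + 2 * Q / w \<le> \<delta> * T"
    proof -
      have "2 * Q / w + 2 * Q / w = (16 * 2 ^ n * \<epsilon>\<^sup>2) * T" using w by (simp add: Q_def power_mult_distrib)
      also have "\<dots> \<le> \<delta> * T" by (rule mult_right_mono[OF \<epsilon>(3) T0])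
      finally show ?thesis .
    qed
    ultimately show ?thesis unfolding N_def[symmetric] S_def[symmetric] by (simp add: algebra_simps)
  qed
  then show ?thesis using F C by (intro exI[of _ F] exI[of _ C]) blast
qed

text \<open>Transfers the local inequality to arbitrary representatives of V and f: all its
  ingredients, the translation bound included, are unchanged by modifications on null sets.\<close>

lemma compactness_inequality:
  fixes V :: "'a::euclidean_space \<Rightarrow> real"
  assumes V: "V \<in> borel_measurable lebesgue"
    and small: "\<And>t. t > 0 \<Longrightarrow> ((\<lambda>a. measure lebesgue {x \<in> cball a 1. V x < t}) \<longlongrightarrow> 0) at_infinity"
    and \<delta>: "\<delta> > 0"
  shows "\<exists>F C. finite F \<and> F \<subseteq> L2 \<and> 0 \<le> C \<and> (\<forall>f\<in>form_sum_domain V. (L2_norm f)\<^sup>2 \<le>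
      \<delta> * ((grad_norm f)\<^sup>2 + (L2_norm (\<lambda>x. complex_of_real (sqrt (pos_part V x)) * f x))\<^sup>2 + (L2_norm f)\<^sup>2) +
      C * (\<Sum>e\<in>F. (cmod (L2_inner f e))\<^sup>2))"
proof -
  obtain V' where V': "V' \<in> borel_measurable borel" "AE x in lborel. V x = V' x"
    using completion_ex_borel_measurable_real[OF V] by auto
  have ae: "AE x in lebesgue. V x = V' x" using V'(2) by (rule AE_completion)
  have V'L: "V' \<in> borel_measurable lebesgue" using V'(1) by (intro measurable_completion) simp
  have "((\<lambda>a. measure lebesgue {x \<in> cball a 1. V' x < t}) \<longlongrightarrow> 0) at_infinity" if "t > 0" for t
  proof -
    have "measure lebesgue {x \<in> cball a 1. V' x < t} = measure lebesgue {x \<in> cball a 1. V x < t}" for a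
    proof (rule measure_eq_AE)
      show "AE x in lebesgue. (x \<in> {x \<in> cball a 1. V' x < t}) = (x \<in> {x \<in> cball a 1. V x < t})"
        using ae by eventually_elim simp
      have s: "{x \<in> cball a 1. U x < t} \<in> sets lebesgue" if "U \<in> borel_measurable lebesgue" for U :: "'a \<Rightarrow> real"
      proof -
        have "{x \<in> cball a 1. U x < t} = cball a 1 \<inter> {x \<in> space lebesgue. U x < t}" by auto
        moreover have "{x \<in> space lebesgue. U x < t} \<in> sets lebesgue"
          using that by (rule borel_measurable_less) simp
        moreover have "cball a 1 \<in> sets lebesgue" by simp
        ultimately show ?thesis by (simp only: sets.Int)
      qed
      show "{x \<in> cball a 1. V' x < t} \<in> sets lebesgue" by (rule s[OF V'L])
      show "{x \<in> cball a 1. V x < t} \<in> sets lebesgue" by (rule s[OF V])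
    qed
    then show ?thesis using small[OF that] by simp
  qed
  then have small': "\<forall>t>0. ((\<lambda>a. measure lebesgue {x \<in> cball a 1. V' x < t}) \<longlongrightarrow> 0) at_infinity" by blast
  \<comment> \<open>The square of the constant 4 \<open>DIM('a)\<close> of the translation estimate.
    The local inequality is used with \<delta> / c, and c >= 1 takes care of the terms that do not
    carry the factor c.\<close>
  define c where "c = 16 * (real DIM('a))\<^sup>2"
  have "1 \<le> real DIM('a)" using DIM_positive[where 'a='a] by linarith
  then have "1 \<le> (real DIM('a))\<^sup>2" by (rule one_le_power)
  then have c: "1 \<le> c" unfolding c_def by linarith
  have "\<delta> / c > 0" using \<delta> c by simp
  obtain F C where F: "finite F" "F \<subseteq> L2" "0 \<le> C" and
    le: "\<forall>f\<in>L2. \<forall>T P. f \<in> borel_measurable borel \<longrightarrow> 0 \<le> T \<longrightarrow> 0 \<le> P \<longrightarrow>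
      (\<forall>h r. norm h \<le> r \<longrightarrow> (L2_norm (\<lambda>x. f (x + h) - f x))\<^sup>2 \<le> r\<^sup>2 * T) \<longrightarrow>
      (\<integral>\<^sup>+x. ennreal (pos_part V' x * (cmod (f x))\<^sup>2) \<partial>lborel) \<le> ennreal P \<longrightarrow>
      (L2_norm f)\<^sup>2 \<le> (\<delta> / c) * (T + P + (L2_norm f)\<^sup>2) + C * (\<Sum>e\<in>F. (cmod (L2_inner f e))\<^sup>2)"
    using compactness_inequality_local[OF V'(1) small' \<open>\<delta> / c > 0\<close>] by (elim exE conjE) (rule that)
  have "(L2_norm f)\<^sup>2 \<le> \<delta> * ((grad_norm f)\<^sup>2 + (L2_norm (\<lambda>x. complex_of_real (sqrt (pos_part V x)) * f x))\<^sup>2 + (L2_norm f)\<^sup>2) +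
      C * (\<Sum>e\<in>F. (cmod (L2_inner f e))\<^sup>2)" if "f \<in> form_sum_domain V" for f
  proof -
    have fH: "f \<in> H1" and fP: "(\<lambda>x. complex_of_real (sqrt (pos_part V x)) * f x) \<in> L2"
      using that by (auto simp: form_sum_domain_def)
    note f = H1_L2[OF fH]
    define P where "P = (L2_norm (\<lambda>x. complex_of_real (sqrt (pos_part V x)) * f x))\<^sup>2"
    define G where "G = (grad_norm f)\<^sup>2"
    obtain f' where f': "f' \<in> borel_measurable borel" "f' \<in> L2" "AE x in lebesgue. f' x = f x"
      by (rule L2_borel_representative[OF f])
    have n: "L2_norm f' = L2_norm f" using f'(3) by (intro L2_norm_cong_AE f f') (auto elim: eventually_mono)
    have "(L2_norm f')\<^sup>2 \<le> (\<delta> / c) * (c * G + P + (L2_norm f')\<^sup>2) + C * (\<Sum>e\<in>F. (cmod (L2_inner f' e))\<^sup>2)"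
    proof (rule le[rule_format, OF f'(2,1)])
      show "0 \<le> c * G" "0 \<le> P" using c by (simp_all add: G_def P_def)
    next
      fix h :: 'a and r :: real assume h: "norm h \<le> r"
      have r: "0 \<le> r" using h norm_ge_zero order_trans by blast
      have dL: "(\<lambda>x. u (x + h) - u x) \<in> L2" if "u \<in> L2" for u :: "'a \<Rightarrow> complex"
        using that by (simp add: L2_translate)
      have "AE x in lebesgue. cmod (f' (x + h) - f' x) = cmod (f (x + h) - f x)"
        using f'(3) AE_translate[OF f'(3), of h] by eventually_elim simp
      then have "L2_norm (\<lambda>x. f' (x + h) - f' x) = L2_norm (\<lambda>x. f (x + h) - f x)"
        by (rule L2_norm_cong_AE) (intro dL f f')+
      also have "\<dots> \<le> 4 * DIM('a) * r * grad_norm f" by (rule H1_translation_estimate[OF fH h])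
      finally have "(L2_norm (\<lambda>x. f' (x + h) - f' x))\<^sup>2 \<le> (4 * DIM('a) * r * grad_norm f)\<^sup>2"
        using L2.nrm_nonneg[OF dL[OF f'(2)]] unfolding L2_nrm by (intro power_mono)
      also have "\<dots> = r\<^sup>2 * (c * G)" by (simp add: c_def G_def power_mult_distrib)
      finally show "(L2_norm (\<lambda>x. f' (x + h) - f' x))\<^sup>2 \<le> r\<^sup>2 * (c * G)" .
    next
      have "(\<integral>\<^sup>+x. ennreal (pos_part V' x * (cmod (f' x))\<^sup>2) \<partial>lborel) = (\<integral>\<^sup>+x. ennreal (pos_part V' x * (cmod (f' x))\<^sup>2) \<partial>lebesgue)"
        by (simp add: nn_integral_completion)
      also have "\<dots> = (\<integral>\<^sup>+x. ennreal ((cmod (complex_of_real (sqrt (pos_part V x)) * f x))\<^sup>2) \<partial>lebesgue)"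
      proof (rule nn_integral_cong_AE)
        show "AE x in lebesgue. ennreal (pos_part V' x * (cmod (f' x))\<^sup>2) = ennreal ((cmod (complex_of_real (sqrt (pos_part V x)) * f x))\<^sup>2)"
          using ae f'(3) by eventually_elim (simp add: norm_mult power_mult_distrib pos_part_def)
      qed
      also have "\<dots> = ennreal P" unfolding P_def by (rule nn_integral_square[OF fP])
      finally show "(\<integral>\<^sup>+x. ennreal (pos_part V' x * (cmod (f' x))\<^sup>2) \<partial>lborel) \<le> ennreal P" by simp
    qed
    also have "(\<delta> / c) * (c * G + P + (L2_norm f')\<^sup>2) \<le> \<delta> * (G + P + (L2_norm f')\<^sup>2)"
    proof -
      have "\<delta> * (c * G + P + (L2_norm f')\<^sup>2) \<le> \<delta> * (c * G + c * P + c * (L2_norm f')\<^sup>2)"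
        using \<delta> c mult_right_mono[OF c, of P] mult_right_mono[OF c, of "(L2_norm f')\<^sup>2"]
        by (intro mult_left_mono add_mono) (simp_all add: P_def)
      then show ?thesis using c by (simp add: field_simps)
    qed
    also have "L2_inner f' e = L2_inner f e" if "e \<in> F" for e
      using f' f F that by (intro L2_inner_cong_AE) auto
    then have "(\<Sum>e\<in>F. (cmod (L2_inner f' e))\<^sup>2) = (\<Sum>e\<in>F. (cmod (L2_inner f e))\<^sup>2)" by (intro sum.cong) auto
    finally show ?thesis by (simp add: n G_def P_def)
  qed
  then show ?thesis using F by blast
qed

section \<open>Linear structure of the first order Sobolev space\<close>

lemma weak_pderiv_eqI:
  assumes "f \<in> H1" "b \<in> Basis" "g \<in> L2" "has_weak_pderiv f b g"
  shows "AE x in lebesgue. weak_pderiv b f x = g x"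
  using has_weak_pderiv_unique weak_pderiv[OF assms(1,2)] assms by blast

lemma H1_add:
  assumes f: "f \<in> H1" and g: "g \<in> H1"
  shows "f + g \<in> H1" "b \<in> Basis \<Longrightarrow> AE x in lebesgue. weak_pderiv b (f + g) x = (weak_pderiv b f + weak_pderiv b g) x"
proof -
  have w: "weak_pderiv b f + weak_pderiv b g \<in> L2 \<and> has_weak_pderiv (f + g) b (weak_pderiv b f + weak_pderiv b g)"
    if b: "b \<in> Basis" for b
    using weak_pderiv[OF f b] weak_pderiv[OF g b] H1_L2[OF f] H1_L2[OF g] b L2.carrier_closed(2) has_weak_pderiv_add by blast
  show fg: "f + g \<in> H1" using w L2.carrier_closed(2)[OF H1_L2[OF f] H1_L2[OF g]] by (auto simp: H1_def)
  show "b \<in> Basis \<Longrightarrow> AE x in lebesgue. weak_pderiv b (f + g) x = (weak_pderiv b f + weak_pderiv b g) x"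
    using weak_pderiv_eqI[OF fg _ conjunct1[OF w] conjunct2[OF w]] .
qed

lemma H1_scale:
  assumes f: "f \<in> H1"
  shows "fscale c f \<in> H1" "b \<in> Basis \<Longrightarrow> AE x in lebesgue. weak_pderiv b (fscale c f) x = (fscale c (weak_pderiv b f)) x"
proof -
  have w: "fscale c (weak_pderiv b f) \<in> L2 \<and> has_weak_pderiv (fscale c f) b (fscale c (weak_pderiv b f))"
    if b: "b \<in> Basis" for b
    using weak_pderiv[OF f b] H1_L2[OF f] b L2.carrier_closed(4) has_weak_pderiv_scale by blast
  show cf: "fscale c f \<in> H1" using w L2.carrier_closed(4)[OF H1_L2[OF f]] by (auto simp: H1_def)
  show "b \<in> Basis \<Longrightarrow> AE x in lebesgue. weak_pderiv b (fscale c f) x = (fscale c (weak_pderiv b f)) x"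
    using weak_pderiv_eqI[OF cf _ conjunct1[OF w] conjunct2[OF w]] .
qed

lemma H1_diff:
  assumes "f \<in> H1" "g \<in> H1"
  shows "f - g \<in> H1" "b \<in> Basis \<Longrightarrow> AE x in lebesgue. weak_pderiv b (f - g) x = (weak_pderiv b f - weak_pderiv b g) x"
proof -
  have eq: "f - g = f + fscale (-1) g" by (simp add: fun_eq_iff)
  show "f - g \<in> H1" unfolding eq using assms by (intro H1_add(1) H1_scale(1))
  assume b: "b \<in> Basis"
  show "AE x in lebesgue. weak_pderiv b (f - g) x = (weak_pderiv b f - weak_pderiv b g) x"
    unfolding eq using H1_add(2)[OF assms(1) H1_scale(1)[OF assms(2), of "-1"] b] H1_scale(2)[OF assms(2) b, of "-1"]
    by eventually_elim simp
qed

text \<open>A null function pairs to zero with everything, so zero is a weak derivative of it. This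
  supplies the saturation \<open>null\<close> of the form domain.\<close>

lemma H1_AE_zero:
  assumes "f \<in> L2" "AE x in lebesgue. f x = 0"
  shows "f \<in> H1" "b \<in> Basis \<Longrightarrow> L2_norm (weak_pderiv b f) = 0"
proof -
  have zero: "L2_inner f g = 0" if "g \<in> L2" for g
    using L2_inner_cong_AE[of "\<lambda>x. 0" f g] assms that by (simp add: L2_inner_def)
  then have w: "has_weak_pderiv f b (\<lambda>x. 0)" if "b \<in> Basis" for b
    unfolding has_weak_pderiv_iff_L2_inner
  proof (intro allI impI)
    fix \<phi> :: "'a \<Rightarrow> real" assume "test_function \<phi>"
    from zero[OF C1_compact_L2(2)[OF test_function_C1[OF this] that]]
    show "L2_inner f (\<lambda>x. complex_of_real (frechet_derivative \<phi> (at x) b)) = - L2_inner (\<lambda>x. 0) (\<lambda>x. complex_of_real (\<phi> x))"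
      by (simp add: L2_inner_def)
  qed
  then show f: "f \<in> H1" using assms by (auto simp: H1_def intro!: bexI[of _ "\<lambda>x. 0"])
  show "b \<in> Basis \<Longrightarrow> L2_norm (weak_pderiv b f) = 0"
    using weak_pderiv_eqI[OF f _ L2_zero w] L2_norm_zero_iff weak_pderiv(1)[OF f] by blast
qed

lemma grad_inner_commute:
  assumes "f \<in> H1" "g \<in> H1" shows "grad_inner g f = cnj (grad_inner f g)"
  unfolding grad_inner_def cnj_sum
  by (intro sum.cong refl L2.ip_commute weak_pderiv assms)

lemma grad_inner_add_left:
  assumes "f \<in> H1" "g \<in> H1" "h \<in> H1" shows "grad_inner (f + g) h = grad_inner f h + grad_inner g h"
  unfolding grad_inner_def sum.distrib[symmetric]
proof (intro sum.cong refl)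
  fix b :: 'a assume b: "b \<in> Basis"
  note w = weak_pderiv(1)[OF _ b]
  have "L2_inner (weak_pderiv b (f + g)) (weak_pderiv b h) = L2_inner (weak_pderiv b f + weak_pderiv b g) (weak_pderiv b h)"
    using assms b by (intro L2_inner_cong_AE H1_add L2.carrier_closed(2) w) auto
  then show "L2_inner (weak_pderiv b (f + g)) (weak_pderiv b h) =
      L2_inner (weak_pderiv b f) (weak_pderiv b h) + L2_inner (weak_pderiv b g) (weak_pderiv b h)"
    using w assms by (simp add: L2.ip_add_left)
qed

lemma grad_inner_scale_left:
  assumes "f \<in> H1" "h \<in> H1" shows "grad_inner (fscale c f) h = c * grad_inner f h"
  unfolding grad_inner_def sum_distrib_left
proof (intro sum.cong refl)
  fix b :: 'a assume b: "b \<in> Basis"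
  note w = weak_pderiv(1)[OF _ b]
  have "L2_inner (weak_pderiv b (fscale c f)) (weak_pderiv b h) = L2_inner (fscale c (weak_pderiv b f)) (weak_pderiv b h)"
    using assms b by (intro L2_inner_cong_AE H1_scale L2.carrier_closed(4) w) auto
  then show "L2_inner (weak_pderiv b (fscale c f)) (weak_pderiv b h) = c * L2_inner (weak_pderiv b f) (weak_pderiv b h)"
    using w assms by (simp add: L2.ip_scale_left)
qed

lemma grad_norm_square: "(grad_norm f)\<^sup>2 = (\<Sum>b\<in>Basis. (L2_norm (weak_pderiv b f))\<^sup>2)"
  unfolding grad_norm_def by (intro real_sqrt_pow2 sum_nonneg) simp

lemma grad_inner_self:
  assumes "f \<in> H1" shows "grad_inner f f = of_real ((grad_norm f)\<^sup>2)"
  unfolding grad_norm_square grad_inner_def of_real_sum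
  by (intro sum.cong refl L2.ip_self[unfolded L2_nrm] weak_pderiv assms)

section \<open>The form sum\<close>

text \<open>The cut-offs to balls are integrable, hence measurable, and converge pointwise to
  \<open>V\<close>.\<close>

lemma locally_integrable_measurable:
  fixes V :: "'a::euclidean_space \<Rightarrow> real"
  assumes "locally_integrable V" shows "V \<in> borel_measurable lebesgue"
proof (rule borel_measurable_LIMSEQ_real)
  show "(\<lambda>x. indicator (cball 0 (real n)) x *\<^sub>R V x) \<in> borel_measurable lebesgue" for n
    using assms compact_cball unfolding locally_integrable_def set_integrable_def
    by (blast intro: borel_measurable_integrable)
  show "(\<lambda>n. indicator (cball 0 (real n)) x *\<^sub>R V x) \<longlonglongrightarrow> V x" for x
  proof (rule tendsto_eventually)
    obtain N where "norm x \<le> real N" using real_arch_simple by blast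
    then show "\<forall>\<^sub>F n in sequentially. indicator (cball 0 (real n)) x *\<^sub>R V x = V x"
      unfolding eventually_sequentially by (intro exI[of _ N]) auto
  qed
qed

locale schroedinger =
  fixes V :: "'a::euclidean_space \<Rightarrow> real" and \<mu> \<nu> :: real
  assumes V_loc: "locally_integrable V"
    and \<mu>: "0 < \<mu>" "\<mu> < 1" and \<nu>: "0 < \<nu>"
    and bounded: "form_bounded (neg_part V) \<mu> \<nu>"
begin

abbreviation "D \<equiv> form_sum_domain V"

text \<open>With the square roots of V_+ and V_- as multipliers, the potential term is a difference
  of two \<open>L2\<close> inner products and inherits linearity, symmetry and integrability from
  them.\<close>

definition pos_mult :: "('a \<Rightarrow> complex) \<Rightarrow> 'a \<Rightarrow> complex" where
  "pos_mult f x = complex_of_real (sqrt (pos_part V x)) * f x"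

definition neg_mult :: "('a \<Rightarrow> complex) \<Rightarrow> 'a \<Rightarrow> complex" where
  "neg_mult f x = complex_of_real (sqrt (neg_part V x)) * f x"

lemma D_iff: "f \<in> D \<longleftrightarrow> f \<in> H1 \<and> pos_mult f \<in> L2"
  by (simp add: form_sum_domain_def pos_mult_def[abs_def])

lemma mult_linear:
  "pos_mult (f + g) = pos_mult f + pos_mult g" "pos_mult (fscale c f) = fscale c (pos_mult f)"
  "pos_mult (f - g) = pos_mult f - pos_mult g"
  "neg_mult (f + g) = neg_mult f + neg_mult g" "neg_mult (fscale c f) = fscale c (neg_mult f)"
  by (simp_all add: pos_mult_def neg_mult_def fun_eq_iff algebra_simps)

lemma V_measurable: "V \<in> borel_measurable lebesgue"
  by (rule locally_integrable_measurable[OF V_loc])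

lemma mult_measurable:
  assumes "f \<in> borel_measurable lebesgue"
  shows "pos_mult f \<in> borel_measurable lebesgue" "neg_mult f \<in> borel_measurable lebesgue"
proof -
  have of_real: "complex_of_real \<in> borel_measurable borel"
    by (intro borel_measurable_continuous_onI continuous_intros)
  have "(\<lambda>x. sqrt (pos_part V x)) \<in> borel_measurable lebesgue" "(\<lambda>x. sqrt (neg_part V x)) \<in> borel_measurable lebesgue"
    unfolding pos_part_def neg_part_def using V_measurable by measurable
  note m = this[THEN measurable_compose[OF _ of_real]]
  show "pos_mult f \<in> borel_measurable lebesgue"
    unfolding pos_mult_def[abs_def] by (rule borel_measurable_times[OF m(1) assms])
  show "neg_mult f \<in> borel_measurable lebesgue"
    unfolding neg_mult_def[abs_def] by (rule borel_measurable_times[OF m(2) assms])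
qed

lemma neg_mult_L2:
  assumes f: "f \<in> H1"
  shows "neg_mult f \<in> L2" "(L2_norm (neg_mult f))\<^sup>2 \<le> \<mu> * (grad_norm f)\<^sup>2 + \<nu> * (L2_norm f)\<^sup>2"
proof -
  have eq: "(cmod (neg_mult f x))\<^sup>2 = neg_part V x * (cmod (f x))\<^sup>2" for x
    by (simp add: neg_mult_def norm_mult power_mult_distrib neg_part_def)
  have le: "(\<integral>\<^sup>+x. ennreal ((cmod (neg_mult f x))\<^sup>2) \<partial>lebesgue) \<le> ennreal (\<mu> * (grad_norm f)\<^sup>2 + \<nu> * (L2_norm f)\<^sup>2)"
    unfolding eq using bounded f by (simp add: form_bounded_def)
  then have "(\<integral>\<^sup>+x. ennreal ((cmod (neg_mult f x))\<^sup>2) \<partial>lebesgue) < \<infinity>"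
    by (rule order.strict_trans1) simp
  then show L2: "neg_mult f \<in> L2"
    unfolding L2_iff using mult_measurable(2)[OF L2_measurable[OF H1_L2[OF f]]] by simp
  show "(L2_norm (neg_mult f))\<^sup>2 \<le> \<mu> * (grad_norm f)\<^sup>2 + \<nu> * (L2_norm f)\<^sup>2"
    using le \<mu> \<nu> unfolding nn_integral_square[OF L2] by (subst (asm) ennreal_le_iff) auto
qed

lemma D_simps:
  "f \<in> D \<Longrightarrow> f \<in> H1" "f \<in> D \<Longrightarrow> f \<in> L2" "f \<in> D \<Longrightarrow> pos_mult f \<in> L2" "f \<in> D \<Longrightarrow> neg_mult f \<in> L2"
  by (auto simp: D_iff H1_L2 neg_mult_L2)

lemma form_sum_eq:
  assumes "f \<in> D" "g \<in> D"
  shows "form_sum V f g = grad_inner f g + (L2_inner (pos_mult f) (pos_mult g) - L2_inner (neg_mult f) (neg_mult g))"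
proof -
  have "complex_of_real (V x) * f x * cnj (g x) = pos_mult f x * cnj (pos_mult g x) - neg_mult f x * cnj (neg_mult g x)" for x
  proof -
    have eq: "complex_of_real (V x) = (complex_of_real (sqrt (pos_part V x)))\<^sup>2 - (complex_of_real (sqrt (neg_part V x)))\<^sup>2"
      unfolding of_real_power[symmetric] of_real_diff[symmetric] by (simp add: pos_part_def neg_part_def max_def)
    show ?thesis by (subst eq) (simp add: pos_mult_def neg_mult_def power2_eq_square algebra_simps)
  qed
  then show ?thesis
    unfolding form_sum_def L2_inner_def
    by (simp add: Bochner_Integration.integral_diff[OF L2_inner_integrable L2_inner_integrable] D_simps assms)
qed

definition Q :: "('a \<Rightarrow> complex) \<Rightarrow> ('a \<Rightarrow> complex) \<Rightarrow> complex" where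
  "Q f g = form_sum V f g + complex_of_real (\<nu> + 1) * L2_inner f g"

text \<open>The square of the natural norm of the form domain. \<open>Q_lower\<close> and
  \<open>Q_upper\<close> make it equivalent to \<open>Q\<close>, so completeness can be proved
  without V_-.\<close>

definition energy :: "('a \<Rightarrow> complex) \<Rightarrow> real" where
  "energy f = (grad_norm f)\<^sup>2 + (L2_norm (pos_mult f))\<^sup>2 + (L2_norm f)\<^sup>2"

lemma Q_self:
  assumes "f \<in> D"
  shows "Q f f = of_real ((grad_norm f)\<^sup>2 + ((L2_norm (pos_mult f))\<^sup>2 - (L2_norm (neg_mult f))\<^sup>2) + (\<nu> + 1) * (L2_norm f)\<^sup>2)"
  unfolding Q_def form_sum_eq[OF assms assms]
  using assms by (simp add: D_simps grad_inner_self L2.ip_self[unfolded L2_nrm])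

text \<open>By (ii) the negative part takes at most a share \<mu> of the gradient term and \<nu>
  times the squared norm. The shift by \<nu> + 1 repays the latter and leaves one squared norm, so a
  share 1 - \<mu> of the energy survives.\<close>

lemma Q_lower: "f \<in> D \<Longrightarrow> (1 - \<mu>) * energy f \<le> Re (Q f f)" "f \<in> D \<Longrightarrow> (L2_norm f)\<^sup>2 \<le> Re (Q f f)"
proof -
  assume f: "f \<in> D"
  have n: "(L2_norm (neg_mult f))\<^sup>2 \<le> \<mu> * (grad_norm f)\<^sup>2 + \<nu> * (L2_norm f)\<^sup>2"
    using neg_mult_L2(2) f by (simp add: D_simps)
  have "\<mu> * (L2_norm (pos_mult f))\<^sup>2 \<ge> 0" "\<mu> * (L2_norm f)\<^sup>2 \<ge> 0" "(1 - \<mu>) * (grad_norm f)\<^sup>2 \<ge> 0" "(L2_norm (pos_mult f))\<^sup>2 \<ge> 0"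
    using \<mu> by auto
  then show "(1 - \<mu>) * energy f \<le> Re (Q f f)" "(L2_norm f)\<^sup>2 \<le> Re (Q f f)"
    unfolding Q_self[OF f] energy_def Re_complex_of_real ring_distribs mult_1 using n by linarith+
qed

lemma Q_upper: "f \<in> D \<Longrightarrow> Re (Q f f) \<le> (\<nu> + 1) * energy f"
proof -
  assume f: "f \<in> D"
  have "\<nu> * (L2_norm (pos_mult f))\<^sup>2 \<ge> 0" "\<nu> * (grad_norm f)\<^sup>2 \<ge> 0" "(L2_norm (neg_mult f))\<^sup>2 \<ge> 0"
    using \<nu> by auto
  then show ?thesis unfolding Q_self[OF f] energy_def Re_complex_of_real by (simp add: algebra_simps)
qed

section \<open>Completeness of the form domain\<close>

lemma D_subspace: "fscale.subspace D"
proof (rule fscale.subspaceI)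
  show "0 \<in> D" using H1_AE_zero(1)[of "\<lambda>x. 0"] by (simp add: D_iff zero_fun_def pos_mult_def[abs_def])
next
  fix f g assume "f \<in> D" "g \<in> D"
  then show "f + g \<in> D" unfolding D_iff mult_linear using H1_add(1) L2.carrier_closed(2) by blast
next
  fix c f assume "f \<in> D"
  then show "fscale c f \<in> D" unfolding D_iff mult_linear using H1_scale(1) L2.carrier_closed(4) by blast
qed

text \<open>The functions, their multiples by the root of V_+ and their weak derivatives are all
  Cauchy in \<open>L2\<close>; the point is to recognise the three limits as belonging to one and
  the same \<open>f\<close>.\<close>

lemma energy_lim:
  assumes X: "\<And>n. X n \<in> D"
    and Cauchy: "\<And>e. e > 0 \<Longrightarrow> \<exists>N. \<forall>m\<ge>N. \<forall>n\<ge>N. energy (X m - X n) < e"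
  shows "\<exists>f\<in>D. (\<lambda>n. energy (X n - f)) \<longlonglongrightarrow> 0"
proof -
  have diff_D: "X m - X n \<in> D" for m n by (rule fscale.subspace_diff[OF D_subspace X X])
  have part: "\<exists>N. \<forall>m\<ge>N. \<forall>n\<ge>N. p (X m - X n) < e"
    if "e > 0" and "\<And>f. f \<in> D \<Longrightarrow> p f \<le> energy f" for p :: "_ \<Rightarrow> real" and e
    using Cauchy[OF that(1)] that(2)[OF diff_D] order.strict_trans1 by blast
  have sq: "(L2_norm f)\<^sup>2 = (LINT x|lebesgue. (cmod (f x))\<^sup>2)" for f :: "'a \<Rightarrow> complex" by (simp add: L2_norm_def)
  have C1: "\<exists>N. \<forall>m\<ge>N. \<forall>n\<ge>N. (LINT x|lebesgue. (cmod (X m x - X n x))\<^sup>2) < e" if "e > 0" for e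
    using part[OF that, of "\<lambda>f. (L2_norm f)\<^sup>2"] by (simp add: energy_def sq)
  have C2: "\<exists>N. \<forall>m\<ge>N. \<forall>n\<ge>N. (LINT x|lebesgue. (cmod (pos_mult (X m) x - pos_mult (X n) x))\<^sup>2) < e" if "e > 0" for e
    using part[OF that, of "\<lambda>f. (L2_norm (pos_mult f))\<^sup>2"] by (simp add: energy_def sq mult_linear)
  have XL: "X n \<in> L2" "pos_mult (X n) \<in> L2" "X n \<in> H1" for n using X D_simps by auto
  obtain r f where r: "\<And>k::nat. k \<le> r k" and fm: "f \<in> borel_measurable lebesgue"
    and ae: "AE x in lebesgue. (\<lambda>k. X (r k) x) \<longlonglongrightarrow> f x"
    using L2_Cauchy_AE_subsequence[OF XL(1) C1] by blast
  have 1: "f \<in> L2" "(\<lambda>n. LINT x|lebesgue. (cmod (X n x - f x))\<^sup>2) \<longlonglongrightarrow> 0"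
    using L2_Fatou[where Y = X and y = f and r = r, OF XL(1) fm ae r C1] by simp_all
  \<comment> \<open>The subsequence that converges to \<open>f\<close> almost everywhere still
    converges after multiplication, so \<open>L2_Fatou\<close> identifies the limit as
    \<open>pos_mult f\<close>.\<close>
  have "AE x in lebesgue. (\<lambda>k. pos_mult (X (r k)) x) \<longlonglongrightarrow> pos_mult f x"
    using ae unfolding pos_mult_def by eventually_elim (intro tendsto_intros)
  from L2_Fatou[where Y = "\<lambda>n. pos_mult (X n)" and y = "pos_mult f" and r = r, OF XL(2) mult_measurable(1)[OF fm] this r C2]
  have 2: "pos_mult f \<in> L2" "(\<lambda>n. LINT x|lebesgue. (cmod (pos_mult (X n) x - pos_mult f x))\<^sup>2) \<longlonglongrightarrow> 0"
    by simp_all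
  have lim1: "L2.lim_to X f"
    using XL(1) 1 tendsto_real_sqrt[OF 1(2)] by (simp add: L2.lim_to_def L2_nrm L2_norm_def)
  have wd: "L2_norm (weak_pderiv b (f - g)) = L2_norm (weak_pderiv b f - weak_pderiv b g)"
    if "f \<in> H1" "g \<in> H1" "b \<in> Basis" for f g b
  proof (rule L2_norm_cong_AE)
    show "AE x in lebesgue. cmod (weak_pderiv b (f - g) x) = cmod ((weak_pderiv b f - weak_pderiv b g) x)"
      using H1_diff(2)[OF that] by eventually_elim simp
    show "weak_pderiv b f - weak_pderiv b g \<in> L2"
      by (rule L2.carrier_closed(3)[OF weak_pderiv(1)[OF that(1,3)] weak_pderiv(1)[OF that(2,3)]])
    show "weak_pderiv b (f - g) \<in> L2"
      by (rule weak_pderiv(1)[OF H1_diff(1)[OF that(1,2)] that(3)])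
  qed
  have "\<exists>g. L2.lim_to (\<lambda>n. weak_pderiv b (X n)) g" if b: "b \<in> Basis" for b
  proof (rule L2.complete_nrm)
    show "weak_pderiv b (X n) \<in> L2" for n by (rule weak_pderiv(1)[OF XL(3) b])
    fix e :: real assume "e > 0"
    then have "e\<^sup>2 > 0" by simp
    have "(L2_norm (weak_pderiv b f))\<^sup>2 \<le> energy f" if "f \<in> D" for f
    proof -
      have "(L2_norm (weak_pderiv b f))\<^sup>2 \<le> (grad_norm f)\<^sup>2"
        unfolding grad_norm_square using b by (intro member_le_sum) auto
      then show ?thesis unfolding energy_def using zero_le_power2[of "L2_norm (pos_mult f)"] zero_le_power2[of "L2_norm f"] by linarith
    qed
    from part[OF \<open>e\<^sup>2 > 0\<close>, of "\<lambda>f. (L2_norm (weak_pderiv b f))\<^sup>2", OF this]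
    obtain N where N: "\<And>m n. m \<ge> N \<Longrightarrow> n \<ge> N \<Longrightarrow> (L2_norm (weak_pderiv b (X m - X n)))\<^sup>2 < e\<^sup>2" by blast
    have "L2.nrm (weak_pderiv b (X m) - weak_pderiv b (X n)) < e" if "m \<ge> N" "n \<ge> N" for m n
    proof -
      have "(L2_norm (weak_pderiv b (X m) - weak_pderiv b (X n)))\<^sup>2 < e\<^sup>2"
        using N[OF that] by (simp only: wd[OF XL(3) XL(3) b])
      then show ?thesis unfolding L2_nrm by (rule power2_less_imp_less) (use \<open>e > 0\<close> in simp)
    qed
    then show "\<exists>N. \<forall>m\<ge>N. \<forall>n\<ge>N. L2.nrm (weak_pderiv b (X m) - weak_pderiv b (X n)) < e" by blast
  qed
  then have "\<forall>b\<in>Basis. \<exists>g. L2.lim_to (\<lambda>n. weak_pderiv b (X n)) g" by (rule ballI)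
  from bchoice[OF this] obtain G where "\<forall>b\<in>Basis. L2.lim_to (\<lambda>n. weak_pderiv b (X n)) (G b)" ..
  then have G: "L2.lim_to (\<lambda>n. weak_pderiv b (X n)) (G b)" if "b \<in> Basis" for b
    using that by (rule bspec)
  have GL: "G b \<in> L2" "has_weak_pderiv f b (G b)" if b: "b \<in> Basis" for b
  proof -
    show "G b \<in> L2" using G[OF b] by (simp add: L2.lim_to_def)
    show "has_weak_pderiv f b (G b)"
      using weak_pderiv(2)[OF XL(3) b] lim1 G[OF b] b by (rule has_weak_pderiv_limit)
  qed
  have fH: "f \<in> H1" using 1(1) GL by (auto simp: H1_def)
  have fD: "f \<in> D" using fH 2(1) by (simp add: D_iff)
  have "(\<lambda>n. (L2_norm (weak_pderiv b (X n - f)))\<^sup>2) \<longlonglongrightarrow> 0" if b: "b \<in> Basis" for b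
  proof -
    have "L2_norm (weak_pderiv b (X n - f)) = L2_norm (weak_pderiv b (X n) - G b)" for n
    proof (rule L2_norm_cong_AE)
      show "AE x in lebesgue. cmod (weak_pderiv b (X n - f) x) = cmod ((weak_pderiv b (X n) - G b) x)"
        using H1_diff(2)[OF XL(3)[of n] fH b] weak_pderiv_eqI[OF fH b GL[OF b]] by eventually_elim simp
      show "weak_pderiv b (X n) - G b \<in> L2" using weak_pderiv(1)[OF XL(3) b] GL(1)[OF b] by (rule L2.carrier_closed(3))
      show "weak_pderiv b (X n - f) \<in> L2" by (rule weak_pderiv(1)[OF H1_diff(1)[OF XL(3) fH] b])
    qed
    then show ?thesis using tendsto_power[of _ 0 sequentially 2] G[OF b] by (simp add: L2.lim_to_def L2_nrm)
  qed
  then have "(\<lambda>n. \<Sum>b\<in>Basis. (L2_norm (weak_pderiv b (X n - f)))\<^sup>2) \<longlonglongrightarrow> (\<Sum>b\<in>(Basis::'a set). 0)"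
    by (rule tendsto_sum)
  then have "(\<lambda>n. (grad_norm (X n - f))\<^sup>2) \<longlonglongrightarrow> 0" unfolding grad_norm_square by simp
  moreover have "(\<lambda>n. (L2_norm (pos_mult (X n - f)))\<^sup>2) \<longlonglongrightarrow> 0" using 2(2) by (simp add: sq mult_linear)
  moreover have "(\<lambda>n. (L2_norm (X n - f))\<^sup>2) \<longlonglongrightarrow> 0" using 1(2) by (simp add: sq)
  ultimately have "(\<lambda>n. energy (X n - f)) \<longlonglongrightarrow> 0 + 0 + 0" unfolding energy_def by (intro tendsto_add)
  then show ?thesis using fD by auto
qed

sublocale form_domain: semi_hilbert fscale D "\<lambda>f g. form_sum V f g + complex_of_real (\<nu> + 1) * L2_inner f g"
proof (unfold_locales, fold Q_def)
  show "fscale.subspace D" by (rule D_subspace)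
next
  fix f g h assume *: "f \<in> D" "g \<in> D" "h \<in> D"
  have "f + g \<in> D" using fscale.subspace_add[OF D_subspace *(1,2)] .
  then show "Q (f + g) h = Q f h + Q g h"
    using * by (simp add: Q_def form_sum_eq mult_linear D_simps L2.ip_add_left grad_inner_add_left algebra_simps)
next
  fix c f g assume *: "f \<in> D" "g \<in> D"
  have "fscale c f \<in> D" using fscale.subspace_scale[OF D_subspace *(1)] .
  then show "Q (fscale c f) g = c * Q f g"
    using * by (simp add: Q_def form_sum_eq mult_linear D_simps L2.ip_scale_left grad_inner_scale_left algebra_simps)
next
  fix f g assume *: "f \<in> D" "g \<in> D"
  then show "Q g f = cnj (Q f g)"
    using L2.ip_commute[of f g] L2.ip_commute[of "pos_mult f" "pos_mult g"] L2.ip_commute[of "neg_mult f" "neg_mult g"]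
      grad_inner_commute[of f g]
    by (simp add: Q_def form_sum_eq D_simps)
next
  fix f assume "f \<in> D"
  then show "0 \<le> Re (Q f f)" using Q_lower(2) zero_le_power2 order_trans by blast
next
  fix X :: "nat \<Rightarrow> 'a \<Rightarrow> complex"
  assume X: "\<And>n. X n \<in> D" and C: "\<And>e. e > 0 \<Longrightarrow> \<exists>N. \<forall>m\<ge>N. \<forall>n\<ge>N. Re (Q (X m - X n) (X m - X n)) < e"
  have diff_D: "X m - X n \<in> D" for m n by (rule fscale.subspace_diff[OF D_subspace X X])
  have "\<exists>N. \<forall>m\<ge>N. \<forall>n\<ge>N. energy (X m - X n) < e" if "e > 0" for e
  proof -
    have "(1 - \<mu>) * e > 0" using that \<mu> by simp
    from C[OF this] obtain N where N: "\<And>m n. m \<ge> N \<Longrightarrow> n \<ge> N \<Longrightarrow> Re (Q (X m - X n) (X m - X n)) < (1 - \<mu>) * e" by blast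
    have "energy (X m - X n) < e" if "m \<ge> N" "n \<ge> N" for m n
      using order.strict_trans1[OF Q_lower(1)[OF diff_D] N[OF that]] \<mu> by simp
    then show ?thesis by blast
  qed
  from energy_lim[OF X this] obtain f where f: "f \<in> D" "(\<lambda>n. energy (X n - f)) \<longlonglongrightarrow> 0" by blast
  have "(\<lambda>n. Re (Q (X n - f) (X n - f))) \<longlonglongrightarrow> 0"
  proof (rule Lim_null_comparison)
    show "\<forall>\<^sub>F n in sequentially. norm (Re (Q (X n - f) (X n - f))) \<le> (\<nu> + 1) * energy (X n - f)"
    proof (intro always_eventually allI)
      fix n
      have "X n - f \<in> D" by (rule fscale.subspace_diff[OF D_subspace X f(1)])
      from Q_upper[OF this] order_trans[OF zero_le_power2 Q_lower(2)[OF this]]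
      show "norm (Re (Q (X n - f) (X n - f))) \<le> (\<nu> + 1) * energy (X n - f)" by simp
    qed
    show "(\<lambda>n. (\<nu> + 1) * energy (X n - f)) \<longlonglongrightarrow> 0" using f(2) by (rule tendsto_mult_right_zero)
  qed
  then show "\<exists>f\<in>D. (\<lambda>n. Re (Q (X n - f) (X n - f))) \<longlonglongrightarrow> 0" using f(1) by blast
qed

text \<open>V_+ is integrable over the compact support of \<phi> and \<phi>^2 is bounded. This is
  where local integrability makes the form densely defined.\<close>

lemma test_function_D:
  assumes "test_function \<phi>" shows "(\<lambda>x. complex_of_real (\<phi> x)) \<in> D"
proof -
  note C1 = test_function_C1[OF assms]
  have "pos_mult (\<lambda>x. complex_of_real (\<phi> x)) \<in> L2"
  proof -
    have K: "compact (closure {x. \<phi> x \<noteq> 0})" using assms by (simp add: test_function_def)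
    have pp: "set_integrable lebesgue (closure {x. \<phi> x \<noteq> 0}) (pos_part V)"
    proof -
      have i: "set_integrable lebesgue (closure {x. \<phi> x \<noteq> 0}) V" using V_loc K by (simp add: locally_integrable_def)
      have "pos_part V x = (\<bar>V x\<bar> + V x) / 2" for x by (simp add: pos_part_def max_def)
      then have "pos_part V = (\<lambda>x. (\<bar>V x\<bar> + V x) / 2)" by (rule ext)
      then show ?thesis using set_integral_add(1)[OF set_integrable_abs[OF i] i] by (simp add: set_integrable_divide)
    qed
    have "integrable lebesgue (\<lambda>x. (\<phi> x)\<^sup>2 *\<^sub>R pos_part V x)"
    proof (rule continuous_compact_support_integrable[OF _ K _ pp])
      show "continuous_on UNIV (\<lambda>x. (\<phi> x)\<^sup>2)" by (intro continuous_intros C1_compact_continuous[OF C1])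
      fix x assume "x \<notin> closure {x. \<phi> x \<noteq> 0}"
      then have "\<phi> x = 0" by (rule zero_outside_closure)
      then show "(\<phi> x)\<^sup>2 = 0" by simp
    qed
    moreover have "(cmod (pos_mult (\<lambda>x. complex_of_real (\<phi> x)) x))\<^sup>2 = (\<phi> x)\<^sup>2 *\<^sub>R pos_part V x" for x
      by (simp add: pos_mult_def norm_mult power_mult_distrib pos_part_def)
    ultimately show ?thesis
      using mult_measurable(1)[OF L2_measurable[OF C1_compact_L2(1)[OF C1]]] by (simp add: L2_def)
  qed
  then show ?thesis using test_function_H1[OF assms] by (simp add: D_iff)
qed

end

locale schroedinger_confining = schroedinger +
  assumes small: "\<And>t. t > 0 \<Longrightarrow> ((\<lambda>a. measure lebesgue {x \<in> cball a 1. V x < t}) \<longlongrightarrow> 0) at_infinity"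
begin

sublocale form_space fscale L2 L2_inner D "form_sum V" "\<nu> + 1"
proof (unfold_locales, fold Q_def)
  show "D \<subseteq> L2" using D_simps by auto
next
  fix f assume "f \<in> D"
  then show "Re (L2_inner f f) \<le> Re (Q f f)" using Q_lower(2) by (simp add: L2.nrm_square[unfolded L2_nrm] D_simps)
next
  fix f :: "'a \<Rightarrow> complex" assume f: "f \<in> L2" and "L2_inner f f = 0"
  then have n0: "L2_norm f = 0" by (simp add: L2_norm_eq)
  then have ae: "AE x in lebesgue. f x = 0" using L2_norm_zero_iff[OF f] by simp
  have ae': "AE x in lebesgue. pos_mult f x = 0" "AE x in lebesgue. neg_mult f x = 0"
    using ae by (eventually_elim, simp add: pos_mult_def neg_mult_def)+
  have L: "pos_mult f \<in> L2" "neg_mult f \<in> L2" using L2_cong_AE[OF L2_zero ae'(1)] L2_cong_AE[OF L2_zero ae'(2)] .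
  have fD: "f \<in> D" using H1_AE_zero(1)[OF f ae] L by (simp add: D_iff)
  have "(grad_norm f)\<^sup>2 = 0" unfolding grad_norm_square using H1_AE_zero(2)[OF f ae] by simp
  moreover have "L2_norm (pos_mult f) = 0" "L2_norm (neg_mult f) = 0"
    using ae' L2_norm_zero_iff L by auto
  ultimately have "Q f f = 0" unfolding Q_self[OF fD] using n0 by simp
  then show "f \<in> D \<and> Q f f = 0" using fD by simp
next
  fix g :: "'a \<Rightarrow> complex" assume g: "g \<in> L2" and orth: "\<And>f. f \<in> D \<Longrightarrow> L2_inner g f = 0"
  have "AE x in lebesgue. g x = 0"
    by (rule L2_AE_zero_if_orthogonal_to_test_functions[OF g orth[OF test_function_D]])
  then show "L2_inner g g = 0" using L2_norm_zero_iff[OF g] L2.ip_self[OF g] by (simp add: L2_nrm)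
next
  fix \<delta> :: real assume \<delta>: "\<delta> > 0"
  \<comment> \<open>\<open>Q_lower\<close> bounds (1 - \<mu>) times the energy by the form, so the
    factor 1 - \<mu> is put into \<delta> beforehand.\<close>
  have "\<delta> * (1 - \<mu>) > 0" using \<delta> \<mu> by simp
  from compactness_inequality[OF V_measurable small this]
  obtain F C where F: "finite F" "F \<subseteq> L2" "0 \<le> C" and
    le: "\<forall>f\<in>D. (L2_norm f)\<^sup>2 \<le> \<delta> * (1 - \<mu>) *
      ((grad_norm f)\<^sup>2 + (L2_norm (\<lambda>x. complex_of_real (sqrt (pos_part V x)) * f x))\<^sup>2 + (L2_norm f)\<^sup>2) +
      C * (\<Sum>e\<in>F. (cmod (L2_inner f e))\<^sup>2)" by auto
  have "Re (L2_inner f f) \<le> \<delta> * Re (Q f f) + C * (\<Sum>e\<in>F. (cmod (L2_inner f e))\<^sup>2)" if f: "f \<in> D" for f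
  proof -
    have "(L2_norm f)\<^sup>2 \<le> \<delta> * ((1 - \<mu>) * energy f) + C * (\<Sum>e\<in>F. (cmod (L2_inner f e))\<^sup>2)"
      using le f by (simp add: energy_def pos_mult_def[abs_def] mult.assoc)
    also have "\<delta> * ((1 - \<mu>) * energy f) \<le> \<delta> * Re (Q f f)" using Q_lower(1)[OF f] \<delta> by (intro mult_left_mono) auto
    finally show ?thesis using f by (simp add: L2.nrm_square[unfolded L2_nrm] D_simps)
  qed
  then show "\<exists>F C. finite F \<and> F \<subseteq> L2 \<and> 0 \<le> C \<and> (\<forall>f\<in>D. Re (L2_inner f f) \<le>
      \<delta> * Re (Q f f) + C * (\<Sum>e\<in>F. (cmod (L2_inner f e))\<^sup>2))"
    using F by blast
qed

end

section \<open>Transfer from the abstract operator to the concrete spectral notions\<close>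

lemma sum_fun_apply: "(\<Sum>b\<in>B. F b) x = (\<Sum>b\<in>B. (F b x :: complex))"
  by (induction B rule: infinite_finite_induct) auto

context schroedinger_confining
begin

text \<open>Both graphs consist of pairs of representatives, so they agree literally and no quotient
  has to be unfolded.\<close>

lemma schroedinger_operator_eq: "schroedinger_operator V = H"
  by (simp add: schroedinger_operator_def form_operator_def H_def)

lemma self_adjoint_schroedinger: "self_adjoint (schroedinger_operator V)"
  unfolding self_adjoint_def schroedinger_operator_eq
proof
  show "densely_defined H"
    unfolding densely_defined_def using H_densely_defined[unfolded L2_nrm diff_fun_eq] by blast
  show "adjoint_operator H = H"
    unfolding adjoint_operator_def by (rule H_adjoint)
qed

text \<open>By contraposition a point of the spectrum is not \<open>resolvent\<close>, the form in
  which the abstract results take it. Seminorm zero becomes equality almost everywhere.\<close>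

lemma resolvent_in_resolvent_set:
  assumes "resolvent z" shows "z \<in> resolvent_set H"
proof -
  obtain C where C: "\<forall>g\<in>L2. \<exists>f. (f, g + fscale z f) \<in> H \<and> L2.nrm f \<le> C * L2.nrm g \<and>
      (\<forall>f'. (f', g + fscale z f') \<in> H \<longrightarrow> L2.nrm (f' - f) = 0)"
    using assms unfolding resolvent_def by (elim exE)
  have "\<exists>f. (f, \<lambda>x. g x + z * f x) \<in> H \<and> L2_norm f \<le> C * L2_norm g \<and>
      (\<forall>f'. (f', \<lambda>x. g x + z * f' x) \<in> H \<longrightarrow> (AE x in lebesgue. f' x = f x))" if g: "g \<in> L2" for g
  proof -
    obtain f where f: "(f, g + fscale z f) \<in> H" "L2.nrm f \<le> C * L2.nrm g"
      and uniq: "\<forall>f'. (f', g + fscale z f') \<in> H \<longrightarrow> L2.nrm (f' - f) = 0"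
      using bspec[OF C g] by (elim exE conjE)
    have "AE x in lebesgue. f' x = f x" if f': "(f', \<lambda>x. g x + z * f' x) \<in> H" for f'
    proof -
      have "L2_norm (f' - f) = 0" using uniq f' by (simp add: plus_fun_def L2_nrm)
      moreover have "f' - f \<in> L2" using H_D(2)[OF f'] H_D(2)[OF f(1)] by (rule L2.carrier_closed(3))
      ultimately have "AE x in lebesgue. (f' - f) x = 0" using L2_norm_zero_iff by blast
      then show ?thesis by eventually_elim simp
    qed
    then show ?thesis using f by (intro exI[of _ f]) (simp add: plus_fun_def L2_nrm)
  qed
  then show ?thesis unfolding resolvent_set_def by blast
qed

lemma purely_discrete_schroedinger: "purely_discrete_spectrum (schroedinger_operator V)"
proof -
  have "z \<in> discrete_spectrum H" if z: "z \<in> spectrum H" for z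
  proof -
    have nr: "\<not> resolvent w" if "w \<in> spectrum H" for w
      using that resolvent_in_resolvent_set by (auto simp: spectrum_def)
    obtain e where "e > 0" "\<forall>w. \<not> resolvent w \<longrightarrow> dist z w < e \<longrightarrow> w = z"
      using spectrum_isolated[OF nr[OF z]] by blast
    then have "z isolated_in spectrum H"
      unfolding isolated_in_dist_Ex_iff using z nr by blast
    moreover have "eigenvalue H z"
    proof -
      obtain f where f: "(f, fscale z f) \<in> H" "L2.nrm f = 1"
        using spectrum_eigenvalue[OF nr[OF z]] by blast
      then have "\<not> (AE x in lebesgue. f x = 0)"
        using L2_norm_zero_iff[OF H_D(2)[OF f(1)]] by (simp add: L2_nrm)
      then show ?thesis using f(1) by (auto simp: eigenvalue_def eigenspace_def)
    qed
    moreover have "finite_dimensional (eigenspace H z)"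
    proof -
      obtain B where B: "B \<subseteq> {f. (f, fscale z f) \<in> H}" "finite B"
        and span: "\<forall>f\<in>{f. (f, fscale z f) \<in> H}. \<exists>a. L2.nrm (f - (\<Sum>b\<in>B. fscale (a b) b)) = 0"
        using eigenspace_finite_dimensional[of z] by (elim exE conjE)
      have "\<exists>a. AE x in lebesgue. f x = (\<Sum>b\<in>B. a b * b x)" if f: "(f, fscale z f) \<in> H" for f
      proof -
        obtain a where a: "L2.nrm (f - (\<Sum>b\<in>B. fscale (a b) b)) = 0" using span f by blast
        have "fscale (a b) b \<in> L2" if "b \<in> B" for b using B(1) that H_D(2) by (intro L2.carrier_closed(4)) blast
        then have "(\<Sum>b\<in>B. fscale (a b) b) \<in> L2" by (intro fscale.subspace_sum[OF L2_subspace])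
        then have "f - (\<Sum>b\<in>B. fscale (a b) b) \<in> L2" using H_D(2)[OF f] by (intro L2.carrier_closed(3))
        then have "AE x in lebesgue. (f - (\<Sum>b\<in>B. fscale (a b) b)) x = 0"
          using a unfolding L2_nrm by (subst (asm) L2_norm_zero_iff)
        then have "AE x in lebesgue. f x = (\<Sum>b\<in>B. a b * b x)"
          by eventually_elim (simp add: sum_fun_apply)
        then show ?thesis by blast
      qed
      then show ?thesis
        unfolding finite_dimensional_def eigenspace_def using B by (intro exI[of _ B]) simp
    qed
    ultimately show ?thesis by (simp add: discrete_spectrum_def)
  qed
  then show ?thesis
    unfolding purely_discrete_spectrum_def essential_spectrum_def schroedinger_operator_eq by blast
qed

end

theorem proposition1:
  fixes V :: "real ^ 'n \<Rightarrow> real" and \<mu> \<nu> :: real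
  assumes "locally_integrable V"
    and "\<And>t::real. t > 0 \<Longrightarrow>
      ((\<lambda>a. measure lebesgue {x \<in> cball a 1. V x < t}) \<longlongrightarrow> 0) at_infinity"
    and "0 < \<mu>" and "\<mu> < 1" and "0 < \<nu>"
    and "form_bounded (neg_part V) \<mu> \<nu>"
  shows "self_adjoint (schroedinger_operator V) \<and>
    purely_discrete_spectrum (schroedinger_operator V)"
proof -
  interpret schroedinger_confining V \<mu> \<nu>
    using assms by unfold_locales
  show ?thesis
    using self_adjoint_schroedinger purely_discrete_schroedinger by (rule conjI)
qed

end
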